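(* Every $3$-oriented Spherical Diagram has at least eight swirls and at least $12$ arcs. Moreover, there exists a $3$-oriented Spherical Occlusion Diagram with exactly eight swirls and exactly $12$ arcs.
   Context: A geodesic arc on the unit sphere in $\mathbb R^3$ is the unique shortest curve joining two non-antipodal points. An arc $a$ blocks an arc $b$ (equivalently, $b$ hits $a$) if an endpoint of $b$ lies in the relative interior of $a$. A Spherical Diagram (SD) is a finite non-empty collection $\mathcal D$ of pairwise interior-disjoint geodesic arcs on the unit sphere such that each arc of $\mathcal D$ is blocked by arcs of $\mathcal D$ at each of its endpoints. A Spherical Occlusion Diagram (SOD) is an SD such that all arcs of $\mathcal D$ that hit the same arc of $\mathcal D$ reach it from the same side. A swirl of an SD is a cycle of arcs, each of which hits the next (and the last hits the first), going either all clockwise or all counterclockwise. An SD $\mathcal D$ is $k$-oriented if there exist a set $P$ of $k$ points on the unit sphere (poles), no two antipodal, and a function $f\colon\mathcal D\to P$ such that each arc $a\in\mathcal D$ lies on a great circle through $f(a)$ but contains neither $f(a)$ nor its antipode $-f(a)$. *)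

theory Defs
  imports "HOL-Analysis.Analysis"
begin

definition S2 :: "(real^3) set" where
  "S2 = sphere 0 1"

text \<open>A geodesic arc is represented by the ordered pair of its endpoints
  (the pairs (u,v) and (v,u) describe the same point set).\<close>
type_synonym arc = "(real^3) \<times> (real^3)"

definition valid_arc :: "arc \<Rightarrow> bool" where
  "valid_arc a \<longleftrightarrow> fst a \<in> S2 \<and> snd a \<in> S2 \<and> fst a \<noteq> snd a \<and> fst a \<noteq> - snd a"

text \<open>The shortest great-circle arc from u to v is the radial projection of
  the chord [u,v] onto the sphere; its relative interior is the projection of
  the open chord.\<close>
definition arc_points :: "arc \<Rightarrow> (real^3) set" where
  "arc_points a = (\<lambda>x. x /\<^sub>R norm x) ` closed_segment (fst a) (snd a)"

definition arc_relint :: "arc \<Rightarrow> (real^3) set" where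
  "arc_relint a = (\<lambda>x. x /\<^sub>R norm x) ` open_segment (fst a) (snd a)"

definition endpoints :: "arc \<Rightarrow> (real^3) set" where
  "endpoints a = {fst a, snd a}"

definition arc_normal :: "arc \<Rightarrow> real^3" where
  "arc_normal a = cross3 (fst a) (snd a)"

definition blocks :: "arc \<Rightarrow> arc \<Rightarrow> bool" where
  "blocks a b \<longleftrightarrow> (\<exists>e\<in>endpoints b. e \<in> arc_relint a)"

definition hits :: "arc \<Rightarrow> arc \<Rightarrow> bool" where
  "hits b a \<longleftrightarrow> blocks a b"

definition SD :: "arc set \<Rightarrow> bool" where
  "SD D \<longleftrightarrow> finite D \<and> D \<noteq> {} \<and> (\<forall>a\<in>D. valid_arc a)
     \<and> (\<forall>a\<in>D. \<forall>b\<in>D. a \<noteq> b \<longrightarrow> arc_relint a \<inter> arc_relint b = {})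
     \<and> (\<forall>a\<in>D. \<forall>e\<in>endpoints a. \<exists>c\<in>D. e \<in> arc_relint c)"

text \<open>An arc b reaches the arc a (at its endpoint e, the other endpoint being w)
  from the side of the great circle of a containing w; the side is the sign of
  (normal of a) . w.\<close>
definition SOD :: "arc set \<Rightarrow> bool" where
  "SOD D \<longleftrightarrow> SD D \<and>
     (\<forall>a\<in>D. \<forall>b\<in>D. \<forall>c\<in>D. \<forall>e w e' w'.
        (e, w) \<in> {b, prod.swap b} \<and> e \<in> arc_relint a \<and>
        (e', w') \<in> {c, prod.swap c} \<and> e' \<in> arc_relint a \<longrightarrow>
        sgn (arc_normal a \<bullet> w) = sgn (arc_normal a \<bullet> w'))"

text \<open>A swirl: a cyclic list of distinct arcs xs!0, ..., xs!(n-1) of D such that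
  xs!i hits xs!((i+1) mod n) at its endpoint ps!i (the other endpoint being qs!i),
  and all turns have the same orientation.  The turn at ps!i, going in along
  xs!i (from qs!i) and out along the next arc towards ps!(i+1), is
  counterclockwise (seen from outside the sphere) iff det(q_i, p_i, p_(i+1)) > 0.\<close>
definition swirl :: "arc set \<Rightarrow> arc list \<Rightarrow> bool" where
  "swirl D xs \<longleftrightarrow> xs \<noteq> [] \<and> distinct xs \<and> set xs \<subseteq> D \<and>
     (\<exists>ps qs. length ps = length xs \<and> length qs = length xs \<and>
        (\<forall>i<length xs. (ps!i, qs!i) \<in> {xs!i, prod.swap (xs!i)}
                        \<and> ps!i \<in> arc_relint (xs!((i+1) mod length xs))) \<and>
        ((\<forall>i<length xs. cross3 (qs!i) (ps!i) \<bullet> ps!((i+1) mod length xs) > 0) \<or>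
         (\<forall>i<length xs. cross3 (qs!i) (ps!i) \<bullet> ps!((i+1) mod length xs) < 0)))"

text \<open>A swirl is identified (up to cyclic rotation) with its set of hitting edges.\<close>
definition swirl_edges :: "arc list \<Rightarrow> (arc \<times> arc) set" where
  "swirl_edges xs = {(xs!i, xs!((i+1) mod length xs)) | i. i < length xs}"

definition swirls :: "arc set \<Rightarrow> (arc \<times> arc) set set" where
  "swirls D = swirl_edges ` {xs. swirl D xs}"

definition k_oriented :: "nat \<Rightarrow> arc set \<Rightarrow> bool" where
  "k_oriented k D \<longleftrightarrow> (\<exists>P f. card P = k \<and> P \<subseteq> S2 \<and> (\<forall>p\<in>P. \<forall>q\<in>P. q \<noteq> - p) \<and>
     (\<forall>a\<in>D. f a \<in> P \<and> arc_normal a \<bullet> f a = 0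
              \<and> f a \<notin> arc_points a \<and> - f a \<notin> arc_points a))"

end

(* Each of the three pole types is an axis after a linear change of coordinates, and the eight sign
   patterns of the coordinates cut the sphere into octants. Fix a sign pattern s and walk along the
   arcs, always heading for the poles with the signs of s. Positive combinations of poles are added
   all the time, so a walk with one coordinate of the right sign ends in a cycle inside the octant
   of s, and this cycle uses all three types. An arc meets at most two octants, which gives 12 arcs.

   Projecting the octant centrally to the plane, take among all cycles of arcs there one whose highest
   vertex is lowest and, among these, one with the fewest turns away from its inside. At such a wrong turn the
   blocking arc extends into the inside, where a walk that turns to the other side at every hit
   stays until it closes a lower cycle or cuts off a part of the old one with fewer wrong turns.
   Hence the minimal cycle turns in one direction only: each octant contains a swirl. *)

theory Submission
  imports Defs
begin

section \<open>The winding function of a polygon\<close>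

text \<open>The polygon of a ring may be far from convex, so its inside is taken to be the set of
  points from which it is seen under a nonzero total angle. This angle has one value,
  \<open>corner_value\<close>, on all open edges and is 2 pi smaller just to the right of each. At
  the highest vertex the backward extension of the next arc lies outside; this fixes the value as 0
  or 2 pi and decides which turns are wrong. From then on, coming from the inside is a comparison of
  angles. An obstacle is that only the heads of the arcs of a ring are known to lie in the octant. A
  walk cannot slip out through the boundary of the octant, because the region of nonzero angle lies
  in a triangle whose closed cone is, apart from the origin, contained in the open octant. Linear
  independence of the poles is not part of the definition. It comes from the argument that also
  yields the octants: if the poles were coplanar, a cycle whose headings all lie on one side of a
  suitable plane would itself lie in the plane of the poles, and hits are never coplanar.\<close>

definition edge_angle :: "(nat \<Rightarrow> complex) \<Rightarrow> complex \<Rightarrow> nat \<Rightarrow> real" where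
  "edge_angle P v i = Arg ((P (Suc i) - v) / (P i - v))"

text \<open>This is 2 pi times the usual winding number. Through \<open>Arg\<close> it has a value
  on the edges too.\<close>

definition winding :: "(nat \<Rightarrow> complex) \<Rightarrow> nat \<Rightarrow> complex \<Rightarrow> real" where
  "winding P n v = (\<Sum>i<n. edge_angle P v i)"

text \<open>Each edge keeps its start and drops its end, so a closed polygon is simple exactly if
  its half-edges are pairwise disjoint.\<close>

definition half_edge :: "(nat \<Rightarrow> complex) \<Rightarrow> nat \<Rightarrow> complex set" where
  "half_edge P i = closed_segment (P i) (P (Suc i)) - {P (Suc i)}"

definition polygon_path :: "(nat \<Rightarrow> complex) \<Rightarrow> nat \<Rightarrow> complex set" where
  "polygon_path P n = (\<Union>i<n. closed_segment (P i) (P (Suc i)))"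

text \<open>The values of \<open>f\<close> lie in one coset of 2 pi Z, which is discrete. All
  comparisons of angles along paths below reduce to this.\<close>

lemma continuous_cis_constant:
  fixes f :: "'a::topological_space \<Rightarrow> real"
  assumes S: "connected S" and f: "continuous_on S f"
    and c: "\<And>s. s \<in> S \<Longrightarrow> cis (f s) = c" and "x \<in> S" "y \<in> S"
  shows "f x = f y"
proof -
  have "f constant_on S"
  proof (rule continuous_discrete_range_constant [OF S f])
    fix x assume x: "x \<in> S"
    have "pi \<le> norm (f y - f x)" if y: "y \<in> S \<and> f y \<noteq> f x" for y
    proof (rule ccontr)
      assume "\<not> ?thesis"
      then have less: "\<bar>f y - f x\<bar> < pi" by simp
      have "cis (f y - f x) = 1"
        using c[OF x] c[of y] y by (simp flip: cis_divide) (metis cis_neq_zero divide_self)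
      then have "Arg (cis (f y - f x)) = 0" by simp
      moreover have "Arg (cis (f y - f x)) = f y - f x"
        by (rule Arg_cis) (use less in auto)
      ultimately show False using y by simp
    qed
    then show "\<exists>e>0. \<forall>y. y \<in> S \<and> f y \<noteq> f x \<longrightarrow> e \<le> norm (f y - f x)"
      using pi_gt_zero by blast
  qed
  then show ?thesis using assms(4,5) unfolding constant_on_def by auto
qed

text \<open>The branch cut of \<open>Arg\<close> is met only on the edge itself. The case
  \<open>v = a\<close> arises from division by zero.\<close>

lemma nonpos_ratio_in_segment:
  fixes a b v :: complex
  assumes "(b - v) / (a - v) \<in> \<real>\<^sub>\<le>\<^sub>0"
  shows "v \<in> closed_segment a b \<or> v = a"
proof (cases "a = v")
  case False
  obtain r where r: "r \<le> 0" "(b - v) / (a - v) = of_real r"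
    using assms by (auto simp: nonpos_Reals_def)
  then have "b - v = of_real r * (a - v)" using False by (simp add: field_simps)
  then have "v * of_real (1 - r) = b - of_real r * a" by (simp add: algebra_simps)
  then have "v = (b - of_real r * a) / of_real (1 - r)" using r by (simp add: field_simps flip: of_real_diff)
  also have "\<dots> = (1 - 1/(1-r)) *\<^sub>R a + (1/(1-r)) *\<^sub>R b"
    using r by (simp add: scaleR_conv_of_real divide_simps)
  finally have "v = (1 - 1/(1-r)) *\<^sub>R a + (1/(1-r)) *\<^sub>R b" .
  then show ?thesis unfolding in_segment using r by (intro disjI1 exI[of _ "1/(1-r)"]) (auto simp: divide_simps)
qed auto

lemma continuous_on_edge_angle:
  assumes "continuous_on S g" "\<And>s. s \<in> S \<Longrightarrow> g s \<notin> closed_segment (P i) (P (Suc i))"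
  shows "continuous_on S (\<lambda>s. edge_angle P (g s) i)"
  unfolding edge_angle_def
proof (rule continuous_on_Arg')
  show "continuous_on S (\<lambda>s. (P (Suc i) - g s) / (P i - g s))"
    using assms by (intro continuous_intros) (auto, metis ends_in_segment(1))
  show "\<And>s. s \<in> S \<Longrightarrow> (P (Suc i) - g s) / (P i - g s) \<notin> \<real>\<^sub>\<le>\<^sub>0"
    using assms(2) nonpos_ratio_in_segment by (metis ends_in_segment(1))
qed

text \<open>The quotients inside the \<open>Arg\<close> terms telescope. Over a full period the sum
  is therefore a multiple of 2 pi.\<close>

lemma cis_sum_edge_angle:
  assumes "a \<le> b" "\<And>i. a \<le> i \<Longrightarrow> i \<le> b \<Longrightarrow> P i \<noteq> v"
  shows "cis (\<Sum>i=a..<b. edge_angle P v i) = sgn ((P b - v) / (P a - v))"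
  using assms
proof (induction b rule: dec_induct)
  case base
  then show ?case by (simp add: sgn_one)
next
  case (step b)
  have ne: "P b - v \<noteq> 0" "P (Suc b) - v \<noteq> 0" "P a - v \<noteq> 0" using step by auto
  have "cis (edge_angle P v b) = sgn ((P (Suc b) - v) / (P b - v))"
    unfolding edge_angle_def by (rule cis_Arg) (use ne in auto)
  then have "cis (\<Sum>i=a..<Suc b. edge_angle P v i)
      = sgn ((P b - v) / (P a - v)) * sgn ((P (Suc b) - v) / (P b - v))"
    using step by (simp flip: cis_mult)
  also have "\<dots> = sgn ((P b - v) / (P a - v) * ((P (Suc b) - v) / (P b - v)))"
    by (simp only: sgn_mult)
  also have "\<dots> = sgn ((P (Suc b) - v) / (P a - v))" using ne by simp
  finally show ?case .
qed

text \<open>Seen from \<open>v\<close>, all vertices lie within a right angle of the direction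
  \<open>w\<close>. Angles relative to \<open>w\<close> then form a single branch \<open>A\<close>,
  the edge angles are its differences, and these sum to zero over a period.\<close>

lemma winding_half_plane:
  assumes per: "P n = P 0" and w: "w \<noteq> 0" and h: "\<And>i. Re (cnj w * (P i - v)) > 0"
  shows "winding P n v = 0"
proof -
  define A where "A i = Arg ((P i - v) / w)" for i
  have pos: "Re ((P i - v) / w) > 0" for i
  proof -
    have "(P i - v) / w = (cnj w * (P i - v)) / of_real ((cmod w)\<^sup>2)"
      using w unfolding complex_norm_square by (simp add: field_simps)
    then have "Re ((P i - v) / w) = Re (cnj w * (P i - v)) / (cmod w)\<^sup>2" by (simp only: Re_divide_of_real)
    then show ?thesis using h[of i] w by simp
  qed
  then have A: "\<bar>A i\<bar> < pi/2" for i unfolding A_def using Arg_Re_pos[of "(P i - v) / w"] by blast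
  have ne: "(P i - v) / w \<noteq> 0" for i using pos[of i] by (metis less_irrefl zero_complex.simps(1))
  have "edge_angle P v i = A (Suc i) - A i" for i
  proof -
    have 1: "(P (Suc i) - v) / (P i - v) = ((P (Suc i) - v) / w) / ((P i - v) / w)" using w by simp
    have "A (Suc i) - A i \<in> {-pi<..pi}" using A[of i] A[of "Suc i"] by auto
    then show ?thesis unfolding edge_angle_def 1 A_def using ne[of i] ne[of "Suc i"] by (subst Arg_divide') auto
  qed
  then have "winding P n v = A n - A 0" unfolding winding_def by (simp add: sum_lessThan_telescope)
  then show ?thesis by (simp add: A_def per)
qed

lemma mod_add_right_cancel_nat:
  assumes "(i + k) mod n = (j + k) mod n" "i < n" "j < (n::nat)"
  shows "i = j"
proof -
  have "(int i + int k) mod int n = (int j + int k) mod int n"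
    using assms(1) by (metis of_nat_add of_nat_mod)
  then have "int n dvd int i - int j" by (simp add: mod_eq_dvd_iff)
  then show ?thesis using assms(2,3) zdvd_imp_le[of "int n" "int i - int j"] zdvd_imp_le[of "int n" "int j - int i"]
    by (cases "i = j"; cases "i < j") (auto simp: dvd_diff_commute)
qed

text \<open>Vertices are a periodic sequence, so the corner where the index wraps around is no
  special case. The condition \<open>corner\<close> rules out straight and reversing corners: each
  corner is a left or a right turn.\<close>

locale polygon =
  fixes P :: "nat \<Rightarrow> complex" and n :: nat
  assumes periodic: "P (i + n) = P i"
    and n_pos: "n > 0"
    and simple: "i < n \<Longrightarrow> j < n \<Longrightarrow> i \<noteq> j \<Longrightarrow> half_edge P i \<inter> half_edge P j = {}"
    and corner: "Im ((P (Suc (Suc i)) - P (Suc i)) / (P (Suc i) - P i)) \<noteq> 0"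
begin

lemma mod_eq: "P (i mod n) = P i"
proof -
  have "P (k + m * n) = P k" for k m
    by (induction m) (auto simp: periodic add.assoc[symmetric] add.commute[of n])
  then show ?thesis by (metis mod_div_mult_eq)
qed

lemma edge_ne: "P (Suc i) \<noteq> P i"
  using corner[of i] by auto

lemma n_ge3: "n \<ge> 3"
proof -
  have "n \<noteq> 1" using edge_ne[of 0] periodic[of 0] by auto
  moreover have "n \<noteq> 2"
  proof
    assume "n = 2"
    then have "P (Suc (Suc 0)) = P 0" using periodic[of 0] by (simp add: numeral_2_eq_2)
    moreover have "(P 0 - P (Suc 0)) / (P (Suc 0) - P 0) = -1" using edge_ne[of 0] by (simp add: field_simps)
    ultimately show False using corner[of 0] by simp
  qed
  ultimately show ?thesis using n_pos by linarith
qed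

lemma half_edge_mod: "half_edge P (i mod n) = half_edge P i"
proof -
  have "P (Suc (i mod n)) = P (Suc i)" by (metis mod_Suc_eq mod_eq)
  then show ?thesis by (simp add: half_edge_def mod_eq)
qed

lemma half_edge_disjoint: "i mod n \<noteq> j mod n \<Longrightarrow> half_edge P i \<inter> half_edge P j = {}"
  using simple[of "i mod n" "j mod n"] n_pos half_edge_mod by auto

lemma start_in_half_edge: "P i \<in> half_edge P i"
  using edge_ne[of i] by (auto simp: half_edge_def)

text \<open>The closed edge \<open>l\<close> is covered by the half-edges \<open>l\<close> and
  \<open>Suc l\<close>.\<close>

lemma not_in_edge:
  assumes "c \<in> half_edge P i" "i mod n \<noteq> l mod n" "i mod n \<noteq> Suc l mod n"
  shows "c \<notin> closed_segment (P l) (P (Suc l))"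
proof
  assume "c \<in> closed_segment (P l) (P (Suc l))"
  then have "c \<in> half_edge P l \<or> c \<in> half_edge P (Suc l)"
    using start_in_half_edge[of "Suc l"] by (auto simp: half_edge_def)
  then show False using half_edge_disjoint assms by blast
qed

text \<open>Local statements need a proof only at the corner formed by the vertices 0, 1, 2;
  rotation carries them to all others.\<close>

lemma polygon_rotate: "polygon (\<lambda>i. P (i + k)) n"
proof
  show "P (i + n + k) = P (i + k)" for i using periodic[of "i+k"] by (simp add: ac_simps)
  show "0 < n" by (rule n_pos)
  show "Im ((P (Suc (Suc i) + k) - P (Suc i + k)) / (P (Suc i + k) - P (i + k))) \<noteq> 0" for i
    using corner[of "i+k"] by simp
  have h: "half_edge (\<lambda>i. P (i + k)) i = half_edge P (i + k)" for i by (simp add: half_edge_def)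
  show "half_edge (\<lambda>i. P (i + k)) i \<inter> half_edge (\<lambda>i. P (i + k)) j = {}" if "i < n" "j < n" "i \<noteq> j" for i j
    unfolding h
  proof (rule half_edge_disjoint)
    show "(i + k) mod n \<noteq> (j + k) mod n" using that
      using mod_add_right_cancel_nat by blast
  qed
qed

lemma edge_angle_periodic: "edge_angle P v (i + n) = edge_angle P v i"
  unfolding edge_angle_def using periodic[of i] periodic[of "Suc i"] by simp

lemma winding_rotate: "winding (\<lambda>i. P (i + k)) n v = winding P n v"
proof (induction k)
  case (Suc k)
  have "winding (\<lambda>i. P (i + Suc k)) n v = (\<Sum>i<n. edge_angle P v (Suc (i + k)))"
    by (simp add: winding_def edge_angle_def)
  also have "\<dots> = (\<Sum>i<Suc n. edge_angle P v (i + k)) - edge_angle P v k"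
    by (subst sum.lessThan_Suc_shift) simp
  also have "\<dots> = (\<Sum>i<n. edge_angle P v (i + k))" using edge_angle_periodic[of v k] by (simp add: add.commute)
  also have "\<dots> = winding (\<lambda>i. P (i + k)) n v" by (simp add: winding_def edge_angle_def)
  finally show ?case using Suc by simp
qed simp

lemma polygon_path_rotate: "polygon_path (\<lambda>i. P (i + k)) n = polygon_path P n"
proof -
  have "polygon_path P n = (\<Union>i. closed_segment (P i) (P (Suc i)))"
  proof -
    have "closed_segment (P i) (P (Suc i)) = closed_segment (P (i mod n)) (P (Suc (i mod n)))" for i
      by (metis mod_Suc_eq mod_eq)
    moreover have "i mod n < n" for i using n_pos by simp
    ultimately show ?thesis unfolding polygon_path_def by blast
  qed
  moreover have "polygon_path (\<lambda>i. P (i + k)) n = (\<Union>i. closed_segment (P (i+k)) (P (Suc (i+k))))"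
  proof -
    have "closed_segment (P (i+k)) (P (Suc (i+k))) = closed_segment (P (i mod n+k)) (P (Suc (i mod n+k)))" for i
      by (metis mod_Suc_eq mod_eq mod_add_left_eq)
    moreover have "i mod n < n" for i using n_pos by simp
    ultimately show ?thesis unfolding polygon_path_def add_Suc by blast
  qed
  moreover have "(\<Union>i. closed_segment (P (i+k)) (P (Suc (i+k)))) = (\<Union>i. closed_segment (P i) (P (Suc i)))" (is "?A = ?B")
  proof
    show "?B \<subseteq> ?A"
    proof
      fix x assume "x \<in> ?B"
      then obtain i where i: "x \<in> closed_segment (P i) (P (Suc i))" by auto
      have "k \<le> i + k * n" using n_pos by (simp add: trans_le_add2)
      then obtain j where j: "i + k * n = j + k" by (metis le_add_diff_inverse2)
      have "P (j + k) = P i" "P (Suc (j + k)) = P (Suc i)"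
        by (metis j mod_eq mod_mult_self1, metis j mod_eq mod_mult_self1 add_Suc)
      then show "x \<in> ?A" by (intro UN_I[of j]) (use i in auto)
    qed
  qed auto
  ultimately show ?thesis by simp
qed

text \<open>Off the polygon no edge angle meets the branch cut, and the sum is a multiple of 2
  pi.\<close>

lemma winding_constant:
  fixes g :: "real \<Rightarrow> complex"
  assumes S: "connected S" and g: "continuous_on S g" and off: "\<And>s. s \<in> S \<Longrightarrow> g s \<notin> polygon_path P n"
    and "x \<in> S" "y \<in> S"
  shows "winding P n (g x) = winding P n (g y)"
proof (rule continuous_cis_constant[OF S _ _ assms(4,5)])
  show "continuous_on S (\<lambda>s. winding P n (g s))"
    unfolding winding_def
    by (intro continuous_on_sum continuous_on_edge_angle g) (use off in \<open>auto simp: polygon_path_def\<close>)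
  fix s assume s: "s \<in> S"
  have ne: "P i \<noteq> g s" for i
  proof -
    have "P (i mod n) \<in> polygon_path P n" using n_pos
      by (auto simp: polygon_path_def intro!: bexI[of _ "i mod n"])
    then show ?thesis using off[OF s] mod_eq by auto
  qed
  show "cis (winding P n (g s)) = 1"
    using cis_sum_edge_angle[of 0 n P "g s"] ne periodic[of 0]
    by (simp add: winding_def atLeast0LessThan sgn_zero_iff)
qed

lemma winding_segment:
  assumes "closed_segment a b \<inter> polygon_path P n = {}"
  shows "winding P n a = winding P n b"
proof -
  have "winding P n ((1 - 0) *\<^sub>R a + 0 *\<^sub>R b) = winding P n ((1 - 1) *\<^sub>R a + 1 *\<^sub>R b)"
  proof (rule winding_constant[where S = "{0..1::real}" and g = "\<lambda>s. (1 - s) *\<^sub>R a + s *\<^sub>R b"])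
    show "(1 - s) *\<^sub>R a + s *\<^sub>R b \<notin> polygon_path P n" if "s \<in> {0..1}" for s
      using that assms by (auto simp: closed_segment_def)
  qed (auto intro!: continuous_intros)
  then show ?thesis by simp
qed

end

text \<open>For edge directions \<open>d0\<close>, \<open>d1\<close> at a corner and a departure
  \<open>u\<close>, put \<alpha> = \<open>d1 / d0\<close> and \<beta> = \<open>u / d1\<close>. The
  two arguments are then the limits of the angles of the two adjacent edges. At a left turn the
  whole half-plane to the right of the outgoing edge lies on the right of the polygon, which costs 2
  pi against \<open>Arg \<alpha> + pi\<close>.\<close>

lemma Arg_corner_left:
  assumes "Im \<alpha> > 0" "Im \<beta> \<le> 0" "\<beta> \<notin> \<real>\<^sub>\<ge>\<^sub>0"
  shows "Arg (\<alpha> * \<beta>) + Arg (- 1 / \<beta>) = Arg \<alpha> - pi"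
proof -
  have b0: "\<beta> \<noteq> 0" and a0: "\<alpha> \<noteq> 0" using assms by auto
  have A: "0 < Arg \<alpha>" "Arg \<alpha> < pi" using assms(1) Arg_lt_pi[of \<alpha>] by auto
  have inv: "- 1 / \<beta> = inverse (- \<beta>)" using b0 by (simp add: field_simps)
  show ?thesis
  proof (cases "\<beta> \<in> \<real>")
    case True
    then obtain r where r: "\<beta> = of_real r" by (auto elim: Reals_cases)
    with assms(3) have "r < 0" by auto
    then have "Arg (\<alpha> * \<beta>) = Arg (- \<alpha>)"
      using Arg_times_of_real2[of "-r" "-\<alpha>"] by (simp add: r)
    also have "\<dots> = Arg \<alpha> - pi" using A a0 by (simp add: Arg_minus)
    moreover have "Arg (- 1 / \<beta>) = 0" using Arg_of_real[of "-1/r"] \<open>r < 0\<close> by (simp add: r divide_less_0_iff)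
    ultimately show ?thesis by simp
  next
    case False
    then have im: "Im \<beta> < 0" using assms(2) by (metis complex_is_Real_iff le_less)
    then have B: "-pi < Arg \<beta>" "Arg \<beta> < 0" using mpi_less_Arg by (auto simp: Arg_neg_iff)
    have "Arg (- 1 / \<beta>) = - Arg (- \<beta>)"
      unfolding inv using False by (subst Arg_inverse) (auto simp: complex_is_Real_iff)
    also have "\<dots> = - Arg \<beta> - pi" using B b0 by (simp add: Arg_minus)
    moreover have "Arg (\<alpha> * \<beta>) = Arg \<alpha> + Arg \<beta>"
      by (rule Arg_times) (use A B a0 b0 in auto)
    ultimately show ?thesis by simp
  qed
qed

text \<open>Here \<beta> is negative, so the departure goes straight back along the outgoing edge.
  At a right turn this direction lies on the left of the polygon.\<close>

lemma Arg_corner_right: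
  assumes "Im \<alpha> < 0" "0 < \<tau>"
  shows "Arg (\<alpha> * (- of_real \<tau>)) + Arg (- 1 / (- of_real \<tau>)) = Arg \<alpha> + pi"
proof -
  have "Arg (\<alpha> * (- of_real \<tau>)) = Arg (- \<alpha>)" using Arg_times_of_real2[of \<tau> "-\<alpha>"] assms by simp
  also have "\<dots> = Arg \<alpha> + pi" using assms(1) Arg_neg_iff[of \<alpha>] by (subst Arg_minus) auto
  moreover have "Arg (- 1 / (- of_real \<tau>)) = 0" using Arg_of_real[of "1/\<tau>"] assms by simp
  ultimately show ?thesis by simp
qed

text \<open>This is the limit of the total angle at \<open>P 1\<close> along either adjacent edge:
  the far edges, the turning angle of the corner, and pi for the edge that carries the
  viewpoint.\<close>

definition corner_value :: "(nat \<Rightarrow> complex) \<Rightarrow> nat \<Rightarrow> real" where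
  "corner_value P n = (\<Sum>l=2..<n. edge_angle P (P 1) l) + Arg ((P 2 - P 1) / (P 1 - P 0)) + pi"

section \<open>Total angle on the edges, beside the edges and at the corners\<close>

context polygon
begin

definition others :: "complex \<Rightarrow> real" where
  "others c = (\<Sum>l=2..<n. edge_angle P c l)"

lemma winding_split: "winding P n c = edge_angle P c 0 + edge_angle P c 1 + others c"
proof -
  have "{..<n} = insert 0 (insert 1 {2..<n})" using n_ge3 by auto
  then show ?thesis unfolding winding_def others_def by (simp add: add.assoc)
qed

lemma cis_winding: "(\<And>i. P i \<noteq> c) \<Longrightarrow> cis (winding P n c) = 1"
  using cis_sum_edge_angle[of 0 n P c] periodic[of 0]
  by (simp add: winding_def atLeast0LessThan sgn_zero_iff)

lemma not_in_other_edge: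
  assumes "c \<in> half_edge P i" "c \<noteq> P i" "i mod n \<noteq> l mod n"
  shows "c \<notin> closed_segment (P l) (P (Suc l))"
proof (cases "i mod n = Suc l mod n")
  case True
  then have "P i = P (Suc l)" by (metis mod_eq)
  then show ?thesis using assms half_edge_disjoint[OF assms(3)] by (auto simp: half_edge_def)
next
  case False
  then show ?thesis using not_in_edge assms by blast
qed

lemma vertex_not_in_edge: "l \<in> {2..<n} \<Longrightarrow> P 1 \<notin> closed_segment (P l) (P (Suc l))"
proof (rule not_in_edge[OF start_in_half_edge])
  assume l: "l \<in> {2..<n}"
  then show "1 mod n \<noteq> l mod n" by auto
  show "1 mod n \<noteq> Suc l mod n" using l by (cases "Suc l = n") auto
qed

lemma open_edge_in_half: "c \<in> open_segment (P i) (P (Suc i)) \<Longrightarrow> c \<in> half_edge P i \<and> c \<noteq> P i"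
  by (auto simp: half_edge_def open_segment_def)

lemma open_edge_not_vertex:
  assumes "c \<in> open_segment (P i) (P (Suc i))"
  shows "P l \<noteq> c"
proof (cases "i mod n = l mod n")
  case True
  then show ?thesis using assms by (metis mod_eq open_edge_in_half)
next
  case False
  then show ?thesis using assms half_edge_disjoint start_in_half_edge open_edge_in_half by blast
qed

lemma real_mult_directions:
  assumes "P 2 - P 1 = of_real a * (P 1 - P 0)"
  shows False
proof -
  have "(P (Suc (Suc 0)) - P (Suc 0)) / (P (Suc 0) - P 0) = of_real a"
    using assms edge_ne[of 0] by (simp add: numeral_2_eq_2)
  then show False using corner[of 0] by simp
qed

text \<open>Since Arg is pi on the negative reals, the winding function takes on an edge the value that it
  has immediately to the left of it. Going along an edge and around a corner does not change this value.\<close>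

lemma winding_second_edge:
  assumes "c \<in> open_segment (P 1) (P 2)"
  shows "winding P n c = corner_value P n"
proof -
  define d0 d1 where "d0 = P 1 - P 0" and "d1 = P 2 - P 1"
  have d: "d0 \<noteq> 0" "d1 \<noteq> 0" using edge_ne[of 0] edge_ne[of 1] by (auto simp: d0_def d1_def numeral_2_eq_2)
  define g where "g t = P 1 + of_real t * d1" for t
  \<comment> \<open>Seen from \<open>g t\<close>, edge 0 has as its angle the \<open>Arg\<close> of
    \<open>t\<close> times \<open>d1 / (g t - P 0)\<close>. Without the positive factor the term
    extends continuously to \<open>t = 0\<close>, where \<open>H\<close> is
    \<open>corner_value\<close>.\<close>
  define H where "H t = others (g t) + Arg (d1 / (g t - P 0)) + pi" for t
  obtain t where t: "0 < t" "t < 1" "c = g t"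
    using assms unfolding in_segment g_def d1_def scaleR_conv_of_real
    by (auto simp: algebra_simps)
  have half: "g t \<in> half_edge P 1" if "0 \<le> t" "t < 1" for t
  proof -
    have "g t - P 2 = of_real (t - 1) * d1" by (simp add: g_def d1_def algebra_simps)
    then have "g t \<noteq> P 2" using that d by auto
    moreover have "g t \<in> closed_segment (P 1) (P 2)"
      using that unfolding closed_segment_def g_def d1_def scaleR_conv_of_real by (auto simp: algebra_simps intro!: exI[of _ t])
    ultimately show ?thesis unfolding half_edge_def Suc_1 by simp
  qed
  have off: "g t \<notin> closed_segment (P l) (P (Suc l))" if "0 \<le> t" "t < 1" "l \<in> {2..<n}" for t l
  proof (rule not_in_edge[OF half])
    show "1 mod n \<noteq> l mod n" using that by auto
    show "1 mod n \<noteq> Suc l mod n" using that by (cases "Suc l = n") auto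
  qed (use that in auto)
  have gP0: "g t - P 0 = d0 + of_real t * d1" for t by (simp add: g_def d0_def)
  have nonreal: "d1 / (g t - P 0) \<notin> \<real>" for t
  proof
    assume "d1 / (g t - P 0) \<in> \<real>"
    then obtain x where x: "d1 / (g t - P 0) = of_real x" by (auto elim: Reals_cases)
    show False
    proof (cases "x = 0 \<or> g t = P 0")
      case True
      then have "g t - P 0 = 0" using x d by auto
      then have "d0 = of_real (-t) * d1" unfolding gP0 by (simp add: eq_neg_iff_add_eq_0)
      moreover have "t \<noteq> 0" using calculation d by auto
      ultimately have "d1 = of_real (-1/t) * d0" by (simp add: field_simps)
      then show False using real_mult_directions[of "-1/t"] by (simp add: d0_def d1_def)
    next
      case False
      then have "d1 = of_real x * (d0 + of_real t * d1)" using x unfolding gP0[symmetric] by (simp add: field_simps)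
      then have *: "of_real (1 - x * t) * d1 = of_real x * d0" by (simp add: algebra_simps)
      then have "1 - x * t \<noteq> 0" using False d by (metis divisors_zero mult_zero_left of_real_0 of_real_eq_0_iff)
      then have "d1 = of_real (x / (1 - x * t)) * d0" using * by (simp add: field_simps flip: of_real_mult)
      then show False using real_mult_directions[of "x / (1 - x * t)"] unfolding d0_def d1_def by blast
    qed
  qed
  have "H t = H 0"
  proof (rule continuous_cis_constant[where S = "{0..<1::real}" and f = H])
    have "continuous_on {0..<1} g" unfolding g_def by (intro continuous_intros)
    moreover have "d1 / (g t - P 0) \<notin> \<real>\<^sub>\<le>\<^sub>0" for t using nonreal[of t] nonpos_Reals_subset_Reals by blast
    moreover have "g t - P 0 \<noteq> 0" for t using nonreal[of t] by auto
    ultimately show "continuous_on {0..<1} H"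
      unfolding H_def others_def using off
      by (intro continuous_intros continuous_on_sum continuous_on_edge_angle continuous_on_Arg') auto
    show "cis (H t) = 1" if "t \<in> {0..<1}" for t
    proof -
      have "P 2 - g t = of_real (1 - t) * d1" by (simp add: g_def d1_def algebra_simps)
      moreover have ne: "g t - P 0 \<noteq> 0" using nonreal[of t] by auto
      moreover have "cis (others (g t)) = sgn ((P 0 - g t) / (P 2 - g t))"
      proof -
        have "P l \<noteq> g t" if "l \<in> {2..n}" for l
          using off[of t l] off[of t "l-1"] that \<open>t \<in> {0..<1}\<close> ne periodic[of 0] by (cases "l = n") auto
        then show ?thesis unfolding others_def using cis_sum_edge_angle[of 2 n P "g t"] n_ge3 periodic[of 0] by simp
      qed
      moreover have "cis (Arg (d1 / (g t - P 0))) = sgn (d1 / (g t - P 0))" using ne d by (intro cis_Arg) auto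
      ultimately have "cis (H t) = - sgn ((P 0 - g t) / (of_real (1 - t) * d1) * (d1 / (g t - P 0)))"
        unfolding H_def by (simp only: cis_mult[symmetric] cis_pi sgn_mult) simp
      also have "(P 0 - g t) / (of_real (1 - t) * d1) * (d1 / (g t - P 0)) = of_real (- 1 / (1 - t))"
      proof -
        have "(- a) / (r * d1) * (d1 / a) = - 1 / r" if "a \<noteq> 0" for a r :: complex
          using that d by (simp add: field_simps)
        from this[OF ne, of "of_real (1 - t)"] show ?thesis by (simp only: minus_diff_eq of_real_minus of_real_divide of_real_1)
      qed
      also have "- sgn (complex_of_real (- 1 / (1 - t))) = 1"
        using that by (simp only: sgn_of_real) simp
      finally show ?thesis .
    qed
  qed (use t in auto)
  moreover have "H 0 = corner_value P n"
    unfolding H_def corner_value_def others_def g_def d0_def d1_def by simp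
  moreover have "winding P n (g t) = H t"
  proof -
    have eq: "(P 1 - g t) / (P 0 - g t) = of_real t * (d1 / (g t - P 0))"
    proof -
      have "P 1 - g t = - (of_real t * d1)" "P 0 - g t = - (g t - P 0)" by (simp_all add: g_def)
      then show ?thesis by (simp only: minus_divide_divide times_divide_eq_right)
    qed
    then have 0: "edge_angle P (g t) 0 = Arg (d1 / (g t - P 0))"
      unfolding edge_angle_def One_nat_def[symmetric] eq using t by (simp only: Arg_times_of_real)
    have "(P 2 - g t) / (P 1 - g t) = of_real (- (1 - t) / t)"
      using t d by (simp add: g_def d1_def field_simps)
    then have "edge_angle P (g t) 1 = pi"
      unfolding edge_angle_def Suc_1 using t by (simp only: Arg_of_real) (simp add: field_simps)
    then show ?thesis unfolding winding_split H_def using 0 by simp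
  qed
  ultimately show ?thesis using t by simp
qed

lemma winding_first_edge:
  assumes "c \<in> open_segment (P 0) (P 1)"
  shows "winding P n c = corner_value P n"
proof -
  define d0 d1 where "d0 = P 1 - P 0" and "d1 = P 2 - P 1"
  have d: "d0 \<noteq> 0" "d1 \<noteq> 0" using edge_ne[of 0] edge_ne[of 1] by (auto simp: d0_def d1_def numeral_2_eq_2)
  define g where "g t = P 0 + of_real t * d0" for t
  \<comment> \<open>The angle of edge 1 carries the positive factor \<open>1 / (1 - t)\<close>;
    without it the term extends to the corner \<open>t = 1\<close>.\<close>
  define H where "H t = others (g t) + Arg ((P 2 - g t) / d0) + pi" for t
  obtain t where t: "0 < t" "t < 1" "c = g t"
    using assms unfolding in_segment g_def d0_def scaleR_conv_of_real
    by (auto simp: algebra_simps)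
  have half: "g t \<in> half_edge P 0" if "0 \<le> t" "t < 1" for t
  proof -
    have "g t - P 1 = of_real (t - 1) * d0" by (simp add: g_def d0_def algebra_simps)
    then have "g t \<noteq> P 1" using that d by auto
    moreover have "g t \<in> closed_segment (P 0) (P 1)"
      using that unfolding closed_segment_def g_def d0_def scaleR_conv_of_real by (auto simp: algebra_simps intro!: exI[of _ t])
    ultimately show ?thesis unfolding half_edge_def One_nat_def by simp
  qed
  have off: "g t \<notin> closed_segment (P l) (P (Suc l))" if "0 < t" "t \<le> 1" "l \<in> {2..<n}" for t l
  proof (cases "t = 1")
    case True
    then show ?thesis using vertex_not_in_edge that by (simp add: g_def d0_def)
  next
    case False
    show ?thesis by (rule not_in_other_edge[OF half]) (use that d False in \<open>auto simp: g_def\<close>)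
  qed
  have nonreal: "(P 2 - g t) / d0 \<notin> \<real>" for t
  proof
    assume "(P 2 - g t) / d0 \<in> \<real>"
    then obtain x where x: "(P 2 - g t) / d0 = of_real x" by (auto elim: Reals_cases)
    then have "P 2 - g t = of_real x * d0" using d by (simp add: field_simps)
    then have "P 2 - P 1 = of_real (x + t - 1) * (P 1 - P 0)" by (simp add: g_def d0_def algebra_simps)
    then show False by (rule real_mult_directions)
  qed
  have "H t = H 1"
  proof (rule continuous_cis_constant[where S = "{0<..1::real}" and f = H])
    have "continuous_on {0<..1} g" unfolding g_def by (intro continuous_intros)
    moreover have "(P 2 - g t) / d0 \<notin> \<real>\<^sub>\<le>\<^sub>0" for t using nonreal[of t] nonpos_Reals_subset_Reals by blast
    ultimately show "continuous_on {0<..1} H"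
      unfolding H_def others_def using off d
      by (intro continuous_intros continuous_on_sum continuous_on_edge_angle continuous_on_Arg') auto
    show "cis (H t) = 1" if "t \<in> {0<..1}" for t
    proof -
      have P0: "P 0 - g t = of_real (- t) * d0" by (simp add: g_def)
      have ne: "P 2 - g t \<noteq> 0" using nonreal[of t] by auto
      have "cis (others (g t)) = sgn ((P 0 - g t) / (P 2 - g t))"
      proof -
        have "P l \<noteq> g t" if "l \<in> {2..n}" for l
          using off[of t l] that \<open>t \<in> {0<..1}\<close> ne periodic[of 0] d by (cases "l = n") (auto simp: g_def)
        then show ?thesis unfolding others_def using cis_sum_edge_angle[of 2 n P "g t"] n_ge3 periodic[of 0] by simp
      qed
      moreover have "cis (Arg ((P 2 - g t) / d0)) = sgn ((P 2 - g t) / d0)" using ne d by (intro cis_Arg) auto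
      ultimately have "cis (H t) = - sgn ((P 0 - g t) / (P 2 - g t) * ((P 2 - g t) / d0))"
        unfolding H_def by (simp only: cis_mult[symmetric] cis_pi sgn_mult) simp
      also have "(P 0 - g t) / (P 2 - g t) * ((P 2 - g t) / d0) = of_real (- t)"
        using ne d unfolding P0 by simp
      also have "- sgn (complex_of_real (- t)) = 1"
        using that by (simp only: sgn_of_real) simp
      finally show ?thesis .
    qed
  qed (use t in auto)
  moreover have "H 1 = corner_value P n"
    unfolding H_def corner_value_def others_def g_def d0_def d1_def by simp
  moreover have "winding P n (g t) = H t"
  proof -
    have P1: "P 1 - g t = of_real (1 - t) * d0" by (simp add: g_def d0_def algebra_simps)
    have "(P 2 - g t) / (P 1 - g t) = of_real (1 / (1 - t)) * ((P 2 - g t) / d0)"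
      using t unfolding P1 by simp
    moreover have "1 / (1 - t) > 0" using t by simp
    ultimately have 1: "edge_angle P (g t) 1 = Arg ((P 2 - g t) / d0)"
      unfolding edge_angle_def Suc_1 by (simp only: Arg_times_of_real)
    have "(P 1 - g t) / (P 0 - g t) = of_real (- (1 - t) / t)"
      using t d by (simp add: g_def d0_def field_simps)
    then have "edge_angle P (g t) 0 = pi"
      unfolding edge_angle_def One_nat_def[symmetric] using t by (simp only: Arg_of_real) (simp add: field_simps)
    then show ?thesis unfolding winding_split H_def using 1 by simp
  qed
  ultimately show ?thesis using t by simp
qed

end

context polygon
begin

text \<open>Stepping off to the right affects only the edge that is left: its angle falls from pi to
  values near -pi, while all others vary continuously.\<close>

lemma winding_right_of_second_edge:
  assumes c: "c \<in> open_segment (P 1) (P 2)"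
    and off: "\<And>s. 0 < s \<Longrightarrow> s \<le> 1 \<Longrightarrow> c + of_real s * u \<notin> polygon_path P n"
    and right: "Im (u / (P 2 - P 1)) < 0"
  shows "winding P n (c + u) = winding P n c - 2 * pi"
proof -
  define d1 where "d1 = P 2 - P 1"
  have d: "d1 \<noteq> 0" using edge_ne[of 1] by (auto simp: d1_def numeral_2_eq_2)
  obtain t where t: "0 < t" "t < 1" "c = P 1 + of_real t * d1"
    using c unfolding in_segment d1_def scaleR_conv_of_real
    by (auto simp: algebra_simps)
  define g where "g s = c + of_real s * u" for s
  define \<omega> where "\<omega> s = of_real t + of_real s * (u / d1)" for s
  have g1: "P 1 - g s = - \<omega> s * d1" and g2: "P 2 - g s = (1 - \<omega> s) * d1" for s
    using d by (auto simp: g_def \<omega>_def t d1_def field_simps)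
  have im: "Im (\<omega> s) = s * Im (u / d1)" for s by (simp add: \<omega>_def del: times_divide_eq_right)
  have \<omega>0: "\<omega> s \<noteq> 0" if "0 \<le> s" for s
  proof (cases "s = 0")
    case False
    then have "Im (\<omega> s) \<noteq> 0" using im right by (simp add: d1_def)
    then show ?thesis by auto
  qed (use t in \<open>simp add: \<omega>_def\<close>)
  define ra where "ra s = (P 2 - g s) / (P 1 - g s)" for s
  have ra: "ra s = 1 - inverse (\<omega> s)" if "0 \<le> s" for s
    using \<omega>0[OF that] d unfolding ra_def g1 g2 by (simp add: field_simps)
  have im_ra: "Im (ra s) < 0" if "0 < s" for s
  proof -
    have "Im (\<omega> s) < 0" using im right that by (simp add: mult_pos_neg d1_def)
    moreover have "(Re (\<omega> s))\<^sup>2 + (Im (\<omega> s))\<^sup>2 > 0"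
      using calculation by (simp add: sum_power2_gt_zero_iff)
    ultimately show ?thesis using that by (simp add: ra divide_neg_pos)
  qed
  have ra0: "ra 0 = of_real (1 - 1/t)" using t by (simp add: ra \<omega>_def field_simps)
  \<comment> \<open>Negating the ratio moves it off the branch cut. \<open>Arg (- ra s)\<close> is
    \<open>Arg (ra s) - pi\<close> on the edge and \<open>Arg (ra s) + pi\<close> to its right, so
    the constancy of \<open>H\<close> is the drop by 2 pi.\<close>
  define H where "H s = edge_angle P (g s) 0 + others (g s) + Arg (- ra s)" for s
  have c_half: "c \<in> half_edge P 1" "c \<noteq> P 1"
    using open_edge_in_half[of c 1] c unfolding Suc_1 by blast+
  have off': "g s \<notin> closed_segment (P l) (P (Suc l))" if "0 \<le> s" "s \<le> 1" "l < n" "l \<noteq> 1" for s l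
  proof (cases "s = 0")
    case True
    show ?thesis using not_in_other_edge[OF c_half, of l] that n_ge3 True by (auto simp: g_def)
  next
    case False
    then show ?thesis using off[of s] that by (auto simp: g_def polygon_path_def)
  qed
  have edge1: "edge_angle P (g s) 1 = Arg (ra s)" for s by (simp only: edge_angle_def ra_def Suc_1)
  have H1: "H s = winding P n (g s) + pi" if "0 < s" "s \<le> 1" for s
  proof -
    have "ra s \<noteq> 0" using im_ra[of s] that by auto
    then have "Arg (- ra s) = Arg (ra s) + pi"
      using im_ra[of s] that Arg_neg_iff[of "ra s"] by (simp add: Arg_minus)
    then show ?thesis unfolding H_def winding_split edge1 by simp
  qed
  have H0: "H 0 = winding P n c - pi"
  proof -
    have "1 - 1/t < 0" using t by (simp add: field_simps)
    then have "Arg (ra 0) = pi" "Arg (- ra 0) = 0"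
      unfolding ra0 using Arg_of_real[of "-(1-1/t)"] by (simp_all only: Arg_of_real of_real_minus) auto
    then show ?thesis unfolding H_def winding_split[of c] using edge1[of 0] by (simp add: g_def)
  qed
  have "H 1 = H 0"
  proof (rule continuous_cis_constant[where S = "{0..1::real}" and f = H])
    have "continuous_on {0..1} g" unfolding g_def by (intro continuous_intros)
    moreover have "- ra s \<notin> \<real>\<^sub>\<le>\<^sub>0" if "0 \<le> s" for s
    proof (cases "s = 0")
      case True
      have "1/t - 1 > 0" using t by (simp add: field_simps)
      moreover have "- ra 0 = of_real (1/t - 1)" by (simp add: ra0)
      ultimately show ?thesis using True by (metis nonpos_Reals_of_real_iff not_less)
    next
      case False
      then have "Im (- ra s) \<noteq> 0" using im_ra[of s] that by simp
      then show ?thesis by (metis complex_nonpos_Reals_iff)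
    qed
    moreover have "P 1 - g s \<noteq> 0" if "0 \<le> s" for s using \<omega>0[OF that] d unfolding g1 by simp
    moreover have "continuous_on {0..1} (\<lambda>s. - ra s)"
      unfolding ra_def using calculation by (intro continuous_intros) auto
    ultimately show "continuous_on {0..1} H"
      unfolding H_def others_def using off' n_ge3
      by (intro continuous_on_add continuous_on_sum continuous_on_edge_angle continuous_on_Arg') auto
    show "cis (H s) = - 1" if "s \<in> {0..1}" for s
    proof (cases "s = 0")
      case True
      have "cis (winding P n c) = 1" by (rule cis_winding) (use open_edge_not_vertex[of c 1] c Suc_1 in metis)
      then show ?thesis unfolding True H0 by (simp add: cis_divide[symmetric])
    next
      case False
      then have s: "0 < s" "s \<le> 1" using that by auto
      have "P i \<noteq> g s" for i
      proof -
        have "P (i mod n) \<in> polygon_path P n" using n_pos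
          by (auto simp: polygon_path_def intro!: bexI[of _ "i mod n"])
        then show ?thesis using off s mod_eq by (auto simp: g_def)
      qed
      then have "cis (winding P n (g s)) = 1" by (rule cis_winding)
      then show ?thesis unfolding H1[OF s] by (simp add: cis_mult[symmetric])
    qed
  qed auto
  then show ?thesis using H0 H1[of 1] by (simp add: g_def)
qed

text \<open>Along the ray from the corner the total angle is constant, so its value at the far end
  can be read off from the limits of the two adjacent edge angles at the corner. These depend only
  on the direction \<open>u\<close>.\<close>

lemma winding_near_vertex:
  assumes off: "\<And>s. 0 < s \<Longrightarrow> s \<le> 1 \<Longrightarrow> P 1 + of_real s * u \<notin> polygon_path P n"
  shows "u \<noteq> 0" "- u / (P 1 - P 0) \<notin> \<real>\<^sub>\<ge>\<^sub>0" "u / (P 2 - P 1) \<notin> \<real>\<^sub>\<ge>\<^sub>0"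
    "winding P n (P 1 + u) = others (P 1) + Arg (u / (P 1 - P 0)) + Arg (- (P 2 - P 1) / u)"
proof -
  define d0 d1 where "d0 = P 1 - P 0" and "d1 = P 2 - P 1"
  have d: "d0 \<noteq> 0" "d1 \<noteq> 0" using edge_ne[of 0] edge_ne[of 1] by (auto simp: d0_def d1_def numeral_2_eq_2)
  define g where "g s = P 1 + of_real s * u" for s
  have v1: "P 1 \<in> polygon_path P n" using n_ge3 by (auto simp: polygon_path_def intro!: bexI[of _ 1])
  show u0: "u \<noteq> 0" using off[of 1] v1 by auto
  have e0: "closed_segment (P 0) (P 1) \<subseteq> polygon_path P n"
    using n_ge3 by (force simp: polygon_path_def intro!: bexI[of _ 0])
  have e1: "closed_segment (P 1) (P 2) \<subseteq> polygon_path P n"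
    using UN_upper[of 1 "{..<n}" "\<lambda>i. closed_segment (P i) (P (Suc i))"] n_ge3
    unfolding polygon_path_def Suc_1 by simp
  \<comment> \<open>If \<open>u\<close> pointed back along the incoming edge, a multiple of it would
    end on that edge. The choice of \<open>s\<close> keeps it from overshooting; \<open>no1\<close>
    is the same for the outgoing edge.\<close>
  have no0: False if "u = of_real (- \<rho>) * d0" "0 < \<rho>" for \<rho>
  proof -
    define s where "s = min 1 (1 / \<rho>)"
    have s: "0 < s" "s \<le> 1" "s * \<rho> \<le> 1" "0 \<le> s * \<rho>" using that by (auto simp: s_def min_def field_simps)
    have "P 1 + of_real s * u = (1 - (1 - s * \<rho>)) *\<^sub>R P 0 + (1 - s * \<rho>) *\<^sub>R P 1"
      unfolding that(1) by (simp add: d0_def scaleR_conv_of_real algebra_simps)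
    then have "P 1 + of_real s * u \<in> closed_segment (P 0) (P 1)"
      unfolding in_segment by (intro exI[of _ "1 - s * \<rho>"]) (use s in auto)
    then show False using off s e0 by blast
  qed
  have no1: False if "u = of_real \<rho> * d1" "0 < \<rho>" for \<rho>
  proof -
    define s where "s = min 1 (1 / \<rho>)"
    have s: "0 < s" "s \<le> 1" "s * \<rho> \<le> 1" "0 \<le> s * \<rho>" using that by (auto simp: s_def min_def field_simps)
    have "P 1 + of_real s * u = (1 - s * \<rho>) *\<^sub>R P 1 + (s * \<rho>) *\<^sub>R P 2"
      unfolding that(1) by (simp add: d1_def scaleR_conv_of_real algebra_simps)
    then have "P 1 + of_real s * u \<in> closed_segment (P 1) (P 2)"
      unfolding in_segment by (intro exI[of _ "s * \<rho>"]) (use s in auto)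
    then show False using off s e1 by blast
  qed
  show "- u / (P 1 - P 0) \<notin> \<real>\<^sub>\<ge>\<^sub>0"
  proof
    assume "- u / (P 1 - P 0) \<in> \<real>\<^sub>\<ge>\<^sub>0"
    then obtain r where r: "0 \<le> r" "- u / d0 = of_real r" by (auto simp: nonneg_Reals_def d0_def)
    then have "u = of_real (- r) * d0" using d by (simp add: field_simps) (metis minus_equation_iff)
    moreover have "r \<noteq> 0" using calculation u0 by auto
    ultimately show False using no0 r by (metis le_less)
  qed
  show "u / (P 2 - P 1) \<notin> \<real>\<^sub>\<ge>\<^sub>0"
  proof
    assume "u / (P 2 - P 1) \<in> \<real>\<^sub>\<ge>\<^sub>0"
    then obtain r where r: "0 \<le> r" "u / d1 = of_real r" by (auto simp: nonneg_Reals_def d1_def)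
    then have "u = of_real r * d1" using d by (simp add: field_simps)
    moreover have "r \<noteq> 0" using calculation u0 by auto
    ultimately show False using no1 r by (metis le_less)
  qed
  \<comment> \<open>For \<open>s > 0\<close> the adjacent edge angles are arguments of ratios with a
    positive factor \<open>s\<close> or \<open>1 / s\<close>. Dropping it gives terms that are
    continuous down to \<open>s = 0\<close>.\<close>
  define H where "H s = others (g s) + Arg (u / (g s - P 0)) + Arg ((P 2 - g s) / (- u))" for s
  have off': "g s \<notin> closed_segment (P l) (P (Suc l))" if "0 \<le> s" "s \<le> 1" "l \<in> {2..<n}" for s l
  proof (cases "s = 0")
    case True
    then show ?thesis using vertex_not_in_edge[OF that(3)] by (simp add: g_def)
  next
    case False
    then show ?thesis using off[of s] that by (auto simp: g_def polygon_path_def)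
  qed
  have gP0: "g s - P 0 = d0 + of_real s * u" and gP2: "P 2 - g s = d1 - of_real s * u" for s
    by (auto simp: g_def d0_def d1_def)
  have ne0: "d0 + of_real s * u \<noteq> 0" if "0 \<le> s" for s
  proof
    assume "d0 + of_real s * u = 0"
    then have *: "d0 = - of_real s * u" by (simp add: eq_neg_iff_add_eq_0)
    then have "s > 0" using d that by (cases "s = 0") auto
    then show False using no0[of "1/s"] * by simp
  qed
  have ne1: "d1 - of_real s * u \<noteq> 0" if "0 \<le> s" for s
  proof
    assume "d1 - of_real s * u = 0"
    then have *: "d1 = of_real s * u" by simp
    then have "s > 0" using d that by (cases "s = 0") auto
    then show False using no1[of "1/s"] * by simp
  qed
  have "H 1 = H 0"
  proof (rule continuous_cis_constant[where S = "{0..1::real}" and f = H])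
    have cg: "continuous_on {0..1} g" unfolding g_def by (intro continuous_intros)
    have "u / (g s - P 0) \<notin> \<real>\<^sub>\<le>\<^sub>0" if "0 \<le> s" for s
    proof
      assume "u / (g s - P 0) \<in> \<real>\<^sub>\<le>\<^sub>0"
      then obtain r where r: "r \<le> 0" "u / (d0 + of_real s * u) = of_real r" by (auto simp: nonpos_Reals_def gP0)
      then have "u = of_real r * (d0 + of_real s * u)" using ne0[OF that] by (simp add: field_simps)
      then have *: "of_real (1 - r * s) * u = of_real r * d0" by (simp add: algebra_simps)
      have pos: "1 - r * s > 0" using r that by (smt (verit) mult_nonpos_nonneg)
      moreover have "u = of_real (- (- r / (1 - r * s))) * d0"
        using * pos by (simp add: field_simps flip: of_real_mult)
      moreover have "r \<noteq> 0" using * pos u0 by auto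
      ultimately show False using no0[of "- r / (1 - r * s)"] r by (simp add: divide_neg_pos)
    qed
    moreover have "(P 2 - g s) / (- u) \<notin> \<real>\<^sub>\<le>\<^sub>0" if "0 \<le> s" for s
    proof
      assume "(P 2 - g s) / (- u) \<in> \<real>\<^sub>\<le>\<^sub>0"
      then obtain r where r: "r \<le> 0" "(d1 - of_real s * u) / (- u) = of_real r" by (auto simp: nonpos_Reals_def gP2)
      then have "d1 - of_real s * u = of_real r * (- u)" using u0 by (simp add: field_simps)
      then have *: "d1 = of_real (s - r) * u" by (simp add: algebra_simps)
      then have "s - r \<noteq> 0" using d by auto
      then have "s - r > 0" "u = of_real (1 / (s - r)) * d1" using r that * by (auto simp: field_simps)
      then show False using no1[of "1 / (s - r)"] by simp
    qed
    ultimately show "continuous_on {0..1} H"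
      unfolding H_def others_def using off' cg u0 ne0
      by (intro continuous_intros continuous_on_sum continuous_on_edge_angle continuous_on_Arg')
         (auto simp: gP0)
    show "cis (H s) = 1" if "s \<in> {0..1}" for s
    proof -
      have n0: "g s - P 0 \<noteq> 0" and n2: "P 2 - g s \<noteq> 0" using ne0 ne1 that by (auto simp: gP0 gP2)
      have "cis (others (g s)) = sgn ((P 0 - g s) / (P 2 - g s))"
      proof -
        have "P l \<noteq> g s" if "l \<in> {2..n}" for l
          using off'[of s l] that \<open>s \<in> {0..1}\<close> n0 periodic[of 0] by (cases "l = n") auto
        then show ?thesis unfolding others_def using cis_sum_edge_angle[of 2 n P "g s"] n_ge3 periodic[of 0] by simp
      qed
      moreover have "cis (Arg (u / (g s - P 0))) = sgn (u / (g s - P 0))" using n0 u0 by (intro cis_Arg) auto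
      moreover have "cis (Arg ((P 2 - g s) / (- u))) = sgn ((P 2 - g s) / (- u))" using n2 u0 by (intro cis_Arg) auto
      ultimately have "cis (H s) = sgn ((P 0 - g s) / (P 2 - g s) * (u / (g s - P 0)) * ((P 2 - g s) / (- u)))"
        unfolding H_def by (simp only: cis_mult[symmetric] sgn_mult)
      also have "(P 0 - g s) / (P 2 - g s) * (u / (g s - P 0)) * ((P 2 - g s) / (- u)) = 1"
      proof -
        have "(- a) / b * (u / a) * (b / (- u)) = 1" if "a \<noteq> 0" "b \<noteq> 0" for a b :: complex
          using that u0 by (simp add: divide_simps)
        from this[OF n0 n2] show ?thesis by (simp only: minus_diff_eq)
      qed
      finally show ?thesis by (simp add: sgn_one)
    qed
  qed auto
  moreover have "H 0 = others (P 1) + Arg (u / (P 1 - P 0)) + Arg (- (P 2 - P 1) / u)"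
    by (simp add: H_def g_def minus_divide_left)
  moreover have "H 1 = winding P n (P 1 + u)"
  proof -
    have "(P 1 - (P 1 + u)) / (P 0 - (P 1 + u)) = u / (P 1 + u - P 0)"
    proof -
      have "P 1 - (P 1 + u) = - u" "P 0 - (P 1 + u) = - (P 1 + u - P 0)" by simp_all
      then show ?thesis by (simp only: minus_divide_divide)
    qed
    then have 0: "edge_angle P (P 1 + u) 0 = Arg (u / (P 1 + u - P 0))"
      unfolding edge_angle_def One_nat_def[symmetric] by simp
    have 1: "edge_angle P (P 1 + u) 1 = Arg ((P 2 - (P 1 + u)) / (- u))"
      unfolding edge_angle_def Suc_1 by simp
    show ?thesis unfolding winding_split 0 1 H_def g_def by simp
  qed
  ultimately show "winding P n (P 1 + u) = others (P 1) + Arg (u / (P 1 - P 0)) + Arg (- (P 2 - P 1) / u)"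
    by simp
qed

lemma winding_left_corner:
  assumes off: "\<And>s. 0 < s \<Longrightarrow> s \<le> 1 \<Longrightarrow> P 1 + of_real s * u \<notin> polygon_path P n"
    and left: "Im ((P 2 - P 1) / (P 1 - P 0)) > 0" and u: "Im (u / (P 2 - P 1)) \<le> 0"
  shows "winding P n (P 1 + u) = corner_value P n - 2 * pi"
proof -
  note near = winding_near_vertex[OF off]
  have d: "P 2 - P 1 \<noteq> 0" "P 1 - P 0 \<noteq> 0" using left by auto
  have "Arg (u / (P 1 - P 0)) + Arg (- (P 2 - P 1) / u) = Arg ((P 2 - P 1) / (P 1 - P 0)) - pi"
    using Arg_corner_left[OF left u near(3)] d near(1) by simp
  then show ?thesis using near(4) unfolding corner_value_def others_def by simp
qed

lemma winding_right_corner: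
  assumes off: "\<And>s. 0 < s \<Longrightarrow> s \<le> 1 \<Longrightarrow> P 1 + of_real s * u \<notin> polygon_path P n"
    and right: "Im ((P 2 - P 1) / (P 1 - P 0)) < 0" and u: "u = - of_real \<tau> * (P 2 - P 1)" "0 < \<tau>"
  shows "winding P n (P 1 + u) = corner_value P n"
proof -
  note near = winding_near_vertex[OF off]
  have d: "P 2 - P 1 \<noteq> 0" "P 1 - P 0 \<noteq> 0" using right by auto
  have "Arg (u / (P 1 - P 0)) + Arg (- (P 2 - P 1) / u) = Arg ((P 2 - P 1) / (P 1 - P 0)) + pi"
  proof -
    have "u / (P 1 - P 0) = (P 2 - P 1) / (P 1 - P 0) * (- of_real \<tau>)" using u by simp
    moreover have "- (P 2 - P 1) / u = - 1 / (- of_real \<tau>)" using u d by (simp add: divide_simps)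
    ultimately show ?thesis using Arg_corner_right[OF right u(2)] by simp
  qed
  then show ?thesis using near(4) unfolding corner_value_def others_def by simp
qed

text \<open>The midpoint of an edge lies on the second edge of one corner and on the first edge of
  the next, so neighbouring corners give the same value.\<close>

lemma corner_value_rotate: "corner_value (\<lambda>j. P (j + i)) n = corner_value P n"
proof (induction i)
  case (Suc i)
  interpret R: polygon "\<lambda>j. P (j + i)" n by (rule polygon_rotate)
  interpret S: polygon "\<lambda>j. P (j + Suc i)" n by (rule polygon_rotate)
  have ne: "P (Suc (Suc i)) \<noteq> P (Suc i)" by (rule edge_ne)
  define c where "c = midpoint (P (Suc i)) (P (Suc (Suc i)))"
  have c: "c \<in> open_segment (P (Suc i)) (P (Suc (Suc i)))"
    using ne unfolding c_def by (metis midpoint_in_open_segment)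
  then have "winding (\<lambda>j. P (j + i)) n c = corner_value (\<lambda>j. P (j + i)) n"
    by (intro R.winding_second_edge) simp
  moreover have "winding (\<lambda>j. P (j + Suc i)) n c = corner_value (\<lambda>j. P (j + Suc i)) n"
    using c by (intro S.winding_first_edge) simp
  ultimately show ?case using Suc winding_rotate[of i c] winding_rotate[of "Suc i" c] by simp
qed simp

lemma winding_right_of_edge:
  assumes c: "c \<in> open_segment (P i) (P (Suc i))"
    and off: "\<And>s. 0 < s \<Longrightarrow> s \<le> 1 \<Longrightarrow> c + of_real s * u \<notin> polygon_path P n"
    and right: "Im (u / (P (Suc i) - P i)) < 0"
  shows "winding P n (c + u) = corner_value P n - 2 * pi"
proof -
  \<comment> \<open>Edge \<open>i\<close> has to become edge 1, which asks for the shift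
    \<open>i - 1\<close>; adding the period \<open>n\<close> avoids a negative shift at
    \<open>i = 0\<close>.\<close>
  define k where "k = i + n - 1"
  have k: "1 + k = i + n" "2 + k = Suc i + n" using n_pos by (auto simp: k_def)
  interpret R: polygon "\<lambda>j. P (j + k)" n by (rule polygon_rotate)
  have c': "c \<in> open_segment (P (1 + k)) (P (2 + k))" using c unfolding k periodic .
  have "winding (\<lambda>j. P (j + k)) n (c + u) = winding (\<lambda>j. P (j + k)) n c - 2 * pi"
  proof (rule R.winding_right_of_second_edge)
    show "Im (u / (P (2 + k) - P (1 + k))) < 0" using right unfolding k periodic .
  qed (use c' off polygon_path_rotate in auto)
  also have "winding (\<lambda>j. P (j + k)) n c = corner_value (\<lambda>j. P (j + k)) n"
    by (rule R.winding_second_edge) (rule c')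
  finally show ?thesis by (simp add: winding_rotate corner_value_rotate)
qed

lemma winding_at_left_corner:
  assumes off: "\<And>s. 0 < s \<Longrightarrow> s \<le> 1 \<Longrightarrow> P (Suc i) + of_real s * u \<notin> polygon_path P n"
    and left: "Im ((P (Suc (Suc i)) - P (Suc i)) / (P (Suc i) - P i)) > 0"
    and u: "Im (u / (P (Suc (Suc i)) - P (Suc i))) \<le> 0"
  shows "winding P n (P (Suc i) + u) = corner_value P n - 2 * pi"
proof -
  interpret R: polygon "\<lambda>j. P (j + i)" n by (rule polygon_rotate)
  show ?thesis
    using R.winding_left_corner[of u] assms by (simp add: winding_rotate corner_value_rotate polygon_path_rotate)
qed

lemma winding_at_right_corner:
  assumes off: "\<And>s. 0 < s \<Longrightarrow> s \<le> 1 \<Longrightarrow> P (Suc i) + of_real s * u \<notin> polygon_path P n"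
    and right: "Im ((P (Suc (Suc i)) - P (Suc i)) / (P (Suc i) - P i)) < 0"
    and u: "u = - of_real \<tau> * (P (Suc (Suc i)) - P (Suc i))" "0 < \<tau>"
  shows "winding P n (P (Suc i) + u) = corner_value P n"
proof -
  interpret R: polygon "\<lambda>j. P (j + i)" n by (rule polygon_rotate)
  show ?thesis
    using R.winding_right_corner[of u \<tau>] assms by (simp add: winding_rotate corner_value_rotate polygon_path_rotate)
qed

end

section \<open>Arcs on the sphere\<close>

definition det3 :: "real^3 \<Rightarrow> real^3 \<Rightarrow> real^3 \<Rightarrow> real" where
  "det3 u v w = cross3 u v \<bullet> w"

lemma det3_linear:
  "det3 (a *\<^sub>R x + b *\<^sub>R y) v w = a * det3 x v w + b * det3 y v w"
  "det3 u (a *\<^sub>R x + b *\<^sub>R y) w = a * det3 u x w + b * det3 u y w"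
  "det3 u v (a *\<^sub>R x + b *\<^sub>R y) = a * det3 u v x + b * det3 u v y"
  by (simp_all add: det3_def cross3_simps)

lemma det3_self [simp]: "det3 u u v = 0" "det3 u v v = 0" "det3 u v u = 0"
  by (simp_all add: det3_def cross3_simps)

lemma det3_rotate: "det3 u v w = det3 v w u"
  by (simp add: det3_def cross3_simps)

lemma det3_swap: "det3 v u w = - det3 u v w"
  by (simp add: det3_def cross3_simps)

lemma det3_cramer:
  "det3 a b c *\<^sub>R q = det3 q b c *\<^sub>R a + det3 a q c *\<^sub>R b + det3 a b q *\<^sub>R c"
  by (simp add: det3_def cross3_simps forall_3)

text \<open>The right-hand side is the determinant of the matrix of inner products, that is, of the
  product of the two matrices.\<close>

lemma det3_gram:
  "det3 X Y Z * det3 u v w =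
     (X \<bullet> u) * ((Y \<bullet> v) * (Z \<bullet> w) - (Y \<bullet> w) * (Z \<bullet> v))
   - (X \<bullet> v) * ((Y \<bullet> u) * (Z \<bullet> w) - (Y \<bullet> w) * (Z \<bullet> u))
   + (X \<bullet> w) * ((Y \<bullet> u) * (Z \<bullet> v) - (Y \<bullet> v) * (Z \<bullet> u))"
  by (simp add: det3_def cross3_def inner_vec_def sum_3 vector_def algebra_simps)

lemma valid_arc_cross:
  assumes "valid_arc a"
  shows "cross3 (fst a) (snd a) \<noteq> 0"
proof
  assume "cross3 (fst a) (snd a) = 0"
  moreover have n: "norm (fst a) = 1" "norm (snd a) = 1" using assms by (auto simp: valid_arc_def S2_def)
  ultimately obtain c where c: "snd a = c *\<^sub>R fst a"
    unfolding cross_eq_0 collinear_lemma by auto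
  then have "\<bar>c\<bar> = 1" using n by simp
  then have "c = 1 \<or> c = -1" by auto
  then show False using c assms by (auto simp: valid_arc_def)
qed

lemma valid_arc_independent:
  assumes "valid_arc a" "\<alpha> *\<^sub>R fst a + \<beta> *\<^sub>R snd a = 0"
  shows "\<alpha> = 0 \<and> \<beta> = 0"
proof -
  have "cross3 (\<alpha> *\<^sub>R fst a + \<beta> *\<^sub>R snd a) (snd a) = 0" "cross3 (fst a) (\<alpha> *\<^sub>R fst a + \<beta> *\<^sub>R snd a) = 0"
    using assms by auto
  then show ?thesis using valid_arc_cross[OF assms(1)]
    by (simp add: cross_add_left cross_add_right cross_mult_left cross_mult_right)
qed

lemma valid_arc_coeff_unique:
  assumes "valid_arc a" "\<alpha> *\<^sub>R fst a + \<beta> *\<^sub>R snd a = \<gamma> *\<^sub>R fst a + \<delta> *\<^sub>R snd a"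
  shows "\<alpha> = \<gamma> \<and> \<beta> = \<delta>"
  using valid_arc_independent[OF assms(1), of "\<alpha> - \<gamma>" "\<beta> - \<delta>"] assms(2)
  by (simp add: algebra_simps)

lemma valid_arc_swap [simp]: "valid_arc (prod.swap a) = valid_arc a"
  by (auto simp: valid_arc_def)

lemma endpoints_swap [simp]: "endpoints (prod.swap a) = endpoints a"
  by (auto simp: endpoints_def)

lemma endpoints_eq_iff: "endpoints a = endpoints b \<longleftrightarrow> a = b \<or> a = prod.swap b"
  by (cases a; cases b) (auto simp: endpoints_def doubleton_eq_iff)

lemma arc_relint_swap [simp]: "arc_relint (prod.swap a) = arc_relint a"
  by (simp add: arc_relint_def open_segment_commute)

lemma arc_relint_endpoints: "endpoints a = endpoints b \<Longrightarrow> arc_relint a = arc_relint b"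
  by (auto simp: endpoints_eq_iff)

lemma arc_relintI:
  assumes "valid_arc a" "0 < \<alpha>" "0 < \<beta>" "x = \<alpha> *\<^sub>R fst a + \<beta> *\<^sub>R snd a"
  shows "x /\<^sub>R norm x \<in> arc_relint a" "x \<noteq> 0"
proof -
  show x: "x \<noteq> 0" using valid_arc_independent assms by fastforce
  define y where "y = x /\<^sub>R (\<alpha> + \<beta>)"
  have "y = (1 - \<beta> / (\<alpha> + \<beta>)) *\<^sub>R fst a + (\<beta> / (\<alpha> + \<beta>)) *\<^sub>R snd a"
  proof -
    have "1 - \<beta> / (\<alpha> + \<beta>) = \<alpha> / (\<alpha> + \<beta>)" using assms by (simp add: field_simps)
    then show ?thesis unfolding y_def assms(4) by (simp add: divide_inverse scaleR_add_right mult.commute)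
  qed
  then have "y \<in> open_segment (fst a) (snd a)"
    unfolding in_segment using assms by (auto simp: valid_arc_def intro!: exI[of _ "\<beta> / (\<alpha> + \<beta>)"])
  moreover have "x /\<^sub>R norm x = y /\<^sub>R norm y" using assms(2,3) by (simp add: y_def)
  ultimately show "x /\<^sub>R norm x \<in> arc_relint a" by (auto simp: arc_relint_def)
qed

lemma arc_relintE:
  assumes "valid_arc a" "v \<in> arc_relint a"
  obtains \<alpha> \<beta> where "0 < \<alpha>" "0 < \<beta>" "v = \<alpha> *\<^sub>R fst a + \<beta> *\<^sub>R snd a" "norm v = 1"
proof -
  obtain x where x: "x \<in> open_segment (fst a) (snd a)" "v = x /\<^sub>R norm x"
    using assms by (auto simp: arc_relint_def)
  then obtain t where t: "0 < t" "t < 1" "x = (1 - t) *\<^sub>R fst a + t *\<^sub>R snd a" by (auto simp: in_segment)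
  have x0: "x \<noteq> 0" using arc_relintI(2)[OF assms(1), of "1 - t" t x] t by auto
  have "norm v = 1" using x0 x(2) by simp
  moreover have "v = ((1 - t) / norm x) *\<^sub>R fst a + (t / norm x) *\<^sub>R snd a"
    unfolding x(2) by (subst (2) t(3)) (simp add: divide_inverse scaleR_add_right mult.commute)
  ultimately show ?thesis
    using t x0 by (intro that[of "(1 - t) / norm x" "t / norm x"]) auto
qed

lemma arc_relint_combination:
  assumes "valid_arc a" "norm v = 1" "0 < \<alpha>" "0 < \<beta>" "v = \<alpha> *\<^sub>R fst a + \<beta> *\<^sub>R snd a"
  shows "v \<in> arc_relint a"
  using arc_relintI(1)[OF assms(1,3,4,5)] assms(2) by simp

lemma endpoint_notin_relint:
  assumes "valid_arc a" "e \<in> endpoints a"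
  shows "e \<notin> arc_relint a"
proof
  assume "e \<in> arc_relint a"
  then obtain \<alpha> \<beta> where e: "0 < \<alpha>" "0 < \<beta>" "e = \<alpha> *\<^sub>R fst a + \<beta> *\<^sub>R snd a"
    using assms arc_relintE by metis
  have "e = 1 *\<^sub>R fst a + 0 *\<^sub>R snd a \<or> e = 0 *\<^sub>R fst a + 1 *\<^sub>R snd a" using assms by (auto simp: endpoints_def)
  then show False using valid_arc_coeff_unique[OF assms(1)] e by (metis less_irrefl)
qed

lemma coplanar_combination:
  assumes "valid_arc c" "det3 (fst c) (snd c) q = 0"
  obtains \<gamma> \<delta> where "q = \<gamma> *\<^sub>R fst c + \<delta> *\<^sub>R snd c"
proof -
  define N where "N = cross3 (fst c) (snd c)"
  have N: "det3 (fst c) (snd c) N = N \<bullet> N" "N \<bullet> N \<noteq> 0"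
    using valid_arc_cross[OF assms(1)] by (auto simp: det3_def N_def)
  have "(N \<bullet> N) *\<^sub>R q = det3 q (snd c) N *\<^sub>R fst c + det3 (fst c) q N *\<^sub>R snd c"
    using det3_cramer[of "fst c" "snd c" N q] N assms(2) by simp
  then have "q = (1 / (N \<bullet> N)) *\<^sub>R (det3 q (snd c) N *\<^sub>R fst c + det3 (fst c) q N *\<^sub>R snd c)"
    using N by (metis (no_types) scaleR_scaleR divide_self times_divide_eq_left mult_1 scaleR_one)
  then show ?thesis
    by (intro that[of "(1 / (N \<bullet> N)) * det3 q (snd c) N" "(1 / (N \<bullet> N)) * det3 (fst c) q N"]) (simp add: scaleR_add_right)
qed

locale spherical_diagram =
  fixes D :: "arc set"
  assumes SD: "SD D"
begin

text \<open>Walks use every arc in both directions. The component \<open>snd\<close> is the head, at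
  which a walk passes to a blocking arc.\<close>

definition oarcs :: "arc set" where
  "oarcs = D \<union> prod.swap ` D"

lemma finite_D: "finite D" and D_nonempty: "D \<noteq> {}"
  using SD by (auto simp: SD_def)

lemma D_valid: "a \<in> D \<Longrightarrow> valid_arc a"
  using SD unfolding SD_def by blast

lemma D_disjoint: "a \<in> D \<Longrightarrow> b \<in> D \<Longrightarrow> a \<noteq> b \<Longrightarrow> arc_relint a \<inter> arc_relint b = {}"
  using SD unfolding SD_def by blast

lemma D_blocked: "a \<in> D \<Longrightarrow> e \<in> endpoints a \<Longrightarrow> \<exists>c\<in>D. e \<in> arc_relint c"
  using SD unfolding SD_def by blast

lemma finite_oarcs: "finite oarcs"
  using finite_D by (simp add: oarcs_def)

lemma oarcs_valid: "a \<in> oarcs \<Longrightarrow> valid_arc a"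
  unfolding oarcs_def using D_valid valid_arc_swap by blast

lemma oarcs_swap: "a \<in> oarcs \<Longrightarrow> prod.swap a \<in> oarcs"
  by (cases a) (force simp: oarcs_def)

lemma oarcs_cases: "a \<in> oarcs \<Longrightarrow> \<exists>a'\<in>D. endpoints a = endpoints a'"
  unfolding oarcs_def by (metis Un_iff imageE endpoints_swap)

lemma oarcs_disjoint:
  assumes "a \<in> oarcs" "b \<in> oarcs" "endpoints a \<noteq> endpoints b"
  shows "arc_relint a \<inter> arc_relint b = {}"
proof -
  obtain a' b' where "a' \<in> D" "b' \<in> D" "endpoints a = endpoints a'" "endpoints b = endpoints b'"
    using assms oarcs_cases by metis
  moreover from this have "arc_relint a' \<inter> arc_relint b' = {}" using D_disjoint assms(3) by metis
  ultimately show ?thesis using arc_relint_endpoints by metis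
qed

lemma oarcs_relint_unique:
  "a \<in> oarcs \<Longrightarrow> b \<in> oarcs \<Longrightarrow> v \<in> arc_relint a \<Longrightarrow> v \<in> arc_relint b \<Longrightarrow> endpoints a = endpoints b"
  using oarcs_disjoint by blast

lemma oarcs_blocked: "a \<in> oarcs \<Longrightarrow> \<exists>c\<in>D. snd a \<in> arc_relint c"
proof -
  assume "a \<in> oarcs"
  then obtain b where "b \<in> D" "endpoints a = endpoints b" using oarcs_cases by blast
  then show ?thesis using D_blocked[of b "snd a"] by (auto simp: endpoints_def)
qed

lemma endpoints_inj_D: "a \<in> D \<Longrightarrow> b \<in> D \<Longrightarrow> endpoints a = endpoints b \<Longrightarrow> a = b"
proof (rule ccontr)
  assume a: "a \<in> D" "b \<in> D" "endpoints a = endpoints b" "a \<noteq> b"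
  then have "arc_relint a \<inter> arc_relint b = {}" "arc_relint a = arc_relint b" "valid_arc a"
    using D_disjoint arc_relint_endpoints D_valid by blast+
  then show False using arc_relintI(1)[of a 1 1, OF _ _ _ refl] by auto
qed

text \<open>If \<open>a\<close> reached \<open>c\<close> within the great circle of
  \<open>c\<close>, points of \<open>a\<close> close to its head would lie in the interior of
  \<open>c\<close>, because interiors are open in their great circle; this contradicts disjointness.
  The sign statement holds since the head of \<open>a\<close> is a positive combination of the ends
  of \<open>c\<close>.\<close>

lemma hit_transversal:
  assumes a: "a \<in> oarcs" and c: "c \<in> oarcs" and hit: "snd a \<in> arc_relint c"
  shows "det3 (fst a) (snd a) (snd c) \<noteq> 0"
    and "det3 (fst a) (snd a) (fst c) * det3 (fst a) (snd a) (snd c) < 0"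
    and "endpoints a \<noteq> endpoints c"
proof -
  have va: "valid_arc a" and vc: "valid_arc c" using a c oarcs_valid by auto
  obtain \<alpha> \<beta> where p: "0 < \<alpha>" "0 < \<beta>" "snd a = \<alpha> *\<^sub>R fst c + \<beta> *\<^sub>R snd c"
    using arc_relintE[OF vc hit] by metis
  show ne: "endpoints a \<noteq> endpoints c"
    using endpoint_notin_relint[OF va, of "snd a"] hit arc_relint_endpoints[of a c] by (auto simp: endpoints_def)
  show nz: "det3 (fst a) (snd a) (snd c) \<noteq> 0"
  proof
    assume "det3 (fst a) (snd a) (snd c) = 0"
    then have "\<alpha> * det3 (fst a) (fst c) (snd c) = 0" by (simp add: p det3_linear)
    then have "det3 (fst c) (snd c) (fst a) = 0" using p det3_rotate[of "fst a" "fst c" "snd c"] by simp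
    then obtain \<gamma> \<delta> where q: "fst a = \<gamma> *\<^sub>R fst c + \<delta> *\<^sub>R snd c" using coplanar_combination[OF vc] by metis
    define m where "m = min \<alpha> \<beta>"
    define G where "G = \<bar>\<gamma>\<bar> + \<bar>\<delta>\<bar>"
    \<comment> \<open>The weight of \<open>fst a\<close> is so small that
      \<open>(1 - e) * m - e * G = e\<close> is positive, which keeps both coefficients over
      \<open>c\<close> positive.\<close>
    define e where "e = m / (m + 1 + G)"
    have m: "m > 0" "m \<le> \<alpha>" "m \<le> \<beta>" and G: "G \<ge> 0" "- \<gamma> \<le> G" "- \<delta> \<le> G" using p by (auto simp: m_def G_def)
    have e: "0 < e" "e < 1" using m G by (auto simp: e_def field_simps)
    have "e * (m + 1 + G) = m" using m G by (simp add: e_def)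
    then have "(1 - e) * m - e * G = e" by (simp add: algebra_simps)
    then have eq: "(1 - e) * m - e * G > 0" using e by simp
    have "(1 - e) * \<alpha> \<ge> (1 - e) * m" "(1 - e) * \<beta> \<ge> (1 - e) * m" "e * \<gamma> \<ge> - (e * G)" "e * \<delta> \<ge> - (e * G)"
      using e m G mult_left_mono[of "-\<gamma>" G e] mult_left_mono[of "-\<delta>" G e] by (auto intro: mult_left_mono)
    with eq have pos: "(1 - e) * \<alpha> + e * \<gamma> > 0" "(1 - e) * \<beta> + e * \<delta> > 0" by linarith+
    define x where "x = e *\<^sub>R fst a + (1 - e) *\<^sub>R snd a"
    have "x = ((1 - e) * \<alpha> + e * \<gamma>) *\<^sub>R fst c + ((1 - e) * \<beta> + e * \<delta>) *\<^sub>R snd c"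
      unfolding x_def p(3) q by (simp add: algebra_simps)
    then have "x /\<^sub>R norm x \<in> arc_relint c" using arc_relintI[OF vc] pos by blast
    moreover have "x /\<^sub>R norm x \<in> arc_relint a" using arc_relintI[OF va _ _ x_def] e by auto
    ultimately show False using oarcs_relint_unique[OF a c] ne by blast
  qed
  have "\<alpha> * det3 (fst a) (snd a) (fst c) + \<beta> * det3 (fst a) (snd a) (snd c) = 0"
    using det3_linear(3)[of "fst a" "snd a" \<alpha> "fst c" \<beta> "snd c"] p(3) by simp
  then have "det3 (fst a) (snd a) (fst c) = - (\<beta> / \<alpha>) * det3 (fst a) (snd a) (snd c)"
    using p by (simp add: field_simps)
  moreover have "\<beta> / \<alpha> > 0" using p by simp
  moreover have "(det3 (fst a) (snd a) (snd c))\<^sup>2 > 0" using nz by simp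
  then have "\<beta> / \<alpha> * (det3 (fst a) (snd a) (snd c))\<^sup>2 > 0" using calculation(2) by (rule mult_pos_pos[rotated])
  ultimately show "det3 (fst a) (snd a) (fst c) * det3 (fst a) (snd a) (snd c) < 0"
    by (simp add: power2_eq_square)
qed

end

text \<open>Moving \<open>c\<close> by \<open>- w\<close> leads away from the half-plane that
  contains the polygon, and afterwards the inequalities are strict.\<close>

lemma (in polygon) winding_outside:
  assumes c: "c \<notin> polygon_path P n" and w: "w \<noteq> 0" and h: "\<And>i. Re (cnj w * (P i - c)) \<ge> 0"
  shows "winding P n c = 0"
proof -
  have ww: "Re (cnj w * w) > 0" using w by (simp add: complex_neq_0 power2_eq_square[symmetric])
  have side: "Re (cnj w * (q - c)) \<ge> 0" if q: "q \<in> polygon_path P n" for q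
  proof -
    obtain i t where t: "0 \<le> t" "t \<le> 1" "q = (1 - t) *\<^sub>R P i + t *\<^sub>R P (Suc i)"
      using q by (auto simp: polygon_path_def in_segment)
    have "cnj w * (q - c) = (1 - t) *\<^sub>R (cnj w * (P i - c)) + t *\<^sub>R (cnj w * (P (Suc i) - c))"
      unfolding t by (simp add: scaleR_conv_of_real algebra_simps)
    then have "Re (cnj w * (q - c)) = (1 - t) * Re (cnj w * (P i - c)) + t * Re (cnj w * (P (Suc i) - c))"
      by simp
    then show ?thesis using h t by simp
  qed
  have "winding P n c = winding P n (c - w)"
  proof (rule winding_segment)
    show "closed_segment c (c - w) \<inter> polygon_path P n = {}"
    proof (rule ccontr)
      assume "closed_segment c (c - w) \<inter> polygon_path P n \<noteq> {}"
      then obtain s where s: "0 \<le> s" "(1 - s) *\<^sub>R c + s *\<^sub>R (c - w) \<in> polygon_path P n" by (auto simp: in_segment)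
      have eq: "(1 - s) *\<^sub>R c + s *\<^sub>R (c - w) = c - s *\<^sub>R w" by (simp add: algebra_simps)
      have "s \<noteq> 0" using s c by auto
      have "cnj w * (c - s *\<^sub>R w - c) = - (s *\<^sub>R (cnj w * w))" by (simp add: scaleR_conv_of_real)
      then have "Re (cnj w * (c - s *\<^sub>R w - c)) = - (s * Re (cnj w * w))" by simp
      moreover have "s * Re (cnj w * w) > 0" using ww s \<open>s \<noteq> 0\<close> by (intro mult_pos_pos) auto
      ultimately show False using side[OF s(2)] unfolding eq by simp
    qed
  qed
  also have "\<dots> = 0"
  proof (rule winding_half_plane)
    show "P n = P 0" using periodic[of 0] by simp
    show "0 < Re (cnj w * (P i - (c - w)))" for i
    proof -
      have "cnj w * (P i - (c - w)) = cnj w * (P i - c) + cnj w * w" by (simp add: algebra_simps)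
      then show ?thesis using h[of i] ww by simp
    qed
  qed (rule w)
  finally show ?thesis .
qed

lemma det3_dual:
  "det3 X Y Z *\<^sub>R q = (X \<bullet> q) *\<^sub>R cross3 Y Z + (Y \<bullet> q) *\<^sub>R cross3 Z X + (Z \<bullet> q) *\<^sub>R cross3 X Y"
  by (simp add: det3_def cross3_simps forall_3)

section \<open>Rings of arcs in an octant\<close>

text \<open>For \<open>c = hd as\<close> these are the cyclically consecutive pairs. A free last
  partner lets a cycle be cut into pieces and reassembled.\<close>

fun pairs_to :: "'a list \<Rightarrow> 'a \<Rightarrow> ('a \<times> 'a) list" where
  "pairs_to [] c = []"
| "pairs_to [a] c = [(a, c)]"
| "pairs_to (a # b # r) c = (a, b) # pairs_to (b # r) c"

lemma pairs_to_append:
  "bs \<noteq> [] \<Longrightarrow> pairs_to (as @ bs) c = pairs_to as (hd bs) @ pairs_to bs c"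
  by (induction as c rule: pairs_to.induct) (auto simp: neq_Nil_conv)

lemma length_pairs_to [simp]: "length (pairs_to as c) = length as"
  by (induction as c rule: pairs_to.induct) auto

lemma nth_pairs_to:
  "i < length as \<Longrightarrow> pairs_to as c ! i = (as ! i, if Suc i < length as then as ! Suc i else c)"
  by (induction as c arbitrary: i rule: pairs_to.induct) (auto simp: nth_Cons split: nat.splits)

lemma set_pairs_to_cyclic:
  "set (pairs_to ys (hd ys)) = {(ys ! i, ys ! (Suc i mod length ys)) | i. i < length ys}"
proof -
  have "pairs_to ys (hd ys) ! i = (ys ! i, ys ! (Suc i mod length ys))" if "i < length ys" for i
  proof (cases "Suc i = length ys")
    case True
    moreover have "hd ys = ys ! 0" using that by (intro hd_conv_nth) auto
    ultimately show ?thesis using nth_pairs_to[OF that, of "hd ys"] by simp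
  next
    case False
    then show ?thesis using nth_pairs_to[OF that, of "hd ys"] that by auto
  qed
  then show ?thesis
    unfolding set_conv_nth length_pairs_to by (intro Collect_cong) metis
qed

locale chart = spherical_diagram D for D +
  fixes X Y Z :: "real^3"
  assumes basis: "det3 X Y Z \<noteq> 0"
begin

definition octant :: "(real^3) set" where
  "octant = {v. X \<bullet> v > 0 \<and> Y \<bullet> v > 0 \<and> Z \<bullet> v > 0}"

text \<open>Central projection to the plane where the form \<open>Z\<close> is 1, in the coordinates
  given by \<open>X\<close> and \<open>Y\<close>. It maps arcs within the octant to
  segments.\<close>

definition proj :: "real^3 \<Rightarrow> complex" where
  "proj v = Complex ((X \<bullet> v) / (Z \<bullet> v)) ((Y \<bullet> v) / (Z \<bullet> v))"

text \<open>The factor \<open>det3 X Y Z\<close> corrects the orientation: the sign is the direction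
  of the turn as seen in the projected plane.\<close>

definition turn :: "arc \<Rightarrow> arc \<Rightarrow> real" where
  "turn a c = det3 X Y Z * det3 (fst a) (snd a) (snd c)"

text \<open>Only the heads have to lie in the octant; an arc may begin outside. The polygon joins
  the heads, so its edge \<open>i\<close> runs along arc \<open>i + 1\<close>, from the point that
  arc \<open>i\<close> hits to the head.\<close>

definition ring :: "arc list \<Rightarrow> bool" where
  "ring ys \<longleftrightarrow> ys \<noteq> [] \<and> set ys \<subseteq> oarcs \<and> distinct (map endpoints ys)
     \<and> (\<forall>(a, b) \<in> set (pairs_to ys (hd ys)). snd a \<in> arc_relint b)
     \<and> (\<forall>y \<in> set ys. snd y \<in> octant)"

definition vertex :: "arc list \<Rightarrow> nat \<Rightarrow> complex" where
  "vertex ys i = proj (snd (ys ! (i mod length ys)))"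

definition path_of :: "arc list \<Rightarrow> complex set" where
  "path_of ys = polygon_path (vertex ys) (length ys)"

definition wind :: "arc list \<Rightarrow> complex \<Rightarrow> real" where
  "wind ys = winding (vertex ys) (length ys)"

lemma zero_if_coords_zero: "X \<bullet> q = 0 \<Longrightarrow> Y \<bullet> q = 0 \<Longrightarrow> Z \<bullet> q = 0 \<Longrightarrow> q = 0"
  using det3_dual[of X Y Z q] basis by simp

lemma octant_add:
  assumes "v \<in> octant" "w \<in> octant" "0 \<le> \<alpha>" "0 \<le> \<beta>" "\<alpha> \<noteq> 0 \<or> \<beta> \<noteq> 0"
  shows "\<alpha> *\<^sub>R v + \<beta> *\<^sub>R w \<in> octant"
proof -
  have "\<alpha> * x + \<beta> * y > 0" if "x > 0" "y > 0" for x y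
    using assms(3-5) that by (cases "\<alpha> = 0") (auto intro: add_pos_nonneg)
  then show ?thesis using assms(1,2) by (simp add: octant_def inner_add_right)
qed

lemma octant_scale: "v \<in> octant \<Longrightarrow> 0 < \<kappa> \<Longrightarrow> \<kappa> *\<^sub>R v \<in> octant"
  by (simp add: octant_def)

lemma octant_nonzero: "v \<in> octant \<Longrightarrow> v \<noteq> 0"
  by (auto simp: octant_def)

lemma proj_scale: "\<kappa> \<noteq> 0 \<Longrightarrow> proj (\<kappa> *\<^sub>R v) = proj v"
  by (simp add: proj_def)

lemma proj_combination:
  assumes "v \<in> octant" "w \<in> octant" "0 \<le> \<alpha>" "0 \<le> \<beta>" "\<alpha> \<noteq> 0 \<or> \<beta> \<noteq> 0"
  shows "proj (\<alpha> *\<^sub>R v + \<beta> *\<^sub>R w)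
    = (1 - \<beta> * (Z \<bullet> w) / (\<alpha> * (Z \<bullet> v) + \<beta> * (Z \<bullet> w))) *\<^sub>R proj v
      + (\<beta> * (Z \<bullet> w) / (\<alpha> * (Z \<bullet> v) + \<beta> * (Z \<bullet> w))) *\<^sub>R proj w"
proof -
  have z: "Z \<bullet> v > 0" "Z \<bullet> w > 0" using assms by (auto simp: octant_def)
  have s: "\<alpha> * (Z \<bullet> v) + \<beta> * (Z \<bullet> w) > 0"
    using octant_add[OF assms] by (simp add: octant_def inner_add_right)
  have 1: "1 - \<beta> * (Z \<bullet> w) / (\<alpha> * (Z \<bullet> v) + \<beta> * (Z \<bullet> w)) = \<alpha> * (Z \<bullet> v) / (\<alpha> * (Z \<bullet> v) + \<beta> * (Z \<bullet> w))"
    using s by (simp add: field_simps)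
  show ?thesis unfolding 1 complex_eq_iff using z
    by (simp add: proj_def inner_add_right add_divide_distrib)
qed

lemma proj_segment:
  assumes "v \<in> octant" "w \<in> octant" "c \<in> closed_segment (proj v) (proj w)"
  obtains \<alpha> \<beta> where "0 \<le> \<alpha>" "0 \<le> \<beta>" "\<alpha> \<noteq> 0 \<or> \<beta> \<noteq> 0" "c = proj (\<alpha> *\<^sub>R v + \<beta> *\<^sub>R w)"
    "\<alpha> = 0 \<Longrightarrow> c = proj w" "\<beta> = 0 \<Longrightarrow> c = proj v"
proof -
  have z: "Z \<bullet> v > 0" "Z \<bullet> w > 0" using assms by (auto simp: octant_def)
  obtain t where t: "0 \<le> t" "t \<le> 1" "c = (1 - t) *\<^sub>R proj v + t *\<^sub>R proj w"
    using assms(3) by (auto simp: in_segment)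
  let ?a = "(1 - t) / (Z \<bullet> v)" and ?b = "t / (Z \<bullet> w)"
  have ab: "0 \<le> ?a" "0 \<le> ?b" "?a \<noteq> 0 \<or> ?b \<noteq> 0" using z t by auto
  have "c = proj (?a *\<^sub>R v + ?b *\<^sub>R w)"
    unfolding t(3) proj_combination[OF assms(1,2) ab] using z by simp
  then show ?thesis using ab z t by (intro that[of ?a ?b]) auto
qed

lemma proj_inj:
  assumes "v \<in> octant" "w \<in> octant" "proj v = proj w"
  obtains \<kappa> where "0 < \<kappa>" "v = \<kappa> *\<^sub>R w"
proof -
  have z: "Z \<bullet> v > 0" "Z \<bullet> w > 0" using assms by (auto simp: octant_def)
  define k where "k = (Z \<bullet> v) / (Z \<bullet> w)"
  have k: "k > 0" using z by (simp add: k_def)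
  have "(X \<bullet> v) / (Z \<bullet> v) = (X \<bullet> w) / (Z \<bullet> w)" "(Y \<bullet> v) / (Z \<bullet> v) = (Y \<bullet> w) / (Z \<bullet> w)"
    using assms(3) by (auto simp: proj_def)
  then have "X \<bullet> (v - k *\<^sub>R w) = 0" "Y \<bullet> (v - k *\<^sub>R w) = 0" "Z \<bullet> (v - k *\<^sub>R w) = 0"
    using z by (simp_all add: inner_diff_right k_def field_simps)
  then have "v = k *\<^sub>R w" using zero_if_coords_zero by fastforce
  then show ?thesis using that k by blast
qed

lemma proj_inj_unit:
  assumes "v \<in> octant" "w \<in> octant" "proj v = proj w" "norm v = 1" "norm w = 1"
  shows "v = w"
proof -
  obtain k where "0 < k" "v = k *\<^sub>R w" using proj_inj assms by metis
  then show ?thesis using assms by simp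
qed

lemma proj_orientation:
  assumes "u \<in> octant" "v \<in> octant" "w \<in> octant"
  shows "Im ((proj w - proj v) * cnj (proj v - proj u)) * ((Z \<bullet> u) * (Z \<bullet> v) * (Z \<bullet> w)) = det3 X Y Z * det3 u v w"
proof -
  have z: "Z \<bullet> u > 0" "Z \<bullet> v > 0" "Z \<bullet> w > 0" using assms by (auto simp: octant_def)
  show ?thesis unfolding det3_gram using z
    by (simp add: proj_def field_simps)
qed

lemma proj_turn:
  assumes "u \<in> octant" "v \<in> octant" "w \<in> octant"
  shows "Im ((proj w - proj v) / (proj v - proj u)) > 0 \<longleftrightarrow> det3 X Y Z * det3 u v w > 0"
    and "Im ((proj w - proj v) / (proj v - proj u)) < 0 \<longleftrightarrow> det3 X Y Z * det3 u v w < 0"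
proof -
  define K where "K = (Z \<bullet> u) * (Z \<bullet> v) * (Z \<bullet> w)"
  have K: "K > 0" using assms by (auto simp: octant_def K_def)
  note eq = proj_orientation[OF assms, folded K_def, symmetric]
  show "Im ((proj w - proj v) / (proj v - proj u)) > 0 \<longleftrightarrow> det3 X Y Z * det3 u v w > 0"
    and "Im ((proj w - proj v) / (proj v - proj u)) < 0 \<longleftrightarrow> det3 X Y Z * det3 u v w < 0"
    unfolding eq Im_complex_div_gt_0 Im_complex_div_lt_0 using K
    by (simp_all only: zero_less_mult_iff mult_less_0_iff) auto
qed

text \<open>The tail of \<open>b\<close> may lie outside the octant, where \<open>proj\<close> is of
  no use. Any point of the great circle that precedes the head can replace it.\<close>

lemma turn_sign:
  assumes c: "valid_arc b" "u \<in> octant" "0 < \<alpha>" "u = \<alpha> *\<^sub>R fst b + \<beta> *\<^sub>R snd b" "snd b \<in> octant" "snd c \<in> octant"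
  shows "Im ((proj (snd c) - proj (snd b)) / (proj (snd b) - proj u)) > 0 \<longleftrightarrow> turn b c > 0"
    and "Im ((proj (snd c) - proj (snd b)) / (proj (snd b) - proj u)) < 0 \<longleftrightarrow> turn b c < 0"
proof -
  have "det3 X Y Z * det3 u (snd b) (snd c) = \<alpha> * turn b c"
    by (simp add: assms(4) det3_linear turn_def)
  then show "Im ((proj (snd c) - proj (snd b)) / (proj (snd b) - proj u)) > 0 \<longleftrightarrow> turn b c > 0"
    and "Im ((proj (snd c) - proj (snd b)) / (proj (snd b) - proj u)) < 0 \<longleftrightarrow> turn b c < 0"
    using proj_turn[OF assms(2,5,6)] \<open>0 < \<alpha>\<close> by (simp_all add: zero_less_mult_iff mult_less_0_iff)
qed

lemma turn_nonzero: "a \<in> oarcs \<Longrightarrow> c \<in> oarcs \<Longrightarrow> snd a \<in> arc_relint c \<Longrightarrow> turn a c \<noteq> 0"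
  using hit_transversal(1) basis by (simp add: turn_def)

text \<open>The two ends of the blocking arc lie on opposite sides of the arriving one.\<close>

lemma turn_swap:
  assumes "a \<in> oarcs" "c \<in> oarcs" "snd a \<in> arc_relint c"
  shows "turn a (prod.swap c) < 0 \<longleftrightarrow> turn a c > 0" "turn a (prod.swap c) > 0 \<longleftrightarrow> turn a c < 0"
  using hit_transversal(1,2)[OF assms] basis
  by (auto simp: turn_def mult_less_0_iff zero_less_mult_iff)

end

section \<open>A ring as a simple polygon, and its inside\<close>

locale ring_in_chart = chart +
  fixes ys :: "arc list"
  assumes ring: "ring ys"
begin

abbreviation "n \<equiv> length ys"

lemma n_pos: "n > 0"
  using ring by (simp add: ring_def)

lemma nth_oarcs: "ys ! (i mod n) \<in> oarcs"
proof -
  have "ys ! (i mod n) \<in> set ys" using n_pos by simp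
  then show ?thesis using ring unfolding ring_def by blast
qed

lemma nth_valid: "valid_arc (ys ! (i mod n))"
  using nth_oarcs oarcs_valid by blast

lemma nth_octant: "snd (ys ! (i mod n)) \<in> octant"
  using ring n_pos by (simp add: ring_def)

lemma nth_hits: "snd (ys ! (i mod n)) \<in> arc_relint (ys ! (Suc i mod n))"
proof -
  have "(ys ! (i mod n), ys ! (Suc (i mod n) mod n)) \<in> set (pairs_to ys (hd ys))"
    unfolding set_pairs_to_cyclic using n_pos by force
  then show ?thesis using ring unfolding ring_def by (auto simp: mod_Suc_eq)
qed

lemma nth_endpoints_eq:
  assumes "endpoints (ys ! (i mod n)) = endpoints (ys ! (j mod n))"
  shows "i mod n = j mod n"
proof -
  have "distinct (map endpoints ys)" using ring by (simp add: ring_def)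
  then show ?thesis using assms n_pos nth_eq_iff_index_eq[of "map endpoints ys" "i mod n" "j mod n"] by simp
qed

lemma vertex_eq: "vertex ys i = proj (snd (ys ! (i mod n)))"
  by (simp add: vertex_def)

lemma hit_coeffs:
  obtains \<alpha> \<beta> where "0 < \<alpha>" "0 < \<beta>"
    "snd (ys ! (i mod n)) = \<alpha> *\<^sub>R fst (ys ! (Suc i mod n)) + \<beta> *\<^sub>R snd (ys ! (Suc i mod n))"
  using arc_relintE[OF nth_valid nth_hits] by metis

lemma half_edge_coeffs:
  assumes "c \<in> half_edge (vertex ys) i"
  obtains \<alpha> \<beta> where "0 < \<alpha>" "0 \<le> \<beta>"
    "c = proj (\<alpha> *\<^sub>R snd (ys ! (i mod n)) + \<beta> *\<^sub>R snd (ys ! (Suc i mod n)))"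
proof -
  have "c \<in> closed_segment (proj (snd (ys ! (i mod n)))) (proj (snd (ys ! (Suc i mod n))))"
    and ne: "c \<noteq> proj (snd (ys ! (Suc i mod n)))"
    using assms by (auto simp: half_edge_def vertex_eq)
  then show ?thesis using proj_segment[OF nth_octant nth_octant] that by (metis le_less)
qed

text \<open>The start of the edge is interior to arc \<open>i + 1\<close> because it is a hit point;
  only the end is an endpoint, and the half-edge omits it. Interior-disjointness of the arcs thus
  makes the polygon simple.\<close>

lemma half_edge_relint:
  assumes "c \<in> half_edge (vertex ys) i"
  obtains v where "v \<in> arc_relint (ys ! (Suc i mod n))" "v \<in> octant" "c = proj v"
proof -
  obtain \<alpha> \<beta> where c: "0 < \<alpha>" "0 \<le> \<beta>" "c = proj (\<alpha> *\<^sub>R snd (ys ! (i mod n)) + \<beta> *\<^sub>R snd (ys ! (Suc i mod n)))"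
    using half_edge_coeffs[OF assms] by metis
  obtain a b where ab: "0 < a" "0 < b"
    "snd (ys ! (i mod n)) = a *\<^sub>R fst (ys ! (Suc i mod n)) + b *\<^sub>R snd (ys ! (Suc i mod n))"
    using hit_coeffs by metis
  define x where "x = \<alpha> *\<^sub>R snd (ys ! (i mod n)) + \<beta> *\<^sub>R snd (ys ! (Suc i mod n))"
  have x: "x = (\<alpha> * a) *\<^sub>R fst (ys ! (Suc i mod n)) + (\<alpha> * b + \<beta>) *\<^sub>R snd (ys ! (Suc i mod n))"
    unfolding x_def ab(3) by (simp add: algebra_simps)
  have pos: "0 < \<alpha> * a" "0 < \<alpha> * b + \<beta>" using ab c by (auto intro: add_pos_nonneg)
  have "x \<in> octant" unfolding x_def using octant_add[OF nth_octant nth_octant] c by auto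
  then have "x /\<^sub>R norm x \<in> octant" "proj (x /\<^sub>R norm x) = c"
    using octant_nonzero[of x] c(3) by (auto simp: octant_scale proj_scale x_def)
  then show ?thesis using that arc_relintI(1)[OF nth_valid pos x] by metis
qed

lemma relint_same_proj:
  assumes "a \<in> oarcs" "b \<in> oarcs" "v \<in> arc_relint a" "w \<in> arc_relint b" "v \<in> octant" "w \<in> octant" "proj v = proj w"
  shows "v = w" "endpoints a = endpoints b"
proof -
  have "norm v = 1" "norm w = 1" using assms arc_relintE oarcs_valid by metis+
  then show "v = w" using proj_inj_unit assms by blast
  then show "endpoints a = endpoints b" using oarcs_relint_unique assms by blast
qed

lemma half_edge_meet:
  assumes "c \<in> half_edge (vertex ys) i" "c \<in> half_edge (vertex ys) j"
  shows "Suc i mod n = Suc j mod n"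
proof -
  obtain v w where "v \<in> arc_relint (ys ! (Suc i mod n))" "v \<in> octant" "c = proj v"
    "w \<in> arc_relint (ys ! (Suc j mod n))" "w \<in> octant" "c = proj w"
    using half_edge_relint assms by metis
  then show ?thesis using relint_same_proj(2)[OF nth_oarcs nth_oarcs] nth_endpoints_eq by metis
qed

lemma corner_sign:
  shows "Im ((vertex ys (Suc (Suc i)) - vertex ys (Suc i)) / (vertex ys (Suc i) - vertex ys i)) > 0
      \<longleftrightarrow> turn (ys ! (Suc i mod n)) (ys ! (Suc (Suc i) mod n)) > 0"
    and "Im ((vertex ys (Suc (Suc i)) - vertex ys (Suc i)) / (vertex ys (Suc i) - vertex ys i)) < 0
      \<longleftrightarrow> turn (ys ! (Suc i mod n)) (ys ! (Suc (Suc i) mod n)) < 0"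
proof -
  obtain a b where ab: "0 < a" "0 < b"
    "snd (ys ! (i mod n)) = a *\<^sub>R fst (ys ! (Suc i mod n)) + b *\<^sub>R snd (ys ! (Suc i mod n))"
    using hit_coeffs by metis
  show "Im ((vertex ys (Suc (Suc i)) - vertex ys (Suc i)) / (vertex ys (Suc i) - vertex ys i)) > 0
      \<longleftrightarrow> turn (ys ! (Suc i mod n)) (ys ! (Suc (Suc i) mod n)) > 0"
    and "Im ((vertex ys (Suc (Suc i)) - vertex ys (Suc i)) / (vertex ys (Suc i) - vertex ys i)) < 0
      \<longleftrightarrow> turn (ys ! (Suc i mod n)) (ys ! (Suc (Suc i) mod n)) < 0"
    unfolding vertex_eq
    using turn_sign[OF nth_valid nth_octant ab(1,3) nth_octant nth_octant] by auto
qed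

sublocale polygon "vertex ys" "length ys"
proof
  show "vertex ys (i + n) = vertex ys i" for i by (simp add: vertex_eq)
  show "n > 0" by (rule n_pos)
  show "half_edge (vertex ys) i \<inter> half_edge (vertex ys) j = {}" if "i < n" "j < n" "i \<noteq> j" for i j
  proof -
    have "Suc i mod n \<noteq> Suc j mod n" using mod_add_right_cancel_nat[of i 1 n j] that by auto
    then show ?thesis using half_edge_meet by blast
  qed
  show "Im ((vertex ys (Suc (Suc i)) - vertex ys (Suc i)) / (vertex ys (Suc i) - vertex ys i)) \<noteq> 0" for i
    using corner_sign[of i] turn_nonzero[OF nth_oarcs nth_oarcs nth_hits, of "Suc i"] by auto
qed

end

text \<open>The sum is symmetric, so mirroring the chart by exchanging \<open>X\<close> and
  \<open>Y\<close> preserves it. Since both coordinates are positive on the octant, a bound on the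
  height cuts out a triangle.\<close>

definition (in chart) height :: "real^3 \<Rightarrow> real" where
  "height v = Re (proj v) + Im (proj v)"

definition (in chart) crest :: "arc list \<Rightarrow> real" where
  "crest ys = Max ((\<lambda>y. height (snd y)) ` set ys)"

context ring_in_chart
begin

definition inside :: "real^3 \<Rightarrow> bool" where
  "inside v \<longleftrightarrow> v \<in> octant \<and> proj v \<notin> path_of ys \<and> wind ys (proj v) \<noteq> 0"

lemma path_half_edge:
  assumes "c \<in> path_of ys"
  obtains i where "c \<in> half_edge (vertex ys) i"
proof -
  obtain i where "c \<in> closed_segment (vertex ys i) (vertex ys (Suc i))"
    using assms by (auto simp: path_of_def polygon_path_def)
  then show ?thesis using that start_in_half_edge[of "Suc i"] by (cases "c = vertex ys (Suc i)") (auto simp: half_edge_def)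
qed

lemma off_path:
  assumes "d \<in> oarcs" "endpoints d \<notin> endpoints ` set ys" "v \<in> arc_relint d" "v \<in> octant"
  shows "proj v \<notin> path_of ys"
proof
  assume "proj v \<in> path_of ys"
  then obtain i where "proj v \<in> half_edge (vertex ys) i" using path_half_edge by metis
  then obtain w where w: "w \<in> arc_relint (ys ! (Suc i mod n))" "w \<in> octant" "proj v = proj w"
    using half_edge_relint by metis
  then have "endpoints d = endpoints (ys ! (Suc i mod n))"
    using relint_same_proj(2)[OF assms(1) nth_oarcs assms(3)] assms(4) by metis
  then show False using assms(2) n_pos by auto
qed

lemma on_path:
  assumes "v \<in> arc_relint (ys ! (Suc i mod n))" "v \<in> octant" "proj v \<in> path_of ys"
  shows "proj v \<in> half_edge (vertex ys) i"
proof -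
  obtain k where k: "proj v \<in> half_edge (vertex ys) k" using path_half_edge assms(3) by metis
  then obtain w where w: "w \<in> arc_relint (ys ! (Suc k mod n))" "w \<in> octant" "proj v = proj w"
    using half_edge_relint by metis
  then have "endpoints (ys ! (Suc i mod n)) = endpoints (ys ! (Suc k mod n))"
    using relint_same_proj(2)[OF nth_oarcs nth_oarcs assms(1)] assms(2) by metis
  then have "Suc i mod n = Suc k mod n" by (rule nth_endpoints_eq)
  then have "Suc (i mod n) mod n = Suc (k mod n) mod n" by (simp add: mod_Suc_eq)
  then have "i mod n = k mod n" using mod_add_right_cancel_nat[of "i mod n" 1 n "k mod n"] n_pos by simp
  then show ?thesis using k half_edge_mod by metis
qed

text \<open>These are the points of arc \<open>i + 1\<close> before the hit. By
  \<open>on_path\<close> only the half-edge on the same arc could contain one, and uniqueness of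
  coefficients excludes that, because such a point has a larger share of \<open>fst\<close>.\<close>

lemma tail_off_path:
  assumes "0 < \<gamma>" "0 < \<delta>" "x = \<gamma> *\<^sub>R snd (ys ! (i mod n)) + \<delta> *\<^sub>R fst (ys ! (Suc i mod n))" "x \<in> octant"
  shows "proj x \<notin> path_of ys"
proof
  assume on: "proj x \<in> path_of ys"
  let ?b = "ys ! (Suc i mod n)"
  obtain a b where ab: "0 < a" "0 < b" "snd (ys ! (i mod n)) = a *\<^sub>R fst ?b + b *\<^sub>R snd ?b"
    using hit_coeffs by metis
  have x: "x = (\<gamma> * a + \<delta>) *\<^sub>R fst ?b + (\<gamma> * b) *\<^sub>R snd ?b"
    unfolding assms(3) ab(3) by (simp add: algebra_simps)
  have "0 < \<gamma> * a + \<delta>" "0 < \<gamma> * b" using assms ab by (auto intro: add_pos_pos)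
  then have "x /\<^sub>R norm x \<in> arc_relint ?b" using arc_relintI(1)[OF nth_valid _ _ x] by blast
  moreover have x0: "x \<noteq> 0" using assms octant_nonzero by auto
  then have "x /\<^sub>R norm x \<in> octant" "proj (x /\<^sub>R norm x) = proj x"
    using assms by (auto simp: octant_scale proj_scale)
  ultimately have "proj x \<in> half_edge (vertex ys) i" using on_path on by metis
  then obtain \<alpha> \<beta> where c: "0 < \<alpha>" "0 \<le> \<beta>" "proj x = proj (\<alpha> *\<^sub>R snd (ys ! (i mod n)) + \<beta> *\<^sub>R snd ?b)"
    using half_edge_coeffs by metis
  have "\<alpha> *\<^sub>R snd (ys ! (i mod n)) + \<beta> *\<^sub>R snd ?b \<in> octant" using octant_add[OF nth_octant nth_octant] c by auto
  then obtain \<kappa> where k: "0 < \<kappa>" "x = \<kappa> *\<^sub>R (\<alpha> *\<^sub>R snd (ys ! (i mod n)) + \<beta> *\<^sub>R snd ?b)"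
    using proj_inj[OF assms(4) _ c(3)] by metis
  have "x = (\<kappa> * \<alpha> * a) *\<^sub>R fst ?b + (\<kappa> * (\<alpha> * b + \<beta>)) *\<^sub>R snd ?b"
    unfolding k(2) ab(3) by (simp add: algebra_simps)
  then have eq: "\<gamma> * a + \<delta> = \<kappa> * \<alpha> * a" "\<gamma> * b = \<kappa> * (\<alpha> * b + \<beta>)"
    using valid_arc_coeff_unique[OF nth_valid] x by metis+
  have "\<gamma> * b \<ge> \<kappa> * \<alpha> * b" unfolding eq(2) using k c by (simp add: algebra_simps)
  then have "\<gamma> \<ge> \<kappa> * \<alpha>" using ab by simp
  then have "\<gamma> * a \<ge> \<kappa> * \<alpha> * a" using ab by simp
  then show False using eq(1) assms by linarith
qed

text \<open>Beyond a line that has all vertices on its other side, the total angle is zero.\<close>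

lemma region_half_plane:
  assumes c: "c \<in> path_of ys \<or> wind ys c \<noteq> 0" and h: "\<And>i. Re (w * vertex ys i) \<ge> b"
  shows "Re (w * c) \<ge> b"
proof (cases "c \<in> path_of ys")
  case True
  then obtain i t where t: "0 \<le> t" "t \<le> 1" "c = (1 - t) *\<^sub>R vertex ys i + t *\<^sub>R vertex ys (Suc i)"
    by (auto simp: path_of_def polygon_path_def in_segment)
  have "w * c = (1 - t) *\<^sub>R (w * vertex ys i) + t *\<^sub>R (w * vertex ys (Suc i))"
    unfolding t by (simp add: scaleR_conv_of_real algebra_simps)
  then have "Re (w * c) = (1 - t) * Re (w * vertex ys i) + t * Re (w * vertex ys (Suc i))" by simp
  moreover have "(1 - t) * Re (w * vertex ys i) \<ge> (1 - t) * b" "t * Re (w * vertex ys (Suc i)) \<ge> t * b"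
    using h t by (auto intro: mult_left_mono)
  moreover have "(1 - t) * b + t * b = b" by (simp add: algebra_simps)
  ultimately show ?thesis by linarith
next
  case False
  show ?thesis
  proof (cases "w = 0")
    case True
    then show ?thesis using h[of 0] by simp
  next
    case w: False
    show ?thesis
    proof (rule ccontr)
      assume "\<not> ?thesis"
      then have "Re (cnj (cnj w) * (vertex ys i - c)) \<ge> 0" for i
        using h[of i] by (simp add: algebra_simps)
      then have "winding (vertex ys) n c = 0"
        using winding_outside[of c "cnj w"] False w by (simp add: path_of_def)
      then show False using c False by (simp add: wind_def)
    qed
  qed
qed

lemma vertex_height: "Re (vertex ys i) + Im (vertex ys i) \<le> crest ys"
  unfolding crest_def height_def vertex_eq using n_pos by (intro Max_ge) auto

lemma region_height:
  assumes "proj v \<in> path_of ys \<or> wind ys (proj v) \<noteq> 0"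
  shows "height v \<le> crest ys"
proof -
  have "- crest ys \<le> Re (Complex (-1) 1 * vertex ys i)" for i using vertex_height[of i] by simp
  then show ?thesis using region_half_plane[OF assms, of "- crest ys" "Complex (-1) 1"] by (simp add: height_def)
qed

lemma inside_height:
  assumes "inside v"
  shows "height v < crest ys"
proof (rule ccontr)
  assume h: "\<not> ?thesis"
  have "winding (vertex ys) n (proj v) = 0"
  proof (rule winding_outside[where w = "Complex (-1) (-1)"])
    show "proj v \<notin> polygon_path (vertex ys) n" using assms by (simp add: inside_def path_of_def)
    show "0 \<le> Re (cnj (Complex (- 1) (- 1)) * (vertex ys i - proj v))" for i
      using vertex_height[of i] h by (simp add: height_def)
  qed (simp add: complex_eq_iff)
  then show False using assms by (simp add: inside_def wind_def)
qed

lemma continuous_on_proj: "continuous_on octant proj"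
proof -
  have "proj = (\<lambda>v. of_real ((X \<bullet> v) / (Z \<bullet> v)) + \<i> * of_real ((Y \<bullet> v) / (Z \<bullet> v)))"
    by (auto simp: proj_def complex_eq_iff)
  then show ?thesis by (auto intro!: continuous_intros simp: octant_def)
qed

lemma wind_constant:
  assumes "v \<in> octant" "e \<in> octant"
    and off: "\<And>s. 0 \<le> s \<Longrightarrow> s \<le> 1 \<Longrightarrow> proj ((1 - s) *\<^sub>R v + s *\<^sub>R e) \<notin> path_of ys"
  shows "wind ys (proj v) = wind ys (proj e)"
proof -
  define g where "g s = (1 - s) *\<^sub>R v + s *\<^sub>R e" for s
  have "winding (vertex ys) n (proj (g 0)) = winding (vertex ys) n (proj (g 1))"
  proof (rule winding_constant[where S = "{0..1::real}" and g = "\<lambda>s. proj (g s)"])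
    have "continuous_on {0..1} g" unfolding g_def by (intro continuous_intros)
    moreover have "g ` {0..1} \<subseteq> octant" unfolding g_def using octant_add[OF assms(1,2)] by force
    ultimately show "continuous_on {0..1} (\<lambda>s. proj (g s))"
      by (metis continuous_on_compose2 continuous_on_proj)
  qed (use off in \<open>auto simp: g_def path_of_def\<close>)
  then show ?thesis by (simp add: g_def wind_def)
qed

lemma open_octant: "open octant"
  unfolding octant_def by (intro open_Collect_conj open_Collect_less continuous_intros)

text \<open>The region of nonzero winding number lies in the convex hull of the vertices, so a segment that
  starts inside cannot leave the octant before it meets the polygon.\<close>

lemma trapped:
  assumes a: "inside a"
    and nz: "\<And>s. 0 \<le> s \<Longrightarrow> s \<le> 1 \<Longrightarrow> (1 - s) *\<^sub>R a + s *\<^sub>R e \<noteq> 0"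
    and off: "\<And>s. 0 \<le> s \<Longrightarrow> s < 1 \<Longrightarrow> (1 - s) *\<^sub>R a + s *\<^sub>R e \<in> octant \<Longrightarrow> proj ((1 - s) *\<^sub>R a + s *\<^sub>R e) \<notin> path_of ys"
  shows "e \<in> octant" "proj e \<notin> path_of ys \<Longrightarrow> inside e"
proof -
  define v where "v s = (1 - s) *\<^sub>R a + s *\<^sub>R e" for s
  have a': "a \<in> octant" "wind ys (proj a) \<noteq> 0" using a by (auto simp: inside_def)
  define m where "m = Min ((\<lambda>y. min (Re (proj (snd y))) (Im (proj (snd y)))) ` set ys)"
  have m0: "m > 0"
  proof -
    have "min (Re (proj (snd y))) (Im (proj (snd y))) > 0" if "y \<in> set ys" for y
    proof -
      have "snd y \<in> octant" using that ring by (auto simp: ring_def)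
      then show ?thesis by (auto simp: proj_def octant_def)
    qed
    then show ?thesis unfolding m_def using ring by (subst Min_gr_iff) (auto simp: ring_def)
  qed
  have m: "m \<le> Re (vertex ys i)" "m \<le> Im (vertex ys i)" for i
  proof -
    have "m \<le> min (Re (vertex ys i)) (Im (vertex ys i))"
      unfolding m_def vertex_eq using n_pos by (intro Min_le) auto
    then show "m \<le> Re (vertex ys i)" "m \<le> Im (vertex ys i)" by auto
  qed
  define M where "M = max (crest ys) (2 * m + 1)"
  \<comment> \<open>This is the closed cone over the triangle that contains the region, in
    homogeneous coordinates. The inequality \<open>M > 2 * m\<close> forces
    \<open>Z \<bullet> w \<ge> 0\<close>, and nonzero vectors of the cone lie in the octant.\<close>
  define K where "K w \<longleftrightarrow> m * (Z \<bullet> w) \<le> X \<bullet> w \<and> m * (Z \<bullet> w) \<le> Y \<bullet> w \<and> X \<bullet> w + Y \<bullet> w \<le> M * (Z \<bullet> w)" for w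
  have regionK: "K w" if w: "w \<in> octant" "proj w \<in> path_of ys \<or> wind ys (proj w) \<noteq> 0" for w
  proof -
    have "Re (proj w) \<ge> m" using region_half_plane[OF w(2), of m 1] m by simp
    moreover have "Im (proj w) \<ge> m" using region_half_plane[OF w(2), of m "-\<i>"] m by simp
    moreover have "Re (proj w) + Im (proj w) \<le> M" using region_height[OF w(2)] by (simp add: height_def M_def)
    ultimately show ?thesis using w(1) unfolding K_def octant_def proj_def
      by (simp add: field_simps add_divide_distrib[symmetric])
  qed
  have K_octant: "w \<in> octant" if "K w" "w \<noteq> 0" for w
  proof -
    have "M > 2 * m" by (simp add: M_def)
    have "(M - 2 * m) * (Z \<bullet> w) \<ge> 0" using that(1) unfolding K_def by (simp add: algebra_simps)
    then have z: "Z \<bullet> w \<ge> 0" using \<open>M > 2 * m\<close> by (simp add: zero_le_mult_iff)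
    have "Z \<bullet> w \<noteq> 0"
    proof
      assume "Z \<bullet> w = 0"
      then have "X \<bullet> w = 0" "Y \<bullet> w = 0" using that(1) by (auto simp: K_def)
      then show False using zero_if_coords_zero \<open>Z \<bullet> w = 0\<close> that(2) by blast
    qed
    then have "Z \<bullet> w > 0" "m * (Z \<bullet> w) > 0" using z m0 by auto
    then show ?thesis using that(1) by (auto simp: K_def octant_def)
  qed
  have same: "wind ys (proj (v s)) = wind ys (proj a)"
    if s: "0 \<le> s" "s \<le> 1" "v s \<in> octant" "proj (v s) \<notin> path_of ys" for s
  proof -
    have "wind ys (proj a) = wind ys (proj (v s))"
    proof (rule wind_constant[OF a'(1) s(3)])
      fix r :: real assume r: "0 \<le> r" "r \<le> 1"
      have eq: "(1 - r) *\<^sub>R a + r *\<^sub>R v s = v (r * s)" by (simp add: v_def algebra_simps)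
      have oc: "(1 - r) *\<^sub>R a + r *\<^sub>R v s \<in> octant" using octant_add[OF a'(1) s(3)] r by force
      show "proj ((1 - r) *\<^sub>R a + r *\<^sub>R v s) \<notin> path_of ys"
      proof (cases "r * s < 1")
        case True
        then show ?thesis using off[of "r * s"] oc s r unfolding eq by (simp add: v_def)
      next
        case False
        moreover have "r * s \<le> r * 1" using r s by (intro mult_left_mono) auto
        ultimately have "r = 1" using r by simp
        then show ?thesis using s(4) by simp
      qed
    qed
    then show ?thesis by simp
  qed
  have iff: "v s \<in> octant \<longleftrightarrow> K (v s)" if s: "0 \<le> s" "s \<le> 1" for s
  proof
    assume "v s \<in> octant"
    then show "K (v s)" using regionK same[OF s] a' by metis
  next
    assume "K (v s)"
    then show "v s \<in> octant" using K_octant nz[OF s] by (simp add: v_def)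
  qed
  have cv: "continuous_on {0..1} v" unfolding v_def by (intro continuous_intros)
  \<comment> \<open>Along the segment, lying in the open octant is equivalent to lying in the closed
    cone. The set of such parameters is clopen in the unit interval and contains 0.\<close>
  have op: "openin (top_of_set {0..1}) ({0..1} \<inter> v -` octant)"
    using cv open_octant by (rule continuous_openin_preimage_gen)
  have "closed {w. K w}"
    unfolding K_def by (intro closed_Collect_conj closed_Collect_le continuous_intros)
  then have "closedin (top_of_set {0..1}) ({0..1} \<inter> v -` {w. K w})"
    by (rule continuous_closedin_preimage[OF cv])
  moreover have "{0..1} \<inter> v -` {w. K w} = {0..1} \<inter> v -` octant" using iff by auto
  ultimately have cl: "closedin (top_of_set {0..1}) ({0..1} \<inter> v -` octant)" by simp
  have "connected {0..1::real}" by simp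
  then have "{0..1} \<inter> v -` octant = {} \<or> {0..1} \<inter> v -` octant = {0..1}"
    using op cl unfolding connected_clopen by blast
  moreover have "0 \<in> {0..1} \<inter> v -` octant" using a' by (simp add: v_def)
  ultimately have "1 \<in> {0..1} \<inter> v -` octant" by (metis empty_iff atLeastAtMost_iff zero_le_one order_refl)
  then show e: "e \<in> octant" by (simp add: v_def)
  show "inside e" if "proj e \<notin> path_of ys"
    using same[of 1] e that a' by (simp add: v_def inside_def)
qed

end

section \<open>Tails at the corners, and arcs arriving from the inside\<close>

context ring_in_chart
begin

text \<open>The total angle on the edges. The value \<open>2 * pi\<close> means that the inside is
  on the left of the ring and the angle to its right is zero.\<close>

abbreviation "level \<equiv> corner_value (vertex ys) n"

lemma short_tail:
  obtains s where "0 < s" "s < 1" "(1 - s) *\<^sub>R snd (ys ! (i mod n)) + s *\<^sub>R fst (ys ! (Suc i mod n)) \<in> octant"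
proof -
  let ?p = "snd (ys ! (i mod n))" and ?q = "fst (ys ! (Suc i mod n))"
  obtain e where e: "e > 0" "ball ?p e \<subseteq> octant"
    using open_octant nth_octant by (metis open_contains_ball)
  define N where "N = norm (?q - ?p)"
  define s where "s = min (1/2) (e / (2 * (N + 1)))"
  have N: "N \<ge> 0" by (simp add: N_def)
  have s: "0 < s" "s < 1" using e N by (auto simp: s_def)
  have "s * N \<le> e / (2 * (N + 1)) * N" using N by (intro mult_right_mono) (auto simp: s_def)
  also have "\<dots> < e" using e N by (simp add: field_simps) (smt (verit) mult_nonneg_nonneg)
  finally have "s * N < e" .
  moreover have "dist ?p ((1 - s) *\<^sub>R ?p + s *\<^sub>R ?q) = s * N"
  proof -
    have "?p - ((1 - s) *\<^sub>R ?p + s *\<^sub>R ?q) = s *\<^sub>R (?p - ?q)" by (simp add: algebra_simps)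
    then show ?thesis using s by (simp add: dist_norm N_def norm_minus_commute)
  qed
  ultimately have "(1 - s) *\<^sub>R ?p + s *\<^sub>R ?q \<in> ball ?p e" by simp
  then show ?thesis using that[OF s] e(2) by blast
qed

text \<open>The tail lies on the same great circle as the edge that follows, so it projects to the
  backward extension of that edge.\<close>

lemma tail_direction:
  assumes "0 < s" "x = (1 - s) *\<^sub>R snd (ys ! (i mod n)) + s *\<^sub>R fst (ys ! (Suc i mod n))" "x \<in> octant" "s < 1"
  obtains \<tau> where "0 < \<tau>" "proj x - vertex ys i = - of_real \<tau> * (vertex ys (Suc i) - vertex ys i)"
proof -
  let ?p = "snd (ys ! (i mod n))" and ?b = "ys ! (Suc i mod n)"
  obtain a b where ab: "0 < a" "0 < b" "?p = a *\<^sub>R fst ?b + b *\<^sub>R snd ?b" using hit_coeffs by metis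
  define \<beta> where "\<beta> = s * b / a"
  define k where "k = 1 - s + s / a"
  have \<beta>: "\<beta> > 0" using assms ab by (simp add: \<beta>_def)
  have k: "k > 0" using assms ab by (simp add: k_def add_pos_pos)
  have "s *\<^sub>R fst ?b = (s / a) *\<^sub>R ?p - \<beta> *\<^sub>R snd ?b"
    unfolding ab(3) \<beta>_def using ab(1) by (simp add: algebra_simps)
  then have "k *\<^sub>R ?p = 1 *\<^sub>R x + \<beta> *\<^sub>R snd ?b" unfolding assms(2) k_def by (simp add: algebra_simps)
  then have "vertex ys i = proj (1 *\<^sub>R x + \<beta> *\<^sub>R snd ?b)"
    unfolding vertex_eq using k by (metis proj_scale less_irrefl)
  define t where "t = \<beta> * (Z \<bullet> snd ?b) / (1 * (Z \<bullet> x) + \<beta> * (Z \<bullet> snd ?b))"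
  have z: "Z \<bullet> x > 0" "Z \<bullet> snd ?b > 0" using assms(3) nth_octant by (auto simp: octant_def)
  have t: "0 < t" "t < 1" using z \<beta> by (auto simp: t_def field_simps add_pos_pos)
  have "vertex ys i = (1 - t) *\<^sub>R proj x + t *\<^sub>R vertex ys (Suc i)"
    using proj_combination[OF assms(3) nth_octant[of "Suc i"], of 1 \<beta>] \<beta> \<open>vertex ys i = _\<close>
    unfolding vertex_eq[of "Suc i"] t_def by simp
  then have v: "of_real (1 - t) * (proj x - vertex ys i) = - of_real t * (vertex ys (Suc i) - vertex ys i)"
    by (simp add: scaleR_conv_of_real algebra_simps)
  have "proj x - vertex ys i = - of_real (t / (1 - t)) * (vertex ys (Suc i) - vertex ys i)"
  proof -
    have "complex_of_real (1 - t) \<noteq> 0" using t by simp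
    then show ?thesis using v by (simp add: field_simps)
  qed
  then show ?thesis using that[of "t / (1 - t)"] t by simp
qed

lemma tail_segment_off_path:
  assumes "0 < s" "s < 1" "x = (1 - s) *\<^sub>R snd (ys ! (i mod n)) + s *\<^sub>R fst (ys ! (Suc i mod n))" "x \<in> octant"
    and r: "0 < r" "r \<le> 1"
  shows "vertex ys i + of_real r * (proj x - vertex ys i) \<notin> path_of ys"
proof -
  let ?p = "snd (ys ! (i mod n))" and ?b = "ys ! (Suc i mod n)"
  define c where "c = vertex ys i + of_real r * (proj x - vertex ys i)"
  have c: "c = (1 - r) *\<^sub>R proj ?p + r *\<^sub>R proj x"
    by (simp add: c_def vertex_eq scaleR_conv_of_real algebra_simps)
  then have "c \<in> closed_segment (proj ?p) (proj x)" using r by (auto simp: in_segment intro!: exI[of _ r])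
  then obtain \<alpha> \<beta> where ab: "0 \<le> \<alpha>" "0 \<le> \<beta>" "\<alpha> \<noteq> 0 \<or> \<beta> \<noteq> 0" "c = proj (\<alpha> *\<^sub>R ?p + \<beta> *\<^sub>R x)" "\<beta> = 0 \<Longrightarrow> c = proj ?p"
    using proj_segment[OF nth_octant assms(4)] by metis
  obtain \<tau> where tau: "0 < \<tau>" "proj x - vertex ys i = - of_real \<tau> * (vertex ys (Suc i) - vertex ys i)"
    using tail_direction[OF assms(1,3,4,2)] by metis
  have "proj x \<noteq> vertex ys i" using tau edge_ne[of i] by auto
  then have "\<beta> \<noteq> 0" using ab(5) r c by (auto simp: vertex_eq c_def)
  have "\<alpha> *\<^sub>R ?p + \<beta> *\<^sub>R x = (\<alpha> + \<beta> * (1 - s)) *\<^sub>R ?p + (\<beta> * s) *\<^sub>R fst ?b"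
    unfolding assms(3) by (simp add: algebra_simps)
  moreover have "0 < \<alpha> + \<beta> * (1 - s)" "0 < \<beta> * s" using ab \<open>\<beta> \<noteq> 0\<close> assms by (auto intro: add_nonneg_pos)
  moreover have "\<alpha> *\<^sub>R ?p + \<beta> *\<^sub>R x \<in> octant" using octant_add[OF nth_octant assms(4)] ab by blast
  ultimately have "proj (\<alpha> *\<^sub>R ?p + \<beta> *\<^sub>R x) \<notin> path_of ys" using tail_off_path by metis
  then show ?thesis using ab(4) c_def by simp
qed

text \<open>Extending the outgoing edge backwards leads to the right of the polygon at a left turn
  and to its left at a right turn.\<close>

lemma tail_wind:
  assumes "0 < s" "s < 1" "x = (1 - s) *\<^sub>R snd (ys ! (Suc i mod n)) + s *\<^sub>R fst (ys ! (Suc (Suc i) mod n))" "x \<in> octant"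
  shows "turn (ys ! (Suc i mod n)) (ys ! (Suc (Suc i) mod n)) > 0 \<Longrightarrow> wind ys (proj x) = level - 2 * pi"
    and "turn (ys ! (Suc i mod n)) (ys ! (Suc (Suc i) mod n)) < 0 \<Longrightarrow> wind ys (proj x) = level"
proof -
  obtain \<tau> where tau: "0 < \<tau>" "proj x - vertex ys (Suc i) = - of_real \<tau> * (vertex ys (Suc (Suc i)) - vertex ys (Suc i))"
    using tail_direction[OF assms(1,3,4,2)] by metis
  have off: "vertex ys (Suc i) + of_real r * (proj x - vertex ys (Suc i)) \<notin> polygon_path (vertex ys) n" if "0 < r" "r \<le> 1" for r
    using tail_segment_off_path[OF assms that] by (simp add: path_of_def)
  show "wind ys (proj x) = level" if "turn (ys ! (Suc i mod n)) (ys ! (Suc (Suc i) mod n)) < 0"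
    using winding_at_right_corner[OF off _ tau(2,1)] corner_sign(2)[of i] that by (simp add: wind_def)
  have "(proj x - vertex ys (Suc i)) / (vertex ys (Suc (Suc i)) - vertex ys (Suc i)) = - of_real \<tau>"
    unfolding tau(2) using edge_ne[of "Suc i"] by simp
  then have "Im ((proj x - vertex ys (Suc i)) / (vertex ys (Suc (Suc i)) - vertex ys (Suc i))) \<le> 0" by simp
  then show "wind ys (proj x) = level - 2 * pi" if "turn (ys ! (Suc i mod n)) (ys ! (Suc (Suc i) mod n)) > 0"
    using winding_at_left_corner[OF off] corner_sign(1)[of i] that by (simp add: wind_def)
qed

text \<open>The highest vertex fixes on which side the polygon has its inside: the arc through it
  continues above the polygon.\<close>

lemma level_from_crest:
  assumes "height (snd (ys ! (Suc i mod n))) = crest ys"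
  shows "turn (ys ! (Suc i mod n)) (ys ! (Suc (Suc i) mod n)) > 0 \<Longrightarrow> level = 2 * pi"
    and "turn (ys ! (Suc i mod n)) (ys ! (Suc (Suc i) mod n)) < 0 \<Longrightarrow> level = 0"
proof -
  obtain s where s: "0 < s" "s < 1"
    "(1 - s) *\<^sub>R snd (ys ! (Suc i mod n)) + s *\<^sub>R fst (ys ! (Suc (Suc i) mod n)) \<in> octant"
    using short_tail[of "Suc i"] by metis
  define x where "x = (1 - s) *\<^sub>R snd (ys ! (Suc i mod n)) + s *\<^sub>R fst (ys ! (Suc (Suc i) mod n))"
  have x: "x \<in> octant" using s by (simp add: x_def)
  obtain \<tau> where tau: "0 < \<tau>" "proj x - vertex ys (Suc i) = - of_real \<tau> * (vertex ys (Suc (Suc i)) - vertex ys (Suc i))"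
    using tail_direction[OF s(1) x_def x s(2)] by metis
  have px: "proj x = vertex ys (Suc i) - of_real \<tau> * (vertex ys (Suc (Suc i)) - vertex ys (Suc i))"
    using tau(2) by (simp add: algebra_simps)
  have "height x = Re (vertex ys (Suc i)) + Im (vertex ys (Suc i))
     + \<tau> * (Re (vertex ys (Suc i)) + Im (vertex ys (Suc i)) - (Re (vertex ys (Suc (Suc i))) + Im (vertex ys (Suc (Suc i)))))"
    unfolding height_def px by (simp add: algebra_simps)
  moreover have "Re (vertex ys (Suc i)) + Im (vertex ys (Suc i)) = crest ys"
    using assms by (simp add: vertex_eq height_def)
  moreover have "\<tau> * (crest ys - (Re (vertex ys (Suc (Suc i))) + Im (vertex ys (Suc (Suc i))))) \<ge> 0"
    using tau(1) vertex_height[of "Suc (Suc i)"] by simp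
  ultimately have "\<not> inside x" using inside_height[of x] by auto
  moreover have "proj x \<notin> path_of ys" using tail_off_path[OF _ s(1) x_def x] s by simp
  ultimately have 0: "wind ys (proj x) = 0" using x by (simp add: inside_def)
  show "turn (ys ! (Suc i mod n)) (ys ! (Suc (Suc i) mod n)) > 0 \<Longrightarrow> level = 2 * pi"
    and "turn (ys ! (Suc i mod n)) (ys ! (Suc (Suc i) mod n)) < 0 \<Longrightarrow> level = 0"
    using tail_wind[OF s(1,2) x_def x] 0 by auto
qed

text \<open>With the inside on the left, an arc from the inside that meets an open edge turns left
  into its direction. A right turn leaves two places: the tail of the edge, which is inside only at
  a right corner, or the corner itself, again only if it is a right one. A ring rerouted over
  \<open>d\<close> therefore gains no right turn that the old corner did not have.\<close>

lemma inside_arrival: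
  assumes d: "d \<in> oarcs" and hit: "snd d \<in> arc_relint (ys ! (Suc (Suc i) mod n))" and v: "snd d \<in> octant"
    and e: "inside e" "0 < \<alpha>" "e = \<alpha> *\<^sub>R fst d + \<beta> *\<^sub>R snd d"
    and off: "\<And>s. 0 \<le> s \<Longrightarrow> s < 1 \<Longrightarrow> proj ((1 - s) *\<^sub>R e + s *\<^sub>R snd d) \<notin> path_of ys"
    and level: "level = 2 * pi"
    and right: "turn d (ys ! (Suc (Suc i) mod n)) < 0"
  shows "turn (ys ! (Suc i mod n)) (ys ! (Suc (Suc i) mod n)) < 0"
    and "proj (snd d) \<in> path_of ys \<Longrightarrow> proj (snd d) = vertex ys (Suc i)"
proof -
  let ?a = "ys ! (Suc i mod n)" and ?b = "ys ! (Suc (Suc i) mod n)"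
  have e': "e \<in> octant" "wind ys (proj e) \<noteq> 0" using e by (auto simp: inside_def)
  obtain a b where ab: "0 < a" "0 < b" "snd ?a = a *\<^sub>R fst ?b + b *\<^sub>R snd ?b" using hit_coeffs[of "Suc i"] by metis
  obtain \<gamma> \<delta> where gd: "0 < \<gamma>" "0 < \<delta>" "snd d = \<gamma> *\<^sub>R fst ?b + \<delta> *\<^sub>R snd ?b"
    using arc_relintE[OF nth_valid hit] by metis
  define u where "u = proj e - proj (snd d)"
  have offu: "proj (snd d) + of_real r * u \<notin> path_of ys" if r: "0 < r" "r \<le> 1" for r
  proof -
    have "proj (snd d) + of_real r * u = (1 - r) *\<^sub>R proj (snd d) + r *\<^sub>R proj e"
      by (simp add: u_def scaleR_conv_of_real algebra_simps)
    then have "proj (snd d) + of_real r * u \<in> closed_segment (proj (snd d)) (proj e)" using r by (auto simp: in_segment intro!: exI[of _ r])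
    then obtain x y where xy: "0 \<le> x" "0 \<le> y" "x \<noteq> 0 \<or> y \<noteq> 0" "proj (snd d) + of_real r * u = proj (x *\<^sub>R snd d + y *\<^sub>R e)"
      "y = 0 \<Longrightarrow> proj (snd d) + of_real r * u = proj (snd d)"
      using proj_segment[OF v e'(1)] by metis
    show ?thesis
    proof (cases "y = 0")
      case True
      then have "u = 0" using xy(5) r by simp
      then have "proj (snd d) = proj e" by (simp add: u_def)
      then show ?thesis using off[of 0] \<open>u = 0\<close> by simp
    next
      case False
      define s where "s = x / (x + y)"
      have s: "0 \<le> s" "s < 1" using xy False by (auto simp: s_def)
      have y: "1 - s = y / (x + y)" using xy False by (simp add: s_def field_simps)
      have "(x + y) *\<^sub>R ((1 - s) *\<^sub>R e + s *\<^sub>R snd d) = x *\<^sub>R snd d + y *\<^sub>R e"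
        unfolding y using xy False by (simp add: s_def scaleR_add_right)
      then have "proj (x *\<^sub>R snd d + y *\<^sub>R e) = proj ((1 - s) *\<^sub>R e + s *\<^sub>R snd d)"
        using proj_scale[of "x + y"] xy False by (metis add_nonneg_eq_0_iff)
      then show ?thesis using off[OF s] xy(4) by simp
    qed
  qed
  have "Im ((proj (snd ?b) - proj (snd d)) / (proj (snd d) - proj e)) < 0"
    using turn_sign(2)[OF oarcs_valid[OF d] e'(1) e(2,3) v nth_octant] right by blast
  then have "Im ((proj (snd ?b) - proj (snd d)) * cnj (- u)) < 0"
    unfolding Im_complex_div_lt_0 by (simp add: u_def)
  then have side: "Im (u * cnj (proj (snd ?b) - proj (snd d))) < 0" by (simp add: algebra_simps)
  have ne: "turn ?a ?b \<noteq> 0" by (rule turn_nonzero[OF nth_oarcs nth_oarcs nth_hits])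
  have on: "turn ?a ?b < 0 \<and> proj (snd d) = vertex ys (Suc i)" if on: "proj (snd d) \<in> path_of ys"
  proof -
    have h: "proj (snd d) \<in> half_edge (vertex ys) (Suc i)" using on_path[OF hit v on] .
    then obtain t where t: "0 \<le> t" "t \<le> 1" "proj (snd d) = (1 - t) *\<^sub>R vertex ys (Suc i) + t *\<^sub>R vertex ys (Suc (Suc i))"
      by (auto simp: half_edge_def in_segment)
    have t1: "t \<noteq> 1" using h t by (auto simp: half_edge_def)
    have diff: "proj (snd ?b) - proj (snd d) = of_real (1 - t) * (vertex ys (Suc (Suc i)) - vertex ys (Suc i))"
      unfolding t(3) vertex_eq[symmetric] by (simp add: scaleR_conv_of_real algebra_simps)
    have "(1 - t) * Im (u * cnj (vertex ys (Suc (Suc i)) - vertex ys (Suc i))) < 0"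
      using side unfolding diff by (simp add: algebra_simps)
    then have "Im (u * cnj (vertex ys (Suc (Suc i)) - vertex ys (Suc i))) < 0"
      using t t1 by (simp add: mult_less_0_iff)
    then have neg: "Im (u / (vertex ys (Suc (Suc i)) - vertex ys (Suc i))) < 0"
      unfolding Im_complex_div_lt_0 .
    have u: "proj (snd d) + u = proj e" by (simp add: u_def)
    \<comment> \<open>On the open edge a right turn means arrival from the right, where the angle is
      \<open>level - 2 * pi = 0\<close>.\<close>
    have vtx: "proj (snd d) = vertex ys (Suc i)"
    proof (rule ccontr)
      assume "proj (snd d) \<noteq> vertex ys (Suc i)"
      then have "proj (snd d) \<in> open_segment (vertex ys (Suc i)) (vertex ys (Suc (Suc i)))"
        using h by (auto simp: half_edge_def open_segment_def)
      then have "winding (vertex ys) n (proj (snd d) + u) = level - 2 * pi"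
        using offu neg by (intro winding_right_of_edge) (auto simp: path_of_def)
      then show False using e'(2) level u by (simp add: wind_def)
    qed
    \<comment> \<open>At a left corner the angle vanishes in the whole half-plane to the right of
      the outgoing edge, near the corner.\<close>
    moreover have "turn ?a ?b < 0"
    proof (rule ccontr)
      assume "\<not> ?thesis"
      then have "turn ?a ?b > 0" using ne by simp
      then have "winding (vertex ys) n (vertex ys (Suc i) + u) = level - 2 * pi"
        using offu neg vtx corner_sign(1)[of i] by (intro winding_at_left_corner) (auto simp: path_of_def)
      then show False using e'(2) level u vtx by (simp add: wind_def)
    qed
    ultimately show ?thesis by blast
  qed
  then show "proj (snd d) \<in> path_of ys \<Longrightarrow> proj (snd d) = vertex ys (Suc i)" by blast
  show "turn ?a ?b < 0"
  proof (cases "proj (snd d) \<in> path_of ys")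
    case True
    then show ?thesis using on by blast
  next
    case False
    have we: "wind ys (proj e) = wind ys (proj (snd d))"
      by (rule wind_constant[OF e'(1) v]) (use off False in \<open>metis add_0 diff_self le_less scaleR_one scaleR_zero_left\<close>)
    \<comment> \<open>The hit lies on \<open>?b\<close> before the head of \<open>?a\<close>: from
      that head on, \<open>?b\<close> runs along the polygon.\<close>
    have tail: "\<delta> * a < \<gamma> * b"
    proof (rule ccontr)
      assume "\<not> ?thesis"
      then have "\<delta> - \<gamma> / a * b \<ge> 0" using ab by (simp add: field_simps)
      moreover have dv: "snd d = (\<gamma> / a) *\<^sub>R snd ?a + (\<delta> - \<gamma> / a * b) *\<^sub>R snd ?b"
        unfolding gd(3) ab(3) using ab by (simp add: algebra_simps)
      moreover have "0 < \<gamma> / a" using gd ab by simp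
      ultimately have "proj (snd d) \<in> closed_segment (proj (snd ?a)) (proj (snd ?b))"
      proof -
        let ?al = "\<gamma> / a" and ?be = "\<delta> - \<gamma> / a * b"
        have z: "Z \<bullet> snd ?a > 0" "Z \<bullet> snd ?b > 0" using nth_octant by (auto simp: octant_def)
        have den: "?al * (Z \<bullet> snd ?a) + ?be * (Z \<bullet> snd ?b) > 0"
          using z \<open>0 < ?al\<close> \<open>?be \<ge> 0\<close> by (intro add_pos_nonneg mult_pos_pos mult_nonneg_nonneg) auto
        show ?thesis unfolding in_segment
          using proj_combination[OF nth_octant[of "Suc i"] nth_octant[of "Suc (Suc i)"], of ?al ?be]
            \<open>0 < ?al\<close> \<open>?be \<ge> 0\<close> dv den z gd(1) ab(1)
          by (intro exI[of _ "?be * (Z \<bullet> snd ?b) / (?al * (Z \<bullet> snd ?a) + ?be * (Z \<bullet> snd ?b))"])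
             (auto simp: divide_le_eq_1 add_pos_nonneg)
      qed
      moreover have "closed_segment (vertex ys (Suc i mod n)) (vertex ys (Suc (Suc i mod n))) \<subseteq> path_of ys"
        unfolding path_of_def polygon_path_def using n_pos by (intro UN_upper) auto
      moreover have "vertex ys (Suc i mod n) = proj (snd ?a)" "vertex ys (Suc (Suc i mod n)) = proj (snd ?b)"
        by (auto simp: vertex_eq mod_Suc_eq)
      ultimately show False using False by auto
    qed
    define g1 g2 where "g1 = \<delta> / b" and "g2 = \<gamma> - \<delta> * a / b"
    have g: "0 < g1" "0 < g2" using tail gd ab by (auto simp: g1_def g2_def field_simps)
    have dv: "snd d = g1 *\<^sub>R snd ?a + g2 *\<^sub>R fst ?b"
      unfolding gd(3) ab(3) g1_def g2_def using ab by (simp add: algebra_simps)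
    obtain s where s: "0 < s" "s < 1" "(1 - s) *\<^sub>R snd ?a + s *\<^sub>R fst ?b \<in> octant"
      using short_tail[of "Suc i"] by metis
    define x where "x = (1 - s) *\<^sub>R snd ?a + s *\<^sub>R fst ?b"
    have x: "x \<in> octant" using s by (simp add: x_def)
    have "wind ys (proj x) = wind ys (proj (snd d))"
    proof (rule wind_constant[OF x v])
      fix r :: real assume r: "0 \<le> r" "r \<le> 1"
      have eq: "(1 - r) *\<^sub>R x + r *\<^sub>R snd d
          = ((1 - r) * (1 - s) + r * g1) *\<^sub>R snd ?a + ((1 - r) * s + r * g2) *\<^sub>R fst ?b"
        unfolding x_def by (subst (1) dv) (simp add: algebra_simps)
      have "(1 - r) * (1 - s) + r * g1 > 0" "(1 - r) * s + r * g2 > 0"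
        using r s g by (cases "r = 0"; force intro: add_nonneg_pos)+
      moreover have "(1 - r) *\<^sub>R x + r *\<^sub>R snd d \<in> octant" using octant_add[OF x v] r by force
      ultimately show "proj ((1 - r) *\<^sub>R x + r *\<^sub>R snd d) \<notin> path_of ys"
        using tail_off_path[OF _ _ eq] by blast
    qed
    then have "wind ys (proj x) \<noteq> 0" using we e' by simp
    then show ?thesis using tail_wind(1)[OF s(1,2) x_def x] level ne by fastforce
  qed
qed

end

lemma pairs_to_successively:
  "ds \<noteq> [] \<Longrightarrow> (\<forall>(a, b) \<in> set (pairs_to ds c). R a b) \<longleftrightarrow> successively R ds \<and> R (last ds) c"
  by (induction ds c rule: pairs_to.induct) auto

lemma last_pairs_to: "ys \<noteq> [] \<Longrightarrow> (last ys, c) \<in> set (pairs_to ys c)"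
  by (induction ys c rule: pairs_to.induct) auto

lemma pairs_to_snoc: "pairs_to (as @ [b]) c = pairs_to as b @ [(b, c)]"
  using pairs_to_append[of "[b]" as c] by simp

lemma pairs_to_fst: "y \<in> set ys \<Longrightarrow> \<exists>b. (y, b) \<in> set (pairs_to ys c)"
  by (induction ys c rule: pairs_to.induct) auto

lemma pairs_to_subset: "(a, b) \<in> set (pairs_to ys c) \<Longrightarrow> a \<in> set ys \<and> (b \<in> set ys \<or> b = c)"
  by (induction ys c rule: pairs_to.induct) auto

context chart
begin

definition right_turns :: "arc list \<Rightarrow> nat" where
  "right_turns zs = length (filter (\<lambda>(a, b). turn a b < 0) (pairs_to zs (hd zs)))"

text \<open>By \<open>level_from_crest\<close> this puts the inside on the left, which makes the
  right turns the wrong ones.\<close>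

definition crest_left :: "arc list \<Rightarrow> bool" where
  "crest_left zs \<longleftrightarrow> (\<exists>(a, b) \<in> set (pairs_to zs (hd zs)). height (snd a) = crest zs \<and> turn a b > 0)"

text \<open>The blocking arc can be followed in either direction, and exactly one of them is a left
  turn.\<close>

lemma oarcs_next:
  assumes d: "d \<in> oarcs"
  obtains c where "c \<in> oarcs" "snd d \<in> arc_relint c" "turn d c > 0"
proof -
  obtain c where c: "c \<in> D" "snd d \<in> arc_relint c" using oarcs_blocked d by blast
  then have co: "c \<in> oarcs" by (simp add: oarcs_def)
  show ?thesis
  proof (cases "turn d c > 0")
    case True
    then show ?thesis using that c co by blast
  next
    case False
    then have "turn d c < 0" using turn_nonzero[OF d co c(2)] by simp
    then have "turn d (prod.swap c) > 0" using turn_swap(2)[OF d co c(2)] by simp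
    then show ?thesis using that[of "prod.swap c"] oarcs_swap[OF co] c(2) by simp
  qed
qed

lemma height_combination:
  assumes "v \<in> octant" "w \<in> octant" "0 < \<alpha>" "0 < \<beta>" "height v < m" "height w \<le> m"
  shows "height (\<alpha> *\<^sub>R v + \<beta> *\<^sub>R w) < m"
proof -
  define t where "t = \<beta> * (Z \<bullet> w) / (\<alpha> * (Z \<bullet> v) + \<beta> * (Z \<bullet> w))"
  have z: "Z \<bullet> v > 0" "Z \<bullet> w > 0" using assms by (auto simp: octant_def)
  have t: "0 < t" "t < 1" using z assms by (auto simp: t_def field_simps add_pos_pos)
  have "height (\<alpha> *\<^sub>R v + \<beta> *\<^sub>R w) = (1 - t) * height v + t * height w"
  proof -
    have eq: "proj (\<alpha> *\<^sub>R v + \<beta> *\<^sub>R w) = (1 - t) *\<^sub>R proj v + t *\<^sub>R proj w"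
      unfolding t_def using proj_combination[OF assms(1,2), of \<alpha> \<beta>] assms(3,4) by simp
    show ?thesis unfolding height_def eq by (simp add: algebra_simps)
  qed
  moreover have "(1 - t) * height v < (1 - t) * m" "t * height w \<le> t * m" using t assms by auto
  moreover have "(1 - t) * m + t * m = m" by (simp add: algebra_simps)
  ultimately show ?thesis by linarith
qed

end

section \<open>The left-turning walk that starts at a wrong turn\<close>

context ring_in_chart
begin

definition left_step :: "arc \<Rightarrow> arc \<Rightarrow> bool" where
  "left_step a b \<longleftrightarrow> snd a \<in> arc_relint b \<and> turn a b > 0 \<and> inside (snd a)"

text \<open>The witness \<open>e\<close> is a point on the great circle of \<open>d\<close> before
  its head from which the rest of the way stays off the polygon. This is the form in which
  \<open>inside_arrival\<close> needs to know that \<open>d\<close> comes from the inside.\<close>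

definition arrives :: "arc \<Rightarrow> bool" where
  "arrives d \<longleftrightarrow> snd d \<in> octant \<and> (proj (snd d) \<notin> path_of ys \<longrightarrow> inside (snd d))
     \<and> (\<exists>e \<alpha> \<beta>. inside e \<and> 0 < \<alpha> \<and> e = \<alpha> *\<^sub>R fst d + \<beta> *\<^sub>R snd d
           \<and> (\<forall>s. 0 \<le> s \<and> s < 1 \<longrightarrow> proj ((1 - s) *\<^sub>R e + s *\<^sub>R snd d) \<notin> path_of ys))"

text \<open>At the wrong turn from \<open>last ys\<close> to \<open>hd ys\<close> the walk takes
  \<open>hd ys\<close> in the opposite direction. This first arc is the only one shared with the
  ring.\<close>

definition left_path :: "arc list \<Rightarrow> bool" where
  "left_path ds \<longleftrightarrow> ds \<noteq> [] \<and> hd ds = prod.swap (hd ys) \<and> set ds \<subseteq> oarcs \<and> distinct (map endpoints ds)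
     \<and> (\<forall>d \<in> set (tl ds). endpoints d \<notin> endpoints ` set ys)
     \<and> successively left_step ds \<and> (\<forall>d \<in> set ds. arrives d)"

lemma pair_index:
  assumes "(a, b) \<in> set (pairs_to ys (hd ys))"
  obtains i where "a = ys ! (Suc i mod n)" "b = ys ! (Suc (Suc i) mod n)"
proof -
  obtain j where j: "j < n" "a = ys ! j" "b = ys ! (Suc j mod n)" using assms unfolding set_pairs_to_cyclic by blast
  \<comment> \<open>The statements on corners are indexed by the preceding vertex; adding
    \<open>n\<close> provides a predecessor for \<open>j = 0\<close>.\<close>
  have "Suc (j + n - 1) = j + n" using n_pos by simp
  then have "Suc (j + n - 1) mod n = j" "Suc (Suc (j + n - 1)) mod n = Suc j mod n"
    using j(1) by (auto simp: mod_Suc_eq[of "j + n", symmetric])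
  then show ?thesis using that j by metis
qed

lemma arrivesI:
  assumes d: "d \<in> oarcs" and e: "inside e" "0 < \<alpha>" "e = \<alpha> *\<^sub>R fst d + \<beta> *\<^sub>R snd d"
    and off: "\<And>s. 0 \<le> s \<Longrightarrow> s < 1 \<Longrightarrow> (1 - s) *\<^sub>R e + s *\<^sub>R snd d \<in> octant \<Longrightarrow>
       proj ((1 - s) *\<^sub>R e + s *\<^sub>R snd d) \<notin> path_of ys"
  shows "arrives d"
proof -
  have eq: "(1 - s) *\<^sub>R e + s *\<^sub>R snd d = ((1 - s) * \<alpha>) *\<^sub>R fst d + ((1 - s) * \<beta> + s) *\<^sub>R snd d" for s
    unfolding e(3) by (simp add: algebra_simps)
  have nz: "(1 - s) *\<^sub>R e + s *\<^sub>R snd d \<noteq> 0" for s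
  proof
    assume "(1 - s) *\<^sub>R e + s *\<^sub>R snd d = 0"
    then have "(1 - s) * \<alpha> = 0" "(1 - s) * \<beta> + s = 0"
      using valid_arc_independent[OF oarcs_valid[OF d]] unfolding eq by metis+
    then show False using e(2) by auto
  qed
  note tr = trapped[OF e(1) nz off]
  have o: "snd d \<in> octant" by (rule tr(1))
  have "e \<in> octant" using e(1) by (simp add: inside_def)
  then have "proj ((1 - s) *\<^sub>R e + s *\<^sub>R snd d) \<notin> path_of ys" if "0 \<le> s" "s < 1" for s
    using off octant_add[OF _ o, of e "1 - s" s] that by auto
  then show ?thesis unfolding arrives_def using o tr(2) e by blast
qed

text \<open>At a right turn the tail of the blocking arc lies on the left, hence inside, and it does
  not meet the polygon; so the first arc arrives.\<close>

lemma left_path_start: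
  assumes level: "level = 2 * pi" and right: "turn (last ys) (hd ys) < 0"
  shows "left_path [prod.swap (hd ys)]"
proof -
  have "ys \<noteq> []" using n_pos by auto
  then obtain i where i: "last ys = ys ! (Suc i mod n)" "hd ys = ys ! (Suc (Suc i) mod n)"
    using pair_index last_pairs_to by metis
  let ?a = "last ys" and ?b = "hd ys"
  obtain a b where ab: "0 < a" "0 < b" "snd ?a = a *\<^sub>R fst ?b + b *\<^sub>R snd ?b" using hit_coeffs[of "Suc i"] i by metis
  obtain s where s: "0 < s" "s < 1" "(1 - s) *\<^sub>R snd ?a + s *\<^sub>R fst ?b \<in> octant"
    using short_tail[of "Suc i"] i by metis
  define e where "e = (1 - s) *\<^sub>R snd ?a + s *\<^sub>R fst ?b"
  have e: "e \<in> octant" using s by (simp add: e_def)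
  have "wind ys (proj e) = 2 * pi"
    using tail_wind(2)[OF s(1,2) _ e] right level i by (simp add: e_def)
  moreover have "proj e \<notin> path_of ys" using tail_off_path[OF _ s(1) _ e] s i by (simp add: e_def)
  ultimately have ins: "inside e" using e by (simp add: inside_def)
  have "arrives (prod.swap ?b)"
  proof (rule arrivesI[OF _ ins])
    show "prod.swap ?b \<in> oarcs" using i nth_oarcs oarcs_swap by metis
    show "0 < (1 - s) * b" using s ab by simp
    show "e = ((1 - s) * b) *\<^sub>R fst (prod.swap ?b) + ((1 - s) * a + s) *\<^sub>R snd (prod.swap ?b)"
      unfolding e_def ab(3) by (simp add: algebra_simps)
    fix r :: real assume r: "0 \<le> r" "r < 1" "(1 - r) *\<^sub>R e + r *\<^sub>R snd (prod.swap ?b) \<in> octant"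
    have eq: "(1 - r) *\<^sub>R e + r *\<^sub>R snd (prod.swap ?b) = ((1 - r) * (1 - s)) *\<^sub>R snd (ys ! (Suc i mod n)) + ((1 - r) * s + r) *\<^sub>R fst (ys ! (Suc (Suc i) mod n))"
      unfolding e_def i[symmetric] by (simp add: algebra_simps)
    have "0 < (1 - r) * (1 - s)" "0 < (1 - r) * s + r" using r s by (auto intro: add_pos_nonneg)
    then show "proj ((1 - r) *\<^sub>R e + r *\<^sub>R snd (prod.swap ?b)) \<notin> path_of ys"
      using tail_off_path[OF _ _ eq r(3)] by blast
  qed
  moreover have "prod.swap ?b \<in> oarcs" using i nth_oarcs oarcs_swap by metis
  ultimately show ?thesis by (simp add: left_path_def)
qed

text \<open>An arc outside the ring does not meet the polygon within the octant, so it is trapped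
  inside from the point where the walk enters it up to its head.\<close>

lemma left_path_extend:
  assumes ds: "left_path ds" and c: "c \<in> oarcs" "snd (last ds) \<in> arc_relint c" "turn (last ds) c > 0"
    and new: "endpoints c \<notin> endpoints ` set ys" "endpoints c \<notin> endpoints ` set ds"
  shows "left_path (ds @ [c])"
proof -
  have nonempty: "ds \<noteq> []" and "arrives (last ds)" using ds by (auto simp: left_path_def)
  then have o: "snd (last ds) \<in> octant" and ins: "proj (snd (last ds)) \<notin> path_of ys \<Longrightarrow> inside (snd (last ds))"
    by (auto simp: arrives_def)
  have ins: "inside (snd (last ds))" using ins off_path[OF c(1) new(1) c(2) o] by blast
  obtain \<alpha> \<beta> where ab: "0 < \<alpha>" "0 < \<beta>" "snd (last ds) = \<alpha> *\<^sub>R fst c + \<beta> *\<^sub>R snd c"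
    using arc_relintE[OF oarcs_valid[OF c(1)] c(2)] by metis
  have "arrives c"
  proof (rule arrivesI[OF c(1) ins ab(1,3)])
    fix s :: real
    assume s: "0 \<le> s" "s < 1" and oc: "(1 - s) *\<^sub>R snd (last ds) + s *\<^sub>R snd c \<in> octant"
    let ?x = "(1 - s) *\<^sub>R snd (last ds) + s *\<^sub>R snd c"
    have x: "?x = ((1 - s) * \<alpha>) *\<^sub>R fst c + ((1 - s) * \<beta> + s) *\<^sub>R snd c" unfolding ab(3) by (simp add: algebra_simps)
    have "0 < (1 - s) * \<alpha>" "0 < (1 - s) * \<beta> + s" using s ab by (auto intro: add_pos_nonneg)
    then have "?x /\<^sub>R norm ?x \<in> arc_relint c" using arc_relintI(1)[OF oarcs_valid[OF c(1)] _ _ x] by blast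
    moreover have "norm ?x > 0" using octant_nonzero[OF oc] by simp
    then have "?x /\<^sub>R norm ?x \<in> octant" "proj (?x /\<^sub>R norm ?x) = proj ?x"
      using oc octant_nonzero[OF oc] by (auto intro: octant_scale proj_scale)
    ultimately show "proj ?x \<notin> path_of ys" using off_path[OF c(1) new(1)] by metis
  qed
  then show ?thesis
    using ds c new ins nonempty unfolding left_path_def
    by (auto simp: successively_append_iff left_step_def)
qed

text \<open>The arcs of a walk are distinct, so some walk is longest; the arc it would turn into
  cannot be new.\<close>

lemma left_path_stuck:
  assumes "left_path [prod.swap (hd ys)]"
  obtains ds c where "left_path ds" "c \<in> oarcs" "snd (last ds) \<in> arc_relint c" "turn (last ds) c > 0"
    "endpoints c \<in> endpoints ` set ys \<or> endpoints c \<in> endpoints ` set ds"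
proof -
  have "length ds \<le> card oarcs" if "left_path ds" for ds
  proof -
    have "distinct (map endpoints ds)" "set ds \<subseteq> oarcs" using that by (auto simp: left_path_def)
    then show ?thesis using finite_oarcs by (metis distinct_card distinct_map card_mono)
  qed
  then obtain ds where ds: "left_path ds" "\<And>es. left_path es \<Longrightarrow> length es \<le> length ds"
    using ex_has_greatest_nat[of left_path "[prod.swap (hd ys)]" length "Suc (card oarcs)"] assms by (metis le_imp_less_Suc)
  then have "last ds \<in> oarcs" by (auto simp: left_path_def)
  then obtain c where c: "c \<in> oarcs" "snd (last ds) \<in> arc_relint c" "turn (last ds) c > 0"
    using oarcs_next by metis
  then have "endpoints c \<in> endpoints ` set ys \<or> endpoints c \<in> endpoints ` set ds"
    using left_path_extend[OF ds(1) c] ds(2)[of "ds @ [c]"] by auto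
  then show ?thesis using that ds(1) c by blast
qed

lemma ring_height: "y \<in> set ys \<Longrightarrow> height (snd y) \<le> crest ys"
  unfolding crest_def by (rule Max_ge) auto

text \<open>If the walk runs into itself, the closed part is a ring whose vertices are interior
  points of the old region, or a point of its first arc that is still strictly below the
  crest.\<close>

lemma left_path_loop:
  assumes ds: "left_path ds" and c: "c \<in> oarcs" "snd (last ds) \<in> arc_relint c"
    and loop: "endpoints c \<in> endpoints ` set ds"
  shows "\<exists>zs. ring zs \<and> crest zs < crest ys"
proof -
  have p: "ds \<noteq> []" "hd ds = prod.swap (hd ys)" "set ds \<subseteq> oarcs" "distinct (map endpoints ds)"
    "\<And>d. d \<in> set (tl ds) \<Longrightarrow> endpoints d \<notin> endpoints ` set ys"
    "successively left_step ds" "\<And>d. d \<in> set ds \<Longrightarrow> arrives d" using ds by (auto simp: left_path_def)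
  obtain d where d: "d \<in> set ds" "endpoints c = endpoints d" using loop by auto
  then obtain As Bs where split: "ds = As @ d # Bs" by (metis split_list)
  define zs where "zs = d # Bs"
  have lastz: "last zs = last ds" by (simp add: zs_def split)
  have suc: "successively left_step zs" using p(6) unfolding split zs_def by (simp add: successively_append_iff)
  have hitd: "snd (last zs) \<in> arc_relint d" using c(2) d(2) arc_relint_endpoints lastz by metis
  have hits: "\<forall>(a, b) \<in> set (pairs_to zs (hd zs)). snd a \<in> arc_relint b"
    using pairs_to_successively[of zs "hd zs" "\<lambda>a b. snd a \<in> arc_relint b"] suc hitd
      successively_mono[of left_step zs "\<lambda>a b. snd a \<in> arc_relint b"]
    by (auto simp: zs_def left_step_def)
  have sub: "set zs \<subseteq> set ds" by (auto simp: zs_def split)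
  have oct: "snd y \<in> octant" if "y \<in> set ds" for y using p(7)[OF that] by (simp add: arrives_def)
  have ring_zs: "ring zs"
    unfolding ring_def using hits p(3,4) sub oct by (auto simp: zs_def split)
  have ins: "inside (snd y)" if "y \<in> set (butlast ds)" for y
  proof -
    have "successively left_step (butlast ds @ [last ds])" using p(1,6) by simp
    then have "\<forall>(a, b) \<in> set (pairs_to (butlast ds) (last ds)). left_step a b" if "butlast ds \<noteq> []"
      using that pairs_to_successively[OF that, of "last ds" left_step] by (simp add: successively_append_iff)
    then show ?thesis using that pairs_to_fst[OF that] by (fastforce simp: left_step_def)
  qed
  have lo: "snd (last ds) \<in> octant" using oct p(1) by simp
  have last_height: "height (snd (last ds)) < crest ys"
  proof (cases "endpoints d \<in> endpoints ` set ys")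
    case False
    then have "proj (snd (last ds)) \<notin> path_of ys" using off_path[OF c(1) _ c(2) lo] d by simp
    then have "inside (snd (last ds))" using p(1) p(7)[of "last ds"] by (simp add: arrives_def)
    then show ?thesis by (rule inside_height)
  next
    \<comment> \<open>The walk closes up at its first arc, where the hit may lie on the polygon. The
      hit is strictly between \<open>fst d\<close>, a vertex of the ring, and \<open>snd d\<close>,
      which is inside and so strictly below the crest.\<close>
    case True
    then have "d = hd ds" using p(5)[of d] d(1) by (metis list.exhaust_sel p(1) set_ConsD)
    then have dd: "d = prod.swap (hd ys)" using p(2) by simp
    have "ds \<noteq> [d]"
    proof
      assume "ds = [d]"
      then have "snd d \<in> arc_relint d" using c(2) d(2) arc_relint_endpoints by (metis last.simps)
      moreover have "valid_arc d" using p(3) d(1) oarcs_valid by blast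
      ultimately show False using endpoint_notin_relint[of d "snd d"] by (auto simp: endpoints_def)
    qed
    then have "d \<in> set (butlast ds)" using \<open>d = hd ds\<close> p(1) by (cases ds) auto
    then have h1: "height (snd d) < crest ys" using ins inside_height by blast
    have y0: "hd ys \<in> set ys" using n_pos by auto
    then have h2: "height (fst d) \<le> crest ys" "fst d \<in> octant"
      using ring_height ring dd by (auto simp: ring_def)
    have "d \<in> oarcs" using d(1) p(3) by auto
    then obtain \<alpha> \<beta> where ab: "0 < \<alpha>" "0 < \<beta>" "snd (last ds) = \<alpha> *\<^sub>R fst d + \<beta> *\<^sub>R snd d"
      using arc_relintE[OF oarcs_valid] hitd lastz by metis
    then have "snd (last ds) = \<beta> *\<^sub>R snd d + \<alpha> *\<^sub>R fst d" by simp
    then show ?thesis using height_combination[OF oct[OF d(1)] h2(2) ab(2,1) h1 h2(1)] by simp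
  qed
  have "height (snd y) < crest ys" if "y \<in> set zs" for y
  proof (cases "y = last ds")
    case True
    then show ?thesis using last_height by simp
  next
    case False
    then have "y \<in> set (butlast ds)" using sub that p(1) by (metis append_butlast_last_id in_set_conv_decomp_last set_ConsD rotate1.simps(2) set_rotate1 subsetD)
    then show ?thesis using ins inside_height by blast
  qed
  then have "crest zs < crest ys" unfolding crest_def[of zs] by (subst Max_less_iff) (auto simp: zs_def)
  then show ?thesis using ring_zs by blast
qed

text \<open>The new ring follows the walk, then the old ring from \<open>b\<close> to its last arc,
  and closes with the reversed \<open>hd ys\<close>. The wrong turn at the end becomes a left turn,
  the walk has only left turns, and the junction with \<open>b\<close> is paid for by the old corner
  at \<open>b\<close>.\<close>

lemma left_path_merge:
  assumes ds: "left_path ds" and c: "c \<in> oarcs" "snd (last ds) \<in> arc_relint c"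
    and new: "endpoints c \<notin> endpoints ` set ds" and old: "endpoints c \<in> endpoints ` set ys"
    and level: "level = 2 * pi" and right: "turn (last ys) (hd ys) < 0"
  shows "\<exists>zs. ring zs \<and> (crest zs < crest ys \<or>
    crest zs = crest ys \<and> crest_left zs \<and> right_turns zs < right_turns ys)"
proof -
  have p: "ds \<noteq> []" "hd ds = prod.swap (hd ys)" "set ds \<subseteq> oarcs" "distinct (map endpoints ds)"
    "\<And>d. d \<in> set (tl ds) \<Longrightarrow> endpoints d \<notin> endpoints ` set ys"
    "successively left_step ds" "\<And>d. d \<in> set ds \<Longrightarrow> arrives d" using ds by (auto simp: left_path_def)
  have R: "set ys \<subseteq> oarcs" "distinct (map endpoints ys)" "\<And>y. y \<in> set ys \<Longrightarrow> snd y \<in> octant"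
    "\<And>a b. (a, b) \<in> set (pairs_to ys (hd ys)) \<Longrightarrow> snd a \<in> arc_relint b"
    using ring by (auto simp: ring_def)
  obtain b where b: "b \<in> set ys" "endpoints c = endpoints b" using old by auto
  then obtain As Bs where split: "ys = As @ b # Bs" by (metis split_list)
  \<comment> \<open>If the walk ran into \<open>hd ys\<close>, it would run into its own first arc,
    which is the other case.\<close>
  have "As \<noteq> []"
  proof
    assume "As = []"
    then have "hd ys = b" using split by simp
    then have "endpoints c = endpoints (hd ds)" using p(2) b by simp
    then show False using new p(1) by auto
  qed
  then obtain Fs a where As: "As = Fs @ [a]" by (metis rev_exhaust)
  have hdAs: "hd As = hd ys" using split \<open>As \<noteq> []\<close> by simp
  obtain Cs l where Cs: "b # Bs = Cs @ [l]" by (metis list.distinct(1) rev_exhaust)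
  have l: "l = last ys" using split Cs by simp
  obtain Es d where Es: "ds = Es @ [d]" using p(1) by (metis rev_exhaust)
  have d: "d = last ds" "d \<in> set ds" "d \<in> oarcs" using Es p(3) by auto
  define zs where "zs = ds @ b # Bs"
  have hdz: "hd zs = prod.swap (hd ys)" using p(1,2) by (simp add: zs_def)
  have pairs_ys: "pairs_to ys (hd ys) = pairs_to Fs a @ [(a, b)] @ pairs_to Cs l @ [(l, hd ys)]"
    unfolding split using pairs_to_append[of "b # Bs" As] by (simp only: As Cs pairs_to_snoc) (simp add: Cs[symmetric])
  have pairs_zs: "pairs_to zs (hd zs) = pairs_to Es d @ [(d, b)] @ pairs_to Cs l @ [(l, prod.swap (hd ys))]"
    unfolding hdz unfolding zs_def using pairs_to_append[of "b # Bs" ds] by (simp only: Es Cs pairs_to_snoc) (simp add: Cs[symmetric])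
  have hit: "snd d \<in> arc_relint b" using c(2) b(2) arc_relint_endpoints d by metis
  have steps: "left_step x y" if "(x, y) \<in> set (pairs_to Es d)" for x y
  proof -
    have "Es \<noteq> []" using that by auto
    moreover have "successively left_step (Es @ [d])" using p(6) Es by simp
    ultimately show ?thesis using pairs_to_successively[of Es d left_step] that by (auto simp: successively_append_iff)
  qed
  have lturn: "turn l (prod.swap (hd ys)) > 0"
  proof -
    have "(l, hd ys) \<in> set (pairs_to ys (hd ys))" using pairs_ys by simp
    then have "l \<in> oarcs" "hd ys \<in> oarcs" "snd l \<in> arc_relint (hd ys)" using R(1,4) n_pos l by auto
    then show ?thesis using turn_swap(2) right l by blast
  qed
  have in_ys: "set Cs \<subseteq> set ys" "l \<in> set ys" "b \<in> set ys" "set Bs \<subseteq> set ys"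
  proof -
    have "set ys = set As \<union> set (b # Bs)" "set (b # Bs) = set (Cs @ [l])" using split Cs by simp_all
    then show "set Cs \<subseteq> set ys" "l \<in> set ys" "b \<in> set ys" "set Bs \<subseteq> set ys" by auto
  qed
  have octd: "snd y \<in> octant" if "y \<in> set ds" for y using p(7)[OF that] by (simp add: arrives_def)
  have ring_zs: "ring zs"
    unfolding ring_def
  proof (intro conjI)
    show "zs \<noteq> []" by (simp add: zs_def)
    show "set zs \<subseteq> oarcs" using p(3) R(1) in_ys by (auto simp: zs_def)
    have "distinct (map endpoints (b # Bs))" using R(2) unfolding split by simp
    moreover have "endpoints ` set ds \<inter> endpoints ` set (b # Bs) = {}"
    proof -
      have "hd ys \<in> set As" using hdAs \<open>As \<noteq> []\<close> by (metis list.set_sel(1))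
      moreover have "endpoints ` set As \<inter> endpoints ` set (b # Bs) = {}"
        using R(2) unfolding split by auto
      ultimately have h: "endpoints (hd ds) \<notin> endpoints ` set (b # Bs)" using p(2) by auto
      have t: "endpoints x \<notin> endpoints ` set (b # Bs)" if "x \<in> set (tl ds)" for x
        using p(5)[OF that] split by auto
      have "endpoints x \<notin> endpoints ` set (b # Bs)" if "x \<in> set ds" for x
        using that h t p(1) by (metis list.exhaust_sel set_ConsD)
      then show ?thesis by (simp only: disjoint_iff ball_simps image_iff) blast
    qed
    ultimately show "distinct (map endpoints zs)" using p(4) by (auto simp: zs_def)
    show "\<forall>(x, y) \<in> set (pairs_to zs (hd zs)). snd x \<in> arc_relint y"
    proof -
      have "snd x \<in> arc_relint y" if z: "(x, y) \<in> set (pairs_to zs (hd zs))" for x y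
      proof -
        consider "(x, y) \<in> set (pairs_to Es d)" | "(x, y) = (d, b)" | "(x, y) \<in> set (pairs_to Cs l)" | "(x, y) = (l, prod.swap (hd ys))"
          using z unfolding pairs_zs by auto
        then show ?thesis
        proof cases
          case 1
          then show ?thesis using steps by (auto simp: left_step_def)
        next
          case 2
          then show ?thesis using hit by simp
        next
          case 3
          then show ?thesis using R(4)[of x y] pairs_ys by simp
        next
          case 4
          then show ?thesis using R(4)[of l "hd ys"] pairs_ys by simp
        qed
      qed
      then show ?thesis by blast
    qed
    show "\<forall>y\<in>set zs. snd y \<in> octant" using octd R(3) in_ys by (auto simp: zs_def)
  qed
  have "(a, b) \<in> set (pairs_to ys (hd ys))" using pairs_ys by simp
  then obtain i where i: "a = ys ! (Suc i mod n)" "b = ys ! (Suc (Suc i) mod n)" by (rule pair_index)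
  obtain e \<alpha> \<beta> where e: "inside e" "0 < \<alpha>" "e = \<alpha> *\<^sub>R fst d + \<beta> *\<^sub>R snd d"
    "\<And>s. 0 \<le> s \<Longrightarrow> s < 1 \<Longrightarrow> proj ((1 - s) *\<^sub>R e + s *\<^sub>R snd d) \<notin> path_of ys"
    using p(7)[OF d(2)] by (auto simp: arrives_def)
  have arrival1: "turn a b < 0" if "turn d b < 0"
    by (rule inside_arrival(1)[of d i e \<alpha> \<beta>, folded i, OF d(3) hit octd[OF d(2)] e(1-3) _ level that]) (rule e(4))
  have arrival2: "proj (snd d) = vertex ys (Suc i)" if "turn d b < 0" "proj (snd d) \<in> path_of ys"
    by (rule inside_arrival(2)[of d i e \<alpha> \<beta>, folded i, OF d(3) hit octd[OF d(2)] e(1-3) _ level that]) (rule e(4))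
  have heights: "height (snd y) \<le> crest ys" if yz: "y \<in> set zs" for y
  proof -
    consider "y \<in> set Es" | "y = d" | "y \<in> set ys" using yz in_ys by (auto simp: zs_def Es)
    then show ?thesis
    proof cases
      case 1
      then obtain z where "(y, z) \<in> set (pairs_to Es d)" using pairs_to_fst by metis
      then have "inside (snd y)" using steps by (simp add: left_step_def)
      then show ?thesis using inside_height by (simp add: less_imp_le)
    next
      case 2
      have "proj (snd d) \<in> path_of ys \<or> inside (snd d)" using p(7)[OF d(2)] by (auto simp: arrives_def)
      then show ?thesis using region_height[of "snd d"] 2 by (auto simp: inside_def)
    next
      case 3
      then show ?thesis by (rule ring_height)
    qed
  qed
  have "crest zs \<le> crest ys"
    unfolding crest_def[of zs] using heights by (subst Max_le_iff) (auto simp: zs_def)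
  moreover have "crest_left zs \<and> right_turns zs < right_turns ys" if eq: "crest zs = crest ys"
  proof
    have "crest zs \<in> (\<lambda>y. height (snd y)) ` set zs" unfolding crest_def by (rule Max_in) (auto simp: zs_def)
    then obtain y where y: "y \<in> set zs" "height (snd y) = crest ys" using eq by auto
    then obtain z where z: "(y, z) \<in> set (pairs_to zs (hd zs))" using pairs_to_fst by metis
    \<comment> \<open>A right turn at the crest would force \<open>level = 0\<close>.\<close>
    have no_right: False if "(x, x') \<in> set (pairs_to ys (hd ys))" "height (snd x) = crest ys" "turn x x' < 0" for x x'
      using pair_index[OF that(1)] level_from_crest(2) that(2,3) level by (metis pi_neq_zero mult_eq_0_iff zero_neq_numeral)
    have "turn y z > 0"
    proof -
      consider "(y, z) \<in> set (pairs_to Es d)" | "(y, z) = (d, b)" | "(y, z) \<in> set (pairs_to Cs l)" | "(y, z) = (l, prod.swap (hd ys))"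
        using z unfolding pairs_zs by auto
      then show ?thesis
      proof cases
        case 1
        then show ?thesis using steps by (auto simp: left_step_def)
      next
        case 2
        \<comment> \<open>A junction at crest height is not inside, so it lies on the polygon. With
          a right turn it would be the vertex of \<open>a\<close>, and the old ring would turn right
          at its crest.\<close>
        have nz: "turn d b \<noteq> 0" using turn_nonzero d(3) hit b(1) R(1) by blast
        have "\<not> turn d b < 0"
        proof
          assume neg: "turn d b < 0"
          have "\<not> inside (snd d)" using y(2) 2 inside_height[of "snd d"] by auto
          then have "proj (snd d) \<in> path_of ys" using p(7)[OF d(2)] by (auto simp: arrives_def)
          then have "proj (snd d) = proj (snd a)" using arrival2[OF neg] by (simp add: vertex_eq i(1))
          then have "height (snd a) = crest ys" using y(2) 2 by (simp add: height_def)
          then show False using no_right[of a b] arrival1[OF neg] pairs_ys by simp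
        qed
        then show ?thesis using nz 2 by auto
      next
        case 3
        then have pr: "(y, z) \<in> set (pairs_to ys (hd ys))" using pairs_ys by simp
        then have "y \<in> oarcs" "z \<in> oarcs" "snd y \<in> arc_relint z"
          using R(1,4) pairs_to_subset[OF pr] n_pos by auto
        then have "turn y z \<noteq> 0" by (rule turn_nonzero)
        then show ?thesis using no_right[OF pr y(2)] by (meson linorder_cases)
      next
        case 4
        then show ?thesis using lturn by simp
      qed
    qed
    then show "crest_left zs" unfolding crest_left_def using z y eq by auto
    have 0: "filter (\<lambda>(x, y). turn x y < 0) (pairs_to Es d) = []"
      unfolding filter_empty_conv using steps by (force simp: left_step_def)
    \<comment> \<open>The new corner \<open>(d, b)\<close> is wrong only if the discarded corner
      \<open>(a, b)\<close> was; the corner from \<open>l\<close> supplies the strict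
      decrease.\<close>
    have "(if turn d b < 0 then 1 else 0) \<le> (if turn a b < 0 then 1 else (0::nat))"
      using arrival1 by auto
    then show "right_turns zs < right_turns ys"
      unfolding right_turns_def pairs_zs pairs_ys using lturn right l 0 by (auto split: if_splits)
  qed
  ultimately show ?thesis using ring_zs by fastforce
qed

lemma ring_reduce:
  assumes "crest_left ys" and right: "turn (last ys) (hd ys) < 0"
  shows "\<exists>zs. ring zs \<and> (crest zs < crest ys \<or>
    crest zs = crest ys \<and> crest_left zs \<and> right_turns zs < right_turns ys)"
proof -
  obtain a b where "(a, b) \<in> set (pairs_to ys (hd ys))" "height (snd a) = crest ys" "turn a b > 0"
    using assms(1) by (auto simp: crest_left_def)
  then have level: "level = 2 * pi" using pair_index level_from_crest(1) by metis
  obtain ds c where ds: "left_path ds" "c \<in> oarcs" "snd (last ds) \<in> arc_relint c"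
    "endpoints c \<in> endpoints ` set ys \<or> endpoints c \<in> endpoints ` set ds"
    using left_path_stuck[OF left_path_start[OF level right]] by metis
  show ?thesis
  proof (cases "endpoints c \<in> endpoints ` set ds")
    case True
    then show ?thesis using left_path_loop[OF ds(1-3)] by blast
  next
    case False
    then show ?thesis using left_path_merge[OF ds(1-3) False _ level right] ds(4) by blast
  qed
qed

end

lemma pairs_to_rotate:
  assumes "As \<noteq> []" "Bs \<noteq> []"
  shows "pairs_to (As @ Bs) (hd (As @ Bs)) = pairs_to As (hd Bs) @ pairs_to Bs (hd As)"
    and "pairs_to (Bs @ As) (hd (Bs @ As)) = pairs_to Bs (hd As) @ pairs_to As (hd Bs)"
  using assms by (simp_all add: pairs_to_append)

section \<open>Minimal rings turn in one direction only\<close>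

context chart
begin

text \<open>The reduction treats a wrong turn at the seam between the last and the first arc. A
  rotation brings any corner there and preserves all quantities that are minimised.\<close>

lemma rotate_to_pair:
  assumes zs: "ring zs" and ab: "(a, b) \<in> set (pairs_to zs (hd zs))"
  obtains ws where "ring ws" "crest ws = crest zs" "crest_left ws = crest_left zs"
    "right_turns ws = right_turns zs" "last ws = a" "hd ws = b"
proof -
  have "zs \<noteq> []" using zs by (simp add: ring_def)
  obtain j where j: "j < length zs" "a = zs ! j" "b = zs ! (Suc j mod length zs)"
    using ab unfolding set_pairs_to_cyclic by blast
  show ?thesis
  proof (cases "Suc j < length zs")
    case False
    then have "Suc j = length zs" using j by simp
    then have "last zs = a" "hd zs = b"
      using j \<open>zs \<noteq> []\<close> by (simp_all add: last_conv_nth hd_conv_nth flip: \<open>Suc j = length zs\<close>)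
    then show ?thesis using that zs by blast
  next
    case True
    define As Bs where "As = take (Suc j) zs" and "Bs = drop (Suc j) zs"
    have ne: "As \<noteq> []" "Bs \<noteq> []" and split: "zs = As @ Bs" using True by (auto simp: As_def Bs_def)
    have "last (Bs @ As) = a" unfolding As_def using j by (simp add: take_Suc_conv_app_nth)
    moreover have "hd (Bs @ As) = b" unfolding Bs_def using j True by (simp add: hd_drop_conv_nth)
    ultimately have lh: "last (Bs @ As) = a" "hd (Bs @ As) = b" by blast+
    have sets: "set (pairs_to (Bs @ As) (hd (Bs @ As))) = set (pairs_to zs (hd zs))"
      unfolding split pairs_to_rotate[OF ne] by auto
    have crest: "crest (Bs @ As) = crest zs" unfolding crest_def split by (simp add: Un_commute)
    have "set (map endpoints As) \<inter> set (map endpoints Bs) = {}" "distinct (map endpoints As)" "distinct (map endpoints Bs)"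
      using zs unfolding ring_def split by (simp_all only: map_append distinct_append)
    then have "distinct (map endpoints (Bs @ As))" by (simp only: map_append distinct_append Int_commute simp_thms)
    moreover have eq: "set (Bs @ As) = set zs" and "Bs @ As \<noteq> []" using ne split by auto
    ultimately have "ring (Bs @ As)" using zs unfolding ring_def sets eq by blast
    have "crest_left (Bs @ As) = crest_left zs" unfolding crest_left_def sets crest ..
    moreover have "right_turns (Bs @ As) = right_turns zs"
      unfolding right_turns_def split pairs_to_rotate[OF ne] by simp
    ultimately show ?thesis using that[of "Bs @ As"] crest \<open>ring (Bs @ As)\<close> lh by simp
  qed
qed

lemma ring_pair_turn:
  assumes "ring zs" "(a, b) \<in> set (pairs_to zs (hd zs))"
  shows "turn a b \<noteq> 0"
proof -
  have "zs \<noteq> []" using assms(1) by (simp add: ring_def)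
  then have "a \<in> oarcs" "b \<in> oarcs" "snd a \<in> arc_relint b"
    using assms pairs_to_subset[OF assms(2)] unfolding ring_def by auto
  then show ?thesis by (rule turn_nonzero)
qed

lemma minimal_ring_left:
  assumes zs: "ring zs" "crest_left zs"
    and low: "\<And>ws. ring ws \<Longrightarrow> crest zs \<le> crest ws"
    and few: "\<And>ws. ring ws \<Longrightarrow> crest ws = crest zs \<Longrightarrow> crest_left ws \<Longrightarrow> right_turns zs \<le> right_turns ws"
    and ab: "(a, b) \<in> set (pairs_to zs (hd zs))"
  shows "turn a b > 0"
proof (rule ccontr)
  assume "\<not> ?thesis"
  then have neg: "turn a b < 0" using ring_pair_turn[OF zs(1) ab] by simp
  obtain ws where ws: "ring ws" "crest ws = crest zs" "crest_left ws = crest_left zs"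
    "right_turns ws = right_turns zs" "last ws = a" "hd ws = b"
    using rotate_to_pair[OF zs(1) ab] by metis
  interpret R: ring_in_chart D X Y Z ws by unfold_locales (rule ws(1))
  obtain vs where "ring vs" "crest vs < crest ws \<or> crest vs = crest ws \<and> crest_left vs \<and> right_turns vs < right_turns ws"
    using R.ring_reduce zs(2) ws neg by auto
  then show False using low[of vs] few[of vs] ws by force
qed

lemma crest_vertex:
  assumes "ring zs"
  obtains a b where "(a, b) \<in> set (pairs_to zs (hd zs))" "height (snd a) = crest zs"
proof -
  have "crest zs \<in> (\<lambda>y. height (snd y)) ` set zs"
    unfolding crest_def using assms by (intro Max_in) (auto simp: ring_def)
  then obtain y where y: "y \<in> set zs" "height (snd y) = crest zs" by auto
  then obtain b where "(y, b) \<in> set (pairs_to zs (hd zs))" using pairs_to_fst by metis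
  then show ?thesis using that y by blast
qed

text \<open>Exchanging two coordinates mirrors the chart, so it suffices to treat rings whose highest
  vertex is a left turn.\<close>

theorem ring_same_turns:
  assumes "ring ys"
  shows "\<exists>zs. ring zs \<and> ((\<forall>(a, b) \<in> set (pairs_to zs (hd zs)). det3 (fst a) (snd a) (snd b) > 0)
    \<or> (\<forall>(a, b) \<in> set (pairs_to zs (hd zs)). det3 (fst a) (snd a) (snd b) < 0))"
proof -
  interpret M: chart D Y X Z
    by unfold_locales (use basis det3_swap[of Y X Z] in simp)
  have octant: "M.octant = octant" by (auto simp: M.octant_def octant_def)
  have height: "M.height = height" by (auto simp: M.height_def height_def M.proj_def proj_def)
  have ring: "M.ring = ring" by (auto simp: M.ring_def ring_def octant fun_eq_iff)
  have crest: "M.crest = crest" by (auto simp: M.crest_def crest_def height fun_eq_iff)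
  have turn: "M.turn a b = - turn a b" for a b by (simp add: M.turn_def turn_def det3_swap[of Y X Z])
  have fin: "finite {zs. ring zs}"
  proof (rule finite_subset)
    show "finite {xs. set xs \<subseteq> oarcs \<and> length xs \<le> card oarcs}" using finite_oarcs by (rule finite_lists_length_le)
    show "{zs. ring zs} \<subseteq> {xs. set xs \<subseteq> oarcs \<and> length xs \<le> card oarcs}"
    proof
      fix zs assume "zs \<in> {zs. ring zs}"
      then have "set zs \<subseteq> oarcs" "distinct zs" by (auto simp: ring_def distinct_map)
      then show "zs \<in> {xs. set xs \<subseteq> oarcs \<and> length xs \<le> card oarcs}"
        using card_mono[OF finite_oarcs, of "set zs"] by (simp add: distinct_card)
    qed
  qed
  define m where "m = Min (crest ` {zs. ring zs})"
  have low: "m \<le> crest zs" if "ring zs" for zs unfolding m_def using fin that by auto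
  have "m \<in> crest ` {zs. ring zs}" unfolding m_def using fin assms by (intro Min_in) auto
  then obtain y0 where y0: "ring y0" "crest y0 = m" by auto
  \<comment> \<open>\<open>M.right_turns\<close> counts left turns. One least number over both
    charts serves whichever way the highest vertex turns.\<close>
  define Q where "Q k \<longleftrightarrow> (\<exists>zs. ring zs \<and> crest zs = m \<and>
    (crest_left zs \<and> right_turns zs = k \<or> M.crest_left zs \<and> M.right_turns zs = k))" for k
  obtain a b where ab: "(a, b) \<in> set (pairs_to y0 (hd y0))" "height (snd a) = crest y0"
    using crest_vertex[OF y0(1)] by metis
  have "turn a b > 0 \<or> M.turn a b > 0" using ring_pair_turn[OF y0(1) ab(1)] by (auto simp: turn)
  then have "crest_left y0 \<or> M.crest_left y0"
    using ab unfolding crest_left_def M.crest_left_def crest height by blast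
  then have "\<exists>k. Q k" unfolding Q_def using y0 by blast
  then have k: "Q (LEAST k. Q k)" by (metis LeastI)
  have least: "(LEAST k. Q k) \<le> k" if "Q k" for k using that by (rule Least_le)
  obtain zs where zs: "ring zs" "crest zs = m"
    "crest_left zs \<and> right_turns zs = (LEAST k. Q k) \<or> M.crest_left zs \<and> M.right_turns zs = (LEAST k. Q k)"
    using k unfolding Q_def by blast
  have "(\<forall>(a, b) \<in> set (pairs_to zs (hd zs)). turn a b > 0) \<or> (\<forall>(a, b) \<in> set (pairs_to zs (hd zs)). M.turn a b > 0)"
    using zs(3)
  proof
    assume c: "crest_left zs \<and> right_turns zs = (LEAST k. Q k)"
    have "turn a b > 0" if ab: "(a, b) \<in> set (pairs_to zs (hd zs))" for a b
    proof (rule minimal_ring_left[OF zs(1) _ _ _ ab])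
      show "crest zs \<le> crest ws" if "ring ws" for ws using low[OF that] zs(2) by simp
      show "right_turns zs \<le> right_turns ws" if "ring ws" "crest ws = crest zs" "crest_left ws" for ws
        using least[of "right_turns ws"] c that zs(2) unfolding Q_def by auto
    qed (use c in blast)
    then show ?thesis by blast
  next
    assume c: "M.crest_left zs \<and> M.right_turns zs = (LEAST k. Q k)"
    have "M.turn a b > 0" if ab: "(a, b) \<in> set (pairs_to zs (hd zs))" for a b
    proof (rule M.minimal_ring_left[OF _ _ _ _ ab])
      show "M.crest zs \<le> M.crest ws" if "M.ring ws" for ws using low[of ws] that zs(2) by (simp add: ring crest)
      show "M.right_turns zs \<le> M.right_turns ws" if "M.ring ws" "M.crest ws = M.crest zs" "M.crest_left ws" for ws
        using least[of "M.right_turns ws"] c that zs(2) unfolding Q_def by (auto simp: ring crest)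
    qed (use c zs(1) in \<open>auto simp: ring\<close>)
    then show ?thesis by blast
  qed
  \<comment> \<open>The common factor is the determinant of the chart or of its mirror image; its
    sign selects the orientation.\<close>
  then have "\<exists>e. \<forall>(a, b) \<in> set (pairs_to zs (hd zs)). e * det3 (fst a) (snd a) (snd b) > 0"
    unfolding turn_def M.turn_def by blast
  moreover have "(\<forall>(a, b) \<in> S. det3 (fst a) (snd a) (snd b) > 0) \<or> (\<forall>(a, b) \<in> S. det3 (fst a) (snd a) (snd b) < 0)"
    if "\<forall>(a, b) \<in> S. e * det3 (fst a) (snd a) (snd b) > 0" for S and e :: real
    using that by (cases "e > 0") (fastforce simp: zero_less_mult_iff)+
  ultimately show ?thesis using zs(1) by blast
qed

end

section \<open>Cycles heading for the poles\<close>

lemma coplanar_det3_zero: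
  assumes "n \<noteq> 0" "n \<bullet> a = 0" "n \<bullet> b = 0" "n \<bullet> c = 0"
  shows "det3 a b c = 0"
proof -
  have "det3 a b c * (n \<bullet> n) = n \<bullet> (det3 a b c *\<^sub>R n)" by simp
  also have "\<dots> = n \<bullet> (det3 n b c *\<^sub>R a + det3 a n c *\<^sub>R b + det3 a b n *\<^sub>R c)"
    by (subst det3_cramer) (rule refl)
  also have "\<dots> = 0" using assms by (simp add: inner_add_right)
  finally show ?thesis using assms(1) by simp
qed

lemma pairs_to_invariant:
  assumes "\<And>a b. (a, b) \<in> set (pairs_to ys c) \<Longrightarrow> Q a \<Longrightarrow> Q b" "ys \<noteq> []" "Q (hd ys)" "y \<in> set ys"
  shows "Q y"
  using assms
proof (induction ys c rule: pairs_to.induct)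
  case (3 a b r c)
  have "Q a" using 3(4) by simp
  moreover have "Q b" using 3(2)[of a b] \<open>Q a\<close> by simp
  moreover have "Q y" if "y \<in> set (b # r)"
    using 3(1) 3(2) \<open>Q b\<close> that by (metis list.sel(1) list.distinct(1) list.set_intros(2) pairs_to.simps(3))
  ultimately show ?case using 3(5) by auto
qed auto

lemma arc_pointsI:
  assumes "valid_arc a" "norm v = 1" "0 \<le> \<gamma>" "0 \<le> \<delta>" "v = \<gamma> *\<^sub>R fst a + \<delta> *\<^sub>R snd a"
  shows "v \<in> arc_points a"
proof -
  have s: "\<gamma> + \<delta> > 0"
  proof (rule ccontr)
    assume "\<not> ?thesis"
    then have "\<gamma> = 0" "\<delta> = 0" using assms by auto
    then show False using assms by simp
  qed
  define y where "y = v /\<^sub>R (\<gamma> + \<delta>)"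
  have "y = (1 - \<delta> / (\<gamma> + \<delta>)) *\<^sub>R fst a + (\<delta> / (\<gamma> + \<delta>)) *\<^sub>R snd a"
  proof -
    have "1 - \<delta> / (\<gamma> + \<delta>) = \<gamma> / (\<gamma> + \<delta>)" using s by (simp add: field_simps)
    then show ?thesis unfolding y_def assms(5) by (simp add: divide_inverse scaleR_add_right mult.commute)
  qed
  then have "y \<in> closed_segment (fst a) (snd a)"
    unfolding in_segment using assms s by (auto intro!: exI[of _ "\<delta> / (\<gamma> + \<delta>)"])
  moreover have "v = y /\<^sub>R norm y" using s assms(2) by (simp add: y_def)
  ultimately show ?thesis by (auto simp: arc_points_def)
qed

text \<open>The pole is a combination of the two ends. Neither it nor its antipode is on the arc, so
  the coefficients have opposite signs, and solving for the end with positive coefficient gives the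
  direction.\<close>

lemma orient_towards:
  assumes a: "valid_arc a" and n: "norm p = 1" and cop: "arc_normal a \<bullet> p = 0"
    and avoid: "p \<notin> arc_points a" "- p \<notin> arc_points a"
  shows "\<exists>b. endpoints b = endpoints a \<and> (\<exists>\<kappa> t. 0 < \<kappa> \<and> 0 < t \<and> \<kappa> *\<^sub>R snd b = fst b + t *\<^sub>R p)"
proof -
  obtain \<gamma> \<delta> where p: "p = \<gamma> *\<^sub>R fst a + \<delta> *\<^sub>R snd a"
    using coplanar_combination[OF a] cop by (auto simp: det3_def arc_normal_def)
  have "\<not> (0 \<le> \<gamma> \<and> 0 \<le> \<delta>)" using arc_pointsI[OF a n _ _ p] avoid by blast
  moreover have "\<not> (\<gamma> \<le> 0 \<and> \<delta> \<le> 0)"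
  proof -
    have "- p = (- \<gamma>) *\<^sub>R fst a + (- \<delta>) *\<^sub>R snd a" unfolding p by simp
    moreover have "norm (- p) = 1" using n by simp
    ultimately show ?thesis using arc_pointsI[OF a, of "-p" "-\<gamma>" "-\<delta>"] avoid(2) by fastforce
  qed
  ultimately consider "\<gamma> < 0" "0 < \<delta>" | "0 < \<gamma>" "\<delta> < 0" by linarith
  then show ?thesis
  proof cases
    case 1
    have "(\<delta> / - \<gamma>) *\<^sub>R snd a = fst a + (1 / - \<gamma>) *\<^sub>R p"
      unfolding p using 1 by (simp add: scaleR_add_right)
    moreover have "\<delta> / - \<gamma> > 0" "1 / - \<gamma> > 0" using 1 by (auto simp: divide_pos_neg)
    ultimately show ?thesis by blast
  next
    case 2
    have "(\<gamma> / - \<delta>) *\<^sub>R snd (prod.swap a) = fst (prod.swap a) + (1 / - \<delta>) *\<^sub>R p"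
      unfolding p using 2 by (simp add: scaleR_add_right)
    moreover have "\<gamma> / - \<delta> > 0" "1 / - \<delta> > 0" using 2 by (auto simp: divide_pos_neg)
    ultimately show ?thesis using endpoints_swap by blast
  qed
qed

text \<open>On the line \<open>h + s v\<close>, each vector excludes at most one value of
  \<open>s\<close>, apart from those orthogonal to \<open>v\<close>, for which \<open>h\<close>
  already works.\<close>

lemma not_orthogonal_to_finite:
  fixes V :: "'a::real_inner set"
  assumes "finite V" "\<And>v. v \<in> V \<Longrightarrow> v \<noteq> 0"
  shows "\<exists>h. \<forall>v \<in> V. h \<bullet> v \<noteq> 0"
  using assms
proof (induction V rule: finite_induct)
  case (insert v V)
  then obtain h where h: "\<forall>v \<in> V. h \<bullet> v \<noteq> 0" by auto
  define bad where "bad = insert (- (h \<bullet> v) / (v \<bullet> v)) ((\<lambda>w. - (h \<bullet> w) / (v \<bullet> w)) ` V)"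
  have "finite bad" using insert by (simp add: bad_def)
  then obtain s where s: "s \<notin> bad" using ex_new_if_finite infinite_UNIV_char_0 by blast
  have "(h + s *\<^sub>R v) \<bullet> w \<noteq> 0" if w: "w \<in> insert v V" for w
  proof
    assume 0: "(h + s *\<^sub>R v) \<bullet> w = 0"
    show False
    proof (cases "v \<bullet> w = 0")
      case True
      then have "h \<bullet> w = 0" using 0 by (simp add: inner_add_left)
      moreover have "w \<in> V" using w True insert.prems by auto
      ultimately show False using h by blast
    next
      case False
      then have "s = - (h \<bullet> w) / (v \<bullet> w)" using 0 by (simp add: inner_add_left field_simps)
      then show False using s w by (auto simp: bad_def)
    qed
  qed
  then show ?case by blast
qed simp

section \<open>Cycles of directed arcs\<close>

context spherical_diagram
begin

text \<open>Up to positive scaling, running along the arc adds a positive multiple of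
  \<open>G b\<close>.\<close>

definition directed :: "(arc \<Rightarrow> real^3) \<Rightarrow> arc \<Rightarrow> bool" where
  "directed G b \<longleftrightarrow> (\<exists>\<kappa> t. 0 < \<kappa> \<and> 0 < t \<and> \<kappa> *\<^sub>R snd b = fst b + t *\<^sub>R G b)"

definition cycle :: "arc list \<Rightarrow> bool" where
  "cycle ys \<longleftrightarrow> ys \<noteq> [] \<and> set ys \<subseteq> oarcs \<and> distinct (map endpoints ys)
     \<and> (\<forall>(a, b) \<in> set (pairs_to ys (hd ys)). snd a \<in> arc_relint b)"

lemma directed_step:
  assumes b: "b \<in> oarcs" "directed G b" and hit: "p \<in> arc_relint b"
  shows "\<exists>\<kappa> t. 0 < \<kappa> \<and> 0 < t \<and> \<kappa> *\<^sub>R snd b = p + t *\<^sub>R G b"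
proof -
  obtain k t where k: "0 < k" "0 < t" "k *\<^sub>R snd b = fst b + t *\<^sub>R G b" using b(2) by (auto simp: directed_def)
  obtain \<alpha> \<beta> where ab: "0 < \<alpha>" "0 < \<beta>" "p = \<alpha> *\<^sub>R fst b + \<beta> *\<^sub>R snd b"
    using arc_relintE[OF oarcs_valid[OF b(1)] hit] by metis
  have f: "fst b = k *\<^sub>R snd b - t *\<^sub>R G b" using k(3) by simp
  have "(\<alpha> * k + \<beta>) *\<^sub>R snd b = p + (\<alpha> * t) *\<^sub>R G b"
    unfolding ab(3) f by (simp add: algebra_simps)
  then show ?thesis using k ab by (intro exI[of _ "\<alpha> * k + \<beta>"] exI[of _ "\<alpha> * t"]) (auto intro: add_pos_pos)
qed

text \<open>A longest walk without repetition in the finite set \<open>S\<close> must run into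
  itself.\<close>

lemma cycle_exists:
  assumes S: "S \<subseteq> oarcs" "S \<noteq> {}" "inj_on endpoints S"
    and next_in: "\<And>b. b \<in> S \<Longrightarrow> \<exists>c \<in> S. snd b \<in> arc_relint c"
  shows "\<exists>ys. cycle ys \<and> set ys \<subseteq> S"
proof -
  define walk where "walk ds \<longleftrightarrow> ds \<noteq> [] \<and> set ds \<subseteq> S \<and> distinct ds \<and> successively (\<lambda>a b. snd a \<in> arc_relint b) ds" for ds
  have finS: "finite S" using S(1) finite_oarcs by (rule finite_subset)
  obtain b0 where "b0 \<in> S" using S by auto
  then have "walk [b0]" by (simp add: walk_def)
  moreover have "length ds \<le> card S" if "walk ds" for ds
    using that finS by (metis walk_def distinct_card card_mono)
  ultimately obtain ds where ds: "walk ds" "\<And>es. walk es \<Longrightarrow> length es \<le> length ds"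
    using ex_has_greatest_nat[of walk "[b0]" length "Suc (card S)"] by (metis le_imp_less_Suc)
  have p: "ds \<noteq> []" "set ds \<subseteq> S" "distinct ds" "successively (\<lambda>a b. snd a \<in> arc_relint b) ds"
    using ds(1) by (auto simp: walk_def)
  have "last ds \<in> S" using p by auto
  then obtain c where c: "c \<in> S" "snd (last ds) \<in> arc_relint c" using next_in by blast
  have "c \<in> set ds"
  proof (rule ccontr)
    assume "c \<notin> set ds"
    then have "walk (ds @ [c])" using p c by (auto simp: walk_def successively_append_iff)
    then show False using ds(2)[of "ds @ [c]"] by simp
  qed
  then obtain As Bs where split: "ds = As @ c # Bs" by (metis split_list)
  have "\<forall>(a, b) \<in> set (pairs_to (c # Bs) c). snd a \<in> arc_relint b"
    using pairs_to_successively[of "c # Bs" c "\<lambda>a b. snd a \<in> arc_relint b"] p(4) c(2)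
    by (simp add: split successively_append_iff)
  moreover have sub: "set (c # Bs) \<subseteq> S" using p(2) split by auto
  moreover have "distinct (map endpoints (c # Bs))"
    using p(3) sub S(3) unfolding split distinct_map by (metis distinct_append inj_on_subset)
  moreover have "set (c # Bs) \<subseteq> oarcs" using sub S(1) by (rule subset_trans)
  ultimately have "cycle (c # Bs)" unfolding cycle_def by (intro conjI) (simp_all only: list.sel, simp)
  then show ?thesis using sub by blast
qed

text \<open>The vector \<open>w\<close> is a combination of the passed headings with positive
  coefficients. This is expressed through linear forms \<open>h\<close>, which is how it is used:
  weak positivity on all headings, and strict positivity as soon as one heading is strictly
  positive.\<close>

lemma directed_path_sum:
  assumes "\<And>a b. (a, b) \<in> set (pairs_to as c) \<Longrightarrow> \<exists>\<kappa> t. 0 < \<kappa> \<and> 0 < t \<and> \<kappa> *\<^sub>R snd b = snd a + t *\<^sub>R G b"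
    and "as \<noteq> []"
  shows "\<exists>\<Lambda> w. 0 < \<Lambda> \<and> \<Lambda> *\<^sub>R snd c = snd (hd as) + w \<and>
    (\<forall>h. (\<forall>y \<in> set (tl as) \<union> {c}. h \<bullet> G y \<ge> 0) \<longrightarrow>
      h \<bullet> w \<ge> 0 \<and> ((\<exists>y \<in> set (tl as) \<union> {c}. h \<bullet> G y > 0) \<longrightarrow> h \<bullet> w > 0))"
  using assms
proof (induction as c rule: pairs_to.induct)
  case (2 a c)
  then obtain \<kappa> t where "0 < \<kappa>" "0 < t" "\<kappa> *\<^sub>R snd c = snd a + t *\<^sub>R G c" by auto
  then show ?case by (intro exI[of _ \<kappa>] exI[of _ "t *\<^sub>R G c"]) auto
next
  case (3 a b r c)
  obtain \<kappa> t where k: "0 < \<kappa>" "0 < t" "\<kappa> *\<^sub>R snd b = snd a + t *\<^sub>R G b" using 3(2)[of a b] by auto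
  obtain \<Lambda> w where w: "0 < \<Lambda>" "\<Lambda> *\<^sub>R snd c = snd b + w"
    "\<And>h. (\<forall>y \<in> set r \<union> {c}. h \<bullet> G y \<ge> 0) \<Longrightarrow>
      h \<bullet> w \<ge> 0 \<and> ((\<exists>y \<in> set r \<union> {c}. h \<bullet> G y > 0) \<longrightarrow> h \<bullet> w > 0)"
    using 3(1) 3(2) by (auto; metis)
  define v where "v = t *\<^sub>R G b + \<kappa> *\<^sub>R w"
  have "(\<kappa> * \<Lambda>) *\<^sub>R snd c = \<kappa> *\<^sub>R (snd b + w)" unfolding w(2)[symmetric] by simp
  also have "\<dots> = snd a + v" using k(3) by (simp add: v_def algebra_simps)
  finally have 1: "(\<kappa> * \<Lambda>) *\<^sub>R snd c = snd a + v" .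
  have 2: "h \<bullet> v \<ge> 0 \<and> ((\<exists>y \<in> set (b # r) \<union> {c}. h \<bullet> G y > 0) \<longrightarrow> h \<bullet> v > 0)"
    if h: "\<forall>y \<in> set (b # r) \<union> {c}. h \<bullet> G y \<ge> 0" for h
  proof -
    have hw: "h \<bullet> w \<ge> 0 \<and> ((\<exists>y \<in> set r \<union> {c}. h \<bullet> G y > 0) \<longrightarrow> h \<bullet> w > 0)" using w(3) h by auto
    have hb: "h \<bullet> G b \<ge> 0" using h by simp
    have eq: "h \<bullet> v = t * (h \<bullet> G b) + \<kappa> * (h \<bullet> w)" by (simp add: v_def inner_add_right)
    show ?thesis
    proof (intro conjI impI)
      show "h \<bullet> v \<ge> 0" unfolding eq using k hw hb by simp
      assume "\<exists>y \<in> set (b # r) \<union> {c}. h \<bullet> G y > 0"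
      then have "h \<bullet> G b > 0 \<or> h \<bullet> w > 0" using hw by auto
      then show "h \<bullet> v > 0" unfolding eq using k hw hb by (auto intro: add_pos_nonneg add_nonneg_pos)
    qed
  qed
  show ?case using 1 2 k w(1) by (intro exI[of _ "\<kappa> * \<Lambda>"] exI[of _ v]) auto
qed auto

lemma cycle_sum:
  assumes ys: "cycle ys" and G: "\<And>y. y \<in> set ys \<Longrightarrow> directed G y"
  obtains \<Lambda> w where "0 < \<Lambda>" "\<Lambda> *\<^sub>R snd (hd ys) = snd (hd ys) + w"
    "\<And>h. (\<And>y. y \<in> set ys \<Longrightarrow> h \<bullet> G y \<ge> 0) \<Longrightarrow> h \<bullet> w \<ge> 0"
    "\<And>h. (\<And>y. y \<in> set ys \<Longrightarrow> h \<bullet> G y \<ge> 0) \<Longrightarrow> (\<exists>y \<in> set ys. h \<bullet> G y > 0) \<Longrightarrow> h \<bullet> w > 0"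
proof -
  have ne: "ys \<noteq> []" using ys by (simp add: cycle_def)
  have "\<exists>\<kappa> t. 0 < \<kappa> \<and> 0 < t \<and> \<kappa> *\<^sub>R snd b = snd a + t *\<^sub>R G b" if "(a, b) \<in> set (pairs_to ys (hd ys))" for a b
  proof -
    have "b \<in> set ys" using pairs_to_subset[OF that] ne by auto
    then show ?thesis using directed_step[of b G "snd a"] G ys that unfolding cycle_def by blast
  qed
  from directed_path_sum[OF this ne] obtain \<Lambda> w where w: "0 < \<Lambda>" "\<Lambda> *\<^sub>R snd (hd ys) = snd (hd ys) + w"
    "\<forall>h. (\<forall>y \<in> set (tl ys) \<union> {hd ys}. h \<bullet> G y \<ge> 0) \<longrightarrow>
      h \<bullet> w \<ge> 0 \<and> ((\<exists>y \<in> set (tl ys) \<union> {hd ys}. h \<bullet> G y > 0) \<longrightarrow> h \<bullet> w > 0)" by metis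
  have "set (tl ys) \<union> {hd ys} = set ys" using ne by (cases ys) auto
  with w show ?thesis using that by metis
qed

text \<open>One round gives \<open>\<Lambda> *\<^sub>R p = p + w\<close> for a head
  \<open>p\<close>, with \<open>w\<close> nonzero and in the plane of the headings. So \<Lambda> is
  not 1 and \<open>p\<close> is in that plane. Then the tail of its arc and the next head are in it
  too, against \<open>hit_transversal\<close>.\<close>

lemma cycle_not_coplanar:
  assumes ys: "cycle ys" and G: "\<And>y. y \<in> set ys \<Longrightarrow> directed G y"
    and n: "n \<noteq> 0" "\<And>y. y \<in> set ys \<Longrightarrow> n \<bullet> G y = 0" and h: "\<And>y. y \<in> set ys \<Longrightarrow> h \<bullet> G y > 0"
  shows False
proof -
  have ne: "ys \<noteq> []" using ys by (simp add: cycle_def)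
  obtain \<Lambda> w where w: "0 < \<Lambda>" "\<Lambda> *\<^sub>R snd (hd ys) = snd (hd ys) + w"
    "\<And>h. (\<And>y. y \<in> set ys \<Longrightarrow> h \<bullet> G y \<ge> 0) \<Longrightarrow> h \<bullet> w \<ge> 0"
    "\<And>h. (\<And>y. y \<in> set ys \<Longrightarrow> h \<bullet> G y \<ge> 0) \<Longrightarrow> (\<exists>y \<in> set ys. h \<bullet> G y > 0) \<Longrightarrow> h \<bullet> w > 0"
    using cycle_sum[OF ys G] by metis
  have "h \<bullet> w > 0" using w(4)[of h] h ne by (metis hd_in_set less_imp_le)
  then have "w \<noteq> 0" by auto
  then have "\<Lambda> \<noteq> 1" using w(2) by auto
  have "n \<bullet> w = 0" using w(3)[of n] w(3)[of "-n"] n(2) by force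
  then have "(\<Lambda> - 1) * (n \<bullet> snd (hd ys)) = 0"
    using arg_cong[OF w(2), of "\<lambda>x. n \<bullet> x"] by (simp add: inner_add_right algebra_simps)
  then have 1: "n \<bullet> snd (hd ys) = 0" using \<open>\<Lambda> \<noteq> 1\<close> by simp
  obtain b where b: "(hd ys, b) \<in> set (pairs_to ys (hd ys))" using pairs_to_fst ne by (metis hd_in_set)
  then have bo: "b \<in> set ys" using pairs_to_subset ne by (metis hd_in_set)
  have o: "hd ys \<in> oarcs" "b \<in> oarcs" and hit: "snd (hd ys) \<in> arc_relint b"
    using ys b bo ne unfolding cycle_def by auto
  obtain k t where k: "0 < k" "k *\<^sub>R snd b = snd (hd ys) + t *\<^sub>R G b" using directed_step[OF o(2) G[OF bo] hit] by metis
  have "n \<bullet> (k *\<^sub>R snd b) = 0" unfolding k(2) using 1 n(2)[OF bo] by (simp add: inner_add_right)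
  then have 2: "n \<bullet> snd b = 0" using k(1) by simp
  obtain k t where k: "k *\<^sub>R snd (hd ys) = fst (hd ys) + t *\<^sub>R G (hd ys)" using G[of "hd ys"] ne by (auto simp: directed_def)
  have "fst (hd ys) = k *\<^sub>R snd (hd ys) - t *\<^sub>R G (hd ys)" using k by simp
  then have 3: "n \<bullet> fst (hd ys) = 0"
    using 1 n(2)[of "hd ys"] ne by (simp add: inner_diff_right)
  show False using coplanar_det3_zero[OF n(1) 3 1 2] hit_transversal(1)[OF o hit] by blast
qed

end

definition sign :: "bool \<Rightarrow> real" where
  "sign b = (if b then 1 else - 1)"

lemma sign_simps [simp]: "sign b \<noteq> 0" "sign b * sign b = 1" "sign (\<not> b) = - sign b" "\<bar>sign b\<bar> = 1"
  by (simp_all add: sign_def)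

lemma sign_pos_eq: "sign b * x > 0 \<Longrightarrow> sign c * x > 0 \<Longrightarrow> b = c"
  by (auto simp: sign_def split: if_splits)

section \<open>Poles, sign patterns and octants\<close>

locale three_poles = spherical_diagram D for D +
  fixes pole :: "3 \<Rightarrow> real^3" and ty :: "arc \<Rightarrow> 3"
  assumes unit: "norm (pole c) = 1"
    and pole_inj: "c \<noteq> c' \<Longrightarrow> pole c \<noteq> pole c'"
    and pole_antipode: "pole c \<noteq> - pole c'"
    and oriented: "a \<in> D \<Longrightarrow> arc_normal a \<bullet> pole (ty a) = 0"
      "a \<in> D \<Longrightarrow> pole (ty a) \<notin> arc_points a" "a \<in> D \<Longrightarrow> - pole (ty a) \<notin> arc_points a"
begin

text \<open>Kinds are given for arcs of \<open>D\<close> only; this recovers the arc of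
  \<open>D\<close> behind a directed one.\<close>

definition base :: "arc \<Rightarrow> arc" where
  "base b = (if b \<in> D then b else prod.swap b)"

abbreviation kind :: "arc \<Rightarrow> 3" where
  "kind b \<equiv> ty (base b)"

definition heading :: "(3 \<Rightarrow> bool) \<Rightarrow> arc \<Rightarrow> real^3" where
  "heading \<sigma> b = sign (\<sigma> (kind b)) *\<^sub>R pole (kind b)"

definition headed :: "(3 \<Rightarrow> bool) \<Rightarrow> arc set" where
  "headed \<sigma> = {b \<in> oarcs. directed (heading \<sigma>) b}"

lemma base_in: "b \<in> oarcs \<Longrightarrow> base b \<in> D"
  by (cases b) (auto simp: base_def oarcs_def)

lemma endpoints_base [simp]: "endpoints (base b) = endpoints b"
  by (simp add: base_def)

lemma base_eq: "a \<in> D \<Longrightarrow> b \<in> oarcs \<Longrightarrow> endpoints b = endpoints a \<Longrightarrow> base b = a"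
  using base_in endpoints_inj_D by simp

text \<open>If both directions of an arc headed for the same pole, eliminating the pole would give a
  vanishing combination of its two ends with a positive coefficient.\<close>

lemma headed_inj: "inj_on endpoints (headed \<sigma>)"
proof (rule inj_onI, rule ccontr)
  fix a b assume ab: "a \<in> headed \<sigma>" "b \<in> headed \<sigma>" "endpoints a = endpoints b" "a \<noteq> b"
  then have sw: "b = prod.swap a" by (metis endpoints_eq_iff)
  have o: "a \<in> oarcs" "b \<in> oarcs" using ab by (auto simp: headed_def)
  have "base a = base b" using base_eq[OF base_in[OF o(2)] o(1)] ab(3) by simp
  then have h: "heading \<sigma> b = heading \<sigma> a" by (simp add: heading_def)
  define g where "g = heading \<sigma> a"
  obtain k t where k: "0 < k" "0 < t" "k *\<^sub>R snd a = fst a + t *\<^sub>R g"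
    using ab(1) by (auto simp: headed_def directed_def g_def)
  obtain l s where l: "0 < l" "0 < s" "l *\<^sub>R fst a = snd a + s *\<^sub>R g"
    using ab(2) h sw by (auto simp: headed_def directed_def g_def)
  have "s *\<^sub>R (k *\<^sub>R snd a - fst a) = t *\<^sub>R (l *\<^sub>R fst a - snd a)" unfolding k(3) l(3) by simp
  then have "(- s - t * l) *\<^sub>R fst a + (s * k + t) *\<^sub>R snd a = 0" by (simp add: algebra_simps)
  then have "s * k + t = 0" using valid_arc_independent oarcs_valid[OF o(1)] by blast
  moreover have "s * k > 0" using k l by simp
  ultimately show False using k by linarith
qed

lemma headed_exists:
  assumes "a \<in> D"
  shows "\<exists>b \<in> headed \<sigma>. endpoints b = endpoints a"
proof -
  let ?p = "sign (\<sigma> (ty a)) *\<^sub>R pole (ty a)"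
  have p: "?p = pole (ty a) \<or> ?p = - pole (ty a)" by (simp add: sign_def)
  then have "arc_normal a \<bullet> ?p = 0" "?p \<notin> arc_points a" "- ?p \<notin> arc_points a" "norm ?p = 1"
    using oriented[OF assms] unit by auto
  then obtain b where b: "endpoints b = endpoints a" "\<exists>\<kappa> t. 0 < \<kappa> \<and> 0 < t \<and> \<kappa> *\<^sub>R snd b = fst b + t *\<^sub>R ?p"
    using orient_towards[OF D_valid[OF assms], of ?p] by metis
  have "a \<in> oarcs" using assms by (simp add: oarcs_def)
  then have o: "b \<in> oarcs" using b(1) oarcs_swap[of a] endpoints_eq_iff[of b a] by metis
  then have "base b = a" using base_eq[OF assms _ b(1)] by simp
  then have "b \<in> headed \<sigma>" using b(2) o unfolding headed_def directed_def heading_def by simp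
  then show ?thesis using b(1) by blast
qed

lemma headed_next:
  assumes "b \<in> oarcs"
  shows "\<exists>c \<in> headed \<sigma>. snd b \<in> arc_relint c"
  using oarcs_blocked[OF assms] headed_exists arc_relint_endpoints by metis

lemma headed_cycle: "\<exists>ys. cycle ys \<and> set ys \<subseteq> headed \<sigma>"
proof (rule cycle_exists)
  show "headed \<sigma> \<noteq> {}" using D_nonempty headed_exists by blast
qed (use headed_inj headed_next in \<open>auto simp: headed_def\<close>)

text \<open>Coplanar poles would give coplanar headings, and generic signs put all of them on one
  side, where \<open>cycle_not_coplanar\<close> applies.\<close>

lemma poles_independent: "det3 (pole 1) (pole 2) (pole 3) \<noteq> 0"
proof
  assume 0: "det3 (pole 1) (pole 2) (pole 3) = 0"
  define n where "n = cross3 (pole 1) (pole 2)"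
  have "valid_arc (pole 1, pole 2)"
    using unit pole_inj[of 1 2] pole_antipode[of 1 2] by (simp add: valid_arc_def S2_def)
  then have n: "n \<noteq> 0" using valid_arc_cross by (fastforce simp: n_def)
  have np: "n \<bullet> pole c = 0" for c
  proof -
    have "\<forall>c. n \<bullet> pole c = 0" unfolding forall_3 using 0
      by (simp add: n_def det3_def dot_cross_self)
    then show ?thesis by blast
  qed
  have "pole c \<noteq> 0" for c using unit[of c] by auto
  then have "\<exists>h. \<forall>v \<in> range pole. h \<bullet> v \<noteq> 0" by (intro not_orthogonal_to_finite) auto
  then obtain h where h: "\<And>c. h \<bullet> pole c \<noteq> 0" by blast
  \<comment> \<open>The signs that make every heading positive under \<open>h\<close>.\<close>
  define \<sigma> where "\<sigma> c \<longleftrightarrow> h \<bullet> pole c > 0" for c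
  obtain ys where ys: "cycle ys" "set ys \<subseteq> headed \<sigma>" using headed_cycle by blast
  show False
  proof (rule cycle_not_coplanar[OF ys(1) _ n])
    show "directed (heading \<sigma>) y" if "y \<in> set ys" for y using that ys(2) by (auto simp: headed_def)
    show "n \<bullet> heading \<sigma> y = 0" for y by (simp add: heading_def np)
    show "h \<bullet> heading \<sigma> y > 0" for y
      using h[of "kind y"] by (auto simp: heading_def sign_def \<sigma>_def)
  qed
qed

text \<open>The basis dual to the poles: \<open>dual c \<bullet> v\<close> is the coordinate of
  \<open>v\<close> along \<open>pole c\<close>.\<close>

definition dual :: "3 \<Rightarrow> real^3" where
  "dual c = (1 / det3 (pole 1) (pole 2) (pole 3)) *\<^sub>R
     (if c = 1 then cross3 (pole 2) (pole 3) else if c = 2 then cross3 (pole 3) (pole 1) else cross3 (pole 1) (pole 2))"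

lemma dual_pole: "dual c \<bullet> pole c' = (if c = c' then 1 else 0)"
proof -
  define \<Delta> where "\<Delta> = det3 (pole 1) (pole 2) (pole 3)"
  have "det3 (pole 2) (pole 3) (pole 1) = \<Delta>" "det3 (pole 3) (pole 1) (pole 2) = \<Delta>"
    unfolding \<Delta>_def by (metis det3_rotate)+
  then have "\<forall>c c'. dual c \<bullet> pole c' = (if c = c' then 1 else 0)"
    unfolding forall_3 dual_def \<Delta>_def[symmetric] using poles_independent[folded \<Delta>_def]
    by (simp add: det3_def dot_cross_self) (simp add: \<Delta>_def det3_def)
  then show ?thesis by blast
qed

definition coord :: "(3 \<Rightarrow> bool) \<Rightarrow> 3 \<Rightarrow> real^3" where
  "coord \<sigma> c = sign (\<sigma> c) *\<^sub>R dual c"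

lemma coord_heading: "coord \<sigma> c \<bullet> heading \<sigma> y = (if kind y = c then 1 else 0)"
  by (simp add: coord_def heading_def dual_pole)

lemma coord_nonzero: "coord \<sigma> c \<noteq> 0"
  using dual_pole[of c c] by (auto simp: coord_def)

text \<open>Without kind \<open>c\<close> all headings lie in the plane where that coordinate
  vanishes, while the sum of the signed coordinates is positive on each of them.\<close>

lemma cycle_uses_all_kinds:
  assumes ys: "cycle ys" "set ys \<subseteq> headed \<sigma>"
  shows "\<exists>y \<in> set ys. kind y = c"
proof (rule ccontr)
  assume no: "\<not> ?thesis"
  show False
  proof (rule cycle_not_coplanar[OF ys(1) _ coord_nonzero])
    show "directed (heading \<sigma>) y" if "y \<in> set ys" for y using that ys(2) by (auto simp: headed_def)
    show "coord \<sigma> c \<bullet> heading \<sigma> y = 0" if "y \<in> set ys" for y using that no by (simp add: coord_heading)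
    show "(\<Sum>c\<in>UNIV. coord \<sigma> c) \<bullet> heading \<sigma> y > 0" for y
      by (simp add: inner_sum_left coord_heading)
  qed
qed

text \<open>The vector added in one round has all signed coordinates positive, and it is a multiple
  of the head; the sign of the factor chooses between the octant and its antipode.\<close>

lemma cycle_start_octant:
  assumes ys: "cycle ys" "set ys \<subseteq> headed \<sigma>"
  shows "(\<forall>c. coord \<sigma> c \<bullet> snd (hd ys) > 0) \<or> (\<forall>c. coord \<sigma> c \<bullet> snd (hd ys) < 0)"
proof -
  have dir: "\<And>y. y \<in> set ys \<Longrightarrow> directed (heading \<sigma>) y" using ys(2) by (auto simp: headed_def)
  obtain \<Lambda> w where "0 < \<Lambda>" and w: "\<Lambda> *\<^sub>R snd (hd ys) = snd (hd ys) + w"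
    "\<And>h. (\<And>y. y \<in> set ys \<Longrightarrow> h \<bullet> heading \<sigma> y \<ge> 0) \<Longrightarrow> h \<bullet> w \<ge> 0"
    "\<And>h. (\<And>y. y \<in> set ys \<Longrightarrow> h \<bullet> heading \<sigma> y \<ge> 0) \<Longrightarrow> (\<exists>y \<in> set ys. h \<bullet> heading \<sigma> y > 0) \<Longrightarrow> h \<bullet> w > 0"
    by (rule cycle_sum[OF ys(1), of "heading \<sigma>"]) (use dir in blast)+
  have "coord \<sigma> c \<bullet> w > 0" for c
  proof (rule w(3))
    obtain y where "y \<in> set ys" "kind y = c" using cycle_uses_all_kinds[OF ys] by metis
    then show "\<exists>y \<in> set ys. coord \<sigma> c \<bullet> heading \<sigma> y > 0" by (auto simp: coord_heading intro!: bexI[of _ y])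
  qed (simp add: coord_heading)
  moreover have "w = (\<Lambda> - 1) *\<^sub>R snd (hd ys)" using w(1) by (simp add: algebra_simps)
  ultimately have "(\<Lambda> - 1) * (coord \<sigma> c \<bullet> snd (hd ys)) > 0" for c by simp
  then show ?thesis by (cases "\<Lambda> > 1") (auto simp: zero_less_mult_iff)
qed

lemma octant_cycle:
  obtains ys where "cycle ys" "set ys \<subseteq> headed \<sigma>" "\<And>y c. y \<in> set ys \<Longrightarrow> coord \<sigma> c \<bullet> snd y > 0"
proof -
  \<comment> \<open>A cycle for this pattern lies in its octant, where coordinate 1 has the sign
    prescribed by \<sigma>, or in the antipodal one, where coordinate 2 does. Either way there is a
    starting point that excludes the antipode of the octant of \<sigma>.\<close>
  define \<tau> where "\<tau> = \<sigma>(2 := \<not> \<sigma> 2, 3 := \<not> \<sigma> 3)"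
  obtain zs where zs: "cycle zs" "set zs \<subseteq> headed \<tau>" using headed_cycle by blast
  then have hz: "hd zs \<in> oarcs" by (auto simp: cycle_def)
  have "coord \<tau> 1 = coord \<sigma> 1" "coord \<tau> 2 = - coord \<sigma> 2" by (auto simp: coord_def \<tau>_def)
  then have "coord \<sigma> 1 \<bullet> snd (hd zs) > 0 \<or> coord \<sigma> 2 \<bullet> snd (hd zs) > 0"
    using cycle_start_octant[OF zs] by (metis inner_minus_left neg_less_0_iff_less)
  then obtain c0 where c0: "coord \<sigma> c0 \<bullet> snd (hd zs) > 0" by blast
  have step: "coord \<sigma> c \<bullet> snd b > 0" if b: "b \<in> headed \<sigma>" "p \<in> arc_relint b" "coord \<sigma> c \<bullet> p > 0" for b p c
  proof -
    obtain k t where k: "0 < k" "0 < t" "k *\<^sub>R snd b = p + t *\<^sub>R heading \<sigma> b"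
      using directed_step[of b "heading \<sigma>" p] b by (auto simp: headed_def)
    have "coord \<sigma> c \<bullet> (k *\<^sub>R snd b) > 0"
      unfolding k(3) using b(3) k(2) by (simp add: inner_add_right coord_heading)
    then show ?thesis using k(1) by (simp add: zero_less_mult_iff)
  qed
  \<comment> \<open>Steps towards the poles of \<sigma> never lower a positive coordinate to zero or
    below, so a walk within \<open>S\<close> can always go on.\<close>
  define S where "S = {b \<in> headed \<sigma>. coord \<sigma> c0 \<bullet> snd b > 0}"
  have "\<exists>ys. cycle ys \<and> set ys \<subseteq> S"
  proof (rule cycle_exists)
    show "S \<subseteq> oarcs" unfolding S_def headed_def by blast
    obtain b where "b \<in> headed \<sigma>" "snd (hd zs) \<in> arc_relint b" using headed_next[OF hz] by blast
    then show "S \<noteq> {}" using step c0 unfolding S_def by blast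
    show "inj_on endpoints S" using headed_inj by (rule inj_on_subset) (auto simp: S_def)
    show "\<exists>c \<in> S. snd b \<in> arc_relint c" if "b \<in> S" for b
    proof -
      have "b \<in> oarcs" using that by (simp add: S_def headed_def)
      then obtain c where "c \<in> headed \<sigma>" "snd b \<in> arc_relint c" using headed_next by blast
      then show ?thesis using step that unfolding S_def by blast
    qed
  qed
  then obtain ys where ys: "cycle ys" "set ys \<subseteq> S" by blast
  then have sub: "set ys \<subseteq> headed \<sigma>" and ne: "ys \<noteq> []" by (auto simp: S_def cycle_def)
  have "hd ys \<in> S" using ys(2) ne hd_in_set by blast
  then have "coord \<sigma> c0 \<bullet> snd (hd ys) > 0" by (simp add: S_def)
  then have start: "coord \<sigma> c \<bullet> snd (hd ys) > 0" for c
    using cycle_start_octant[OF ys(1) sub] by (metis less_asym)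
  have "coord \<sigma> c \<bullet> snd y > 0" if "y \<in> set ys" for y c
  proof (rule pairs_to_invariant[of ys "hd ys" "\<lambda>y. coord \<sigma> c \<bullet> snd y > 0", OF _ ne start that])
    fix a b assume ab: "(a, b) \<in> set (pairs_to ys (hd ys))" "coord \<sigma> c \<bullet> snd a > 0"
    then have "b \<in> headed \<sigma>" "snd a \<in> arc_relint b"
      using pairs_to_subset[OF ab(1)] ne sub ys(1) by (auto simp: cycle_def)
    then show "coord \<sigma> c \<bullet> snd b > 0" using step ab(2) by blast
  qed
  then show ?thesis using that ys(1) sub by blast
qed

text \<open>An arc changes only the coordinate of its own kind, up to a positive factor, so its ends
  agree in the signs of the other two.\<close>

lemma directed_same_sign:
  assumes y: "y \<in> headed \<sigma>" and c: "c \<noteq> kind y" and e: "e \<in> endpoints y" "e' \<in> endpoints y"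
    and pos: "sign b * (dual c \<bullet> e) > 0" "sign b' * (dual c \<bullet> e') > 0"
  shows "b = b'"
proof -
  obtain k t where k: "0 < k" "k *\<^sub>R snd y = fst y + t *\<^sub>R heading \<sigma> y"
    using y by (auto simp: headed_def directed_def)
  have "dual c \<bullet> heading \<sigma> y = 0" using c by (simp add: heading_def dual_pole)
  then have "k * (dual c \<bullet> snd y) = dual c \<bullet> fst y"
    using arg_cong[OF k(2), of "\<lambda>x. dual c \<bullet> x"] by (simp add: inner_add_right)
  then have eq: "dual c \<bullet> fst y = k * (dual c \<bullet> snd y)" by simp
  have "sign b * (dual c \<bullet> snd y) > 0" if "sign b * (dual c \<bullet> e) > 0" "e \<in> endpoints y" for b e
  proof (cases "e = snd y")
    case False
    then have "e = fst y" using that(2) by (simp add: endpoints_def)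
    then have "0 < k * (sign b * (dual c \<bullet> snd y))" using that(1) eq by (simp only: mult.left_commute)
    then show ?thesis using k(1) by (rule zero_less_mult_pos)
  qed (use that in simp)
  then show ?thesis using pos e sign_pos_eq by blast
qed

theorem twelve_arcs: "12 \<le> card D"
proof -
  \<comment> \<open>An arc of kind \<open>c\<close> reveals the signs of the two other coordinates.
    The pattern takes these as \<open>p\<close> and \<open>q\<close>, in the order 1, 2, 3, and
    fixes the sign at \<open>c\<close>; this gives 3 * 2 * 2 distinct arcs.\<close>
  define \<sigma> :: "3 \<times> bool \<times> bool \<Rightarrow> 3 \<Rightarrow> bool" where
    "\<sigma> = (\<lambda>(c, p, q) i. if i = c then True else if (i, c) \<in> {(2, 1), (1, 2), (1, 3)} then p else q)"
  have \<sigma>_inj: "p = p' \<and> q = q'" if "\<And>i. i \<noteq> c \<Longrightarrow> \<sigma> (c, p, q) i = \<sigma> (c, p', q') i" for c p q p' q'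
  proof -
    have "\<forall>c. (\<forall>i. i \<noteq> c \<longrightarrow> \<sigma> (c, p, q) i = \<sigma> (c, p', q') i) \<longrightarrow> p = p' \<and> q = q'"
      unfolding forall_3 by (simp add: \<sigma>_def)
    then show ?thesis using that by blast
  qed
  have "\<exists>y. y \<in> headed (\<sigma> x) \<and> kind y = fst x \<and> (\<forall>c. coord (\<sigma> x) c \<bullet> snd y > 0)" for x
  proof -
    obtain ys where ys: "cycle ys" "set ys \<subseteq> headed (\<sigma> x)" "\<And>y c. y \<in> set ys \<Longrightarrow> coord (\<sigma> x) c \<bullet> snd y > 0"
      using octant_cycle[of "\<sigma> x"] by blast
    obtain y where "y \<in> set ys" "kind y = fst x" using cycle_uses_all_kinds[OF ys(1,2)] by blast
    then show ?thesis using ys(2,3) by blast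
  qed
  then have "\<forall>x. \<exists>y. y \<in> headed (\<sigma> x) \<and> kind y = fst x \<and> (\<forall>c. coord (\<sigma> x) c \<bullet> snd y > 0)" by blast
  from choice[OF this] obtain F where F: "\<And>x. F x \<in> headed (\<sigma> x)" "\<And>x. kind (F x) = fst x"
    "\<And>x c. coord (\<sigma> x) c \<bullet> snd (F x) > 0" by blast
  have "inj (\<lambda>x. base (F x))"
  proof (rule injI)
    fix x x' assume eq: "base (F x) = base (F x')"
    then have ep: "endpoints (F x) = endpoints (F x')" by (metis endpoints_base)
    have kx: "fst x = fst x'" using F(2) eq by metis
    have "\<sigma> x i = \<sigma> x' i" if "i \<noteq> fst x" for i
    proof (rule directed_same_sign[OF F(1)])
      show "i \<noteq> kind (F x)" using that F(2) by simp
      show "snd (F x) \<in> endpoints (F x)" "snd (F x') \<in> endpoints (F x)" using ep by (auto simp: endpoints_def)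
      show "sign (\<sigma> x i) * (dual i \<bullet> snd (F x)) > 0" "sign (\<sigma> x' i) * (dual i \<bullet> snd (F x')) > 0"
        using F(3)[of x i] F(3)[of x' i] by (auto simp: coord_def)
    qed
    moreover obtain c p q where x: "x = (c, p, q)" by (cases x)
    moreover obtain p' q' where x': "x' = (c, p', q')" using kx x by (cases x') auto
    ultimately have "p = p' \<and> q = q'" by (intro \<sigma>_inj) (simp only: fst_conv)
    then show "x = x'" using x x' by simp
  qed
  moreover have "base (F x) \<in> D" for x
    using F(1)[of x] base_in by (simp only: headed_def mem_Collect_eq)
  then have "range (\<lambda>x. base (F x)) \<subseteq> D" by blast
  ultimately have "card (UNIV :: (3 \<times> bool \<times> bool) set) \<le> card D"
    using finite_D by (rule card_inj_on_le)
  then show ?thesis by (simp add: card_prod[symmetric])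
qed

end

section \<open>One swirl for each octant\<close>

context three_poles
begin

text \<open>A cycle for \<sigma> is a ring in the chart of the signed coordinates, so
  \<open>ring_same_turns\<close> applies. The arcs of the resulting ring need not head for the poles
  of \<sigma>; what remains is that their heads are in the octant.\<close>

lemma octant_swirl:
  obtains xs ys where "swirl D xs" "length xs = length ys" "ys \<noteq> []"
    "\<And>i. i < length ys \<Longrightarrow> ys ! i \<in> oarcs \<and> xs ! i = base (ys ! i) \<and> (\<forall>c. coord \<sigma> c \<bullet> snd (ys ! i) > 0)
       \<and> snd (ys ! i) \<in> arc_relint (xs ! (Suc i mod length ys))"
proof -
  obtain zs where zs: "cycle zs" "set zs \<subseteq> headed \<sigma>" "\<And>y c. y \<in> set zs \<Longrightarrow> coord \<sigma> c \<bullet> snd y > 0"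
    using octant_cycle[of \<sigma>] by blast
  interpret chart D "coord \<sigma> 1" "coord \<sigma> 2" "coord \<sigma> 3"
  proof unfold_locales
    have "det3 (coord \<sigma> 1) (coord \<sigma> 2) (coord \<sigma> 3) * det3 (pole 1) (pole 2) (pole 3)
       = sign (\<sigma> 1) * sign (\<sigma> 2) * sign (\<sigma> 3)"
      unfolding det3_gram by (simp add: coord_def dual_pole)
    then show "det3 (coord \<sigma> 1) (coord \<sigma> 2) (coord \<sigma> 3) \<noteq> 0" by force
  qed
  have oct: "v \<in> octant \<longleftrightarrow> (\<forall>c. coord \<sigma> c \<bullet> v > 0)" for v
    unfolding octant_def forall_3 by simp
  have "ring zs" using zs(1,3) unfolding ring_def cycle_def oct by blast
  then obtain ys where ys: "ring ys"
    "(\<forall>(a, b) \<in> set (pairs_to ys (hd ys)). det3 (fst a) (snd a) (snd b) > 0)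
      \<or> (\<forall>(a, b) \<in> set (pairs_to ys (hd ys)). det3 (fst a) (snd a) (snd b) < 0)"
    using ring_same_turns by blast
  define n where "n = length ys"
  have r: "ys \<noteq> []" "set ys \<subseteq> oarcs" "distinct (map endpoints ys)"
    "\<And>a b. (a, b) \<in> set (pairs_to ys (hd ys)) \<Longrightarrow> snd a \<in> arc_relint b" "\<And>y. y \<in> set ys \<Longrightarrow> snd y \<in> octant"
    using ys(1) unfolding ring_def by blast+
  have n: "n > 0" using r(1) by (simp add: n_def)
  have pair: "(ys ! i, ys ! (Suc i mod n)) \<in> set (pairs_to ys (hd ys))" if "i < n" for i
    unfolding set_pairs_to_cyclic n_def using that n_def by blast
  define xs where "xs = map base ys"
  have mem: "ys ! i \<in> oarcs" if "i < n" for i using r(2) that nth_mem[of i ys] unfolding n_def by blast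
  have relint: "arc_relint (base y) = arc_relint y" for y by (rule arc_relint_endpoints) simp
  have xs_nth: "xs ! i = base (ys ! i)" if "i < n" for i using that by (simp add: xs_def n_def)
  have hit: "snd (ys ! i) \<in> arc_relint (xs ! (Suc i mod n))" if "i < n" for i
    using r(4)[OF pair[OF that]] xs_nth[of "Suc i mod n"] n relint by simp
  have "swirl D xs"
    unfolding swirl_def
  proof (intro conjI)
    show "xs \<noteq> []" using r(1) by (simp add: xs_def)
    have "map endpoints xs = map endpoints ys" by (simp add: xs_def)
    then show "distinct xs" using r(3) by (metis distinct_map)
    show "set xs \<subseteq> D" using r(2) base_in by (auto simp: xs_def simp del: split_paired_All)
    have len: "length xs = n" by (simp add: xs_def n_def)
    have e: "(snd y, fst y) \<in> {base y, prod.swap (base y)}" for y by (cases y) (simp add: base_def)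
    have turns: "cross3 (fst (ys ! i)) (snd (ys ! i)) \<bullet> snd (ys ! (Suc i mod n))
       = det3 (fst (ys ! i)) (snd (ys ! i)) (snd (ys ! (Suc i mod n)))" for i by (simp add: det3_def)
    have nthm: "map snd ys ! i = snd (ys ! i)" "map fst ys ! i = fst (ys ! i)" if "i < n" for i
      using that by (simp_all add: n_def)
    have Suc: "(i + 1) mod n = Suc i mod n" "Suc i mod n < n" for i using n by auto
    show "\<exists>ps qs. length ps = length xs \<and> length qs = length xs \<and>
        (\<forall>i<length xs. (ps ! i, qs ! i) \<in> {xs ! i, prod.swap (xs ! i)} \<and> ps ! i \<in> arc_relint (xs ! ((i + 1) mod length xs))) \<and>
        ((\<forall>i<length xs. 0 < cross3 (qs ! i) (ps ! i) \<bullet> ps ! ((i + 1) mod length xs)) \<or>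
         (\<forall>i<length xs. cross3 (qs ! i) (ps ! i) \<bullet> ps ! ((i + 1) mod length xs) < 0))"
    proof (rule exI[of _ "map snd ys"], rule exI[of _ "map fst ys"], intro conjI)
      show "\<forall>i<length xs. (map snd ys ! i, map fst ys ! i) \<in> {xs ! i, prod.swap (xs ! i)} \<and>
          map snd ys ! i \<in> arc_relint (xs ! ((i + 1) mod length xs))"
        unfolding len using e hit by (simp add: nthm xs_nth)
      show "(\<forall>i<length xs. 0 < cross3 (map fst ys ! i) (map snd ys ! i) \<bullet> map snd ys ! ((i + 1) mod length xs)) \<or>
         (\<forall>i<length xs. cross3 (map fst ys ! i) (map snd ys ! i) \<bullet> map snd ys ! ((i + 1) mod length xs) < 0)"
        using ys(2) pair unfolding len by (fastforce simp: nthm Suc turns)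
    qed (simp_all add: xs_def)
  qed
  moreover have "\<forall>c. coord \<sigma> c \<bullet> snd (ys ! i) > 0" if "i < n" for i
    using r(5)[of "ys ! i"] that unfolding oct n_def by simp
  ultimately show ?thesis using that[of xs ys] mem xs_nth hit r(1) by (simp add: xs_def n_def)
qed

text \<open>A hitting edge \<open>(a, b)\<close> determines which end of \<open>a\<close> is on
  \<open>b\<close>, and the coordinate signs of that end are the sign pattern. Swirls chosen for
  different octants thus have different edge sets.\<close>

theorem eight_swirls: "8 \<le> card (swirls D)"
proof -
  have "\<exists>E. E \<in> swirls D \<and> (\<exists>a b y. (a, b) \<in> E \<and> y \<in> oarcs \<and> a = base y \<and> snd y \<in> arc_relint b) \<and>
     (\<forall>a b. (a, b) \<in> E \<longrightarrow> (\<exists>y. y \<in> oarcs \<and> b \<in> D \<and> a = base y \<and> snd y \<in> arc_relint b \<and> (\<forall>c. coord \<sigma> c \<bullet> snd y > 0)))" for \<sigma>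
  proof -
    obtain xs ys where xs: "swirl D xs" "length xs = length ys" "ys \<noteq> []"
      "\<And>i. i < length ys \<Longrightarrow> ys ! i \<in> oarcs \<and> xs ! i = base (ys ! i) \<and> (\<forall>c. coord \<sigma> c \<bullet> snd (ys ! i) > 0)
         \<and> snd (ys ! i) \<in> arc_relint (xs ! (Suc i mod length ys))"
      using octant_swirl[of \<sigma>] by metis
    have n: "length ys > 0" using xs(3) by simp
    have xsD: "xs ! i \<in> D" if "i < length ys" for i
      using xs(1,2) that nth_mem[of i xs] unfolding swirl_def by (simp add: subset_iff del: split_paired_All)
    have "swirl_edges xs \<in> swirls D" using xs(1) by (simp add: swirls_def)
    moreover have "(xs ! 0, xs ! (Suc 0 mod length ys)) \<in> swirl_edges xs"
      unfolding swirl_edges_def xs(2) using n by (intro CollectI exI[of _ 0]) simp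
    moreover have "\<exists>y. y \<in> oarcs \<and> b \<in> D \<and> a = base y \<and> snd y \<in> arc_relint b \<and> (\<forall>c. coord \<sigma> c \<bullet> snd y > 0)"
      if ab: "(a, b) \<in> swirl_edges xs" for a b
    proof -
      obtain i where i: "i < length ys" "a = xs ! i" "b = xs ! (Suc i mod length ys)"
        using ab unfolding swirl_edges_def xs(2) by auto
      then show ?thesis using xs(4)[OF i(1)] xsD[of "Suc i mod length ys"] n by (intro exI[of _ "ys ! i"]) simp
    qed
    ultimately show ?thesis using xs(4)[OF n] by blast
  qed
  then have "\<forall>\<sigma>. \<exists>E. E \<in> swirls D \<and> (\<exists>a b y. (a, b) \<in> E \<and> y \<in> oarcs \<and> a = base y \<and> snd y \<in> arc_relint b) \<and>
     (\<forall>a b. (a, b) \<in> E \<longrightarrow> (\<exists>y. y \<in> oarcs \<and> b \<in> D \<and> a = base y \<and> snd y \<in> arc_relint b \<and> (\<forall>c. coord \<sigma> c \<bullet> snd y > 0)))" by blast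
  from choice[OF this] obtain E where E: "\<And>\<sigma>. E \<sigma> \<in> swirls D" "\<And>\<sigma>. \<exists>a b. (a, b) \<in> E \<sigma>"
    "\<And>\<sigma> a b. (a, b) \<in> E \<sigma> \<Longrightarrow> \<exists>y. y \<in> oarcs \<and> b \<in> D \<and> a = base y \<and> snd y \<in> arc_relint b \<and> (\<forall>c. coord \<sigma> c \<bullet> snd y > 0)"
    by blast
  have "inj E"
  proof (rule injI)
    fix \<sigma> \<tau> assume eq: "E \<sigma> = E \<tau>"
    obtain a b where ab: "(a, b) \<in> E \<sigma>" using E(2) by blast
    obtain y where y: "y \<in> oarcs" "b \<in> D" "a = base y" "snd y \<in> arc_relint b" "\<And>c. coord \<sigma> c \<bullet> snd y > 0"
      using E(3)[OF ab] by blast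
    obtain z where z: "z \<in> oarcs" "a = base z" "snd z \<in> arc_relint b" "\<And>c. coord \<tau> c \<bullet> snd z > 0"
      using E(3)[of a b \<tau>] ab eq by auto
    have "endpoints y = endpoints z" using y(3) z(2) by (metis endpoints_base)
    \<comment> \<open>With both ends on \<open>b\<close>, the arc would lie in the great circle of
      \<open>b\<close>.\<close>
    moreover have "y \<noteq> prod.swap z"
    proof
      assume "y = prod.swap z"
      then have f: "fst y \<in> arc_relint b" using z(3) by simp
      have bo: "b \<in> oarcs" using y(2) by (simp add: oarcs_def)
      obtain \<alpha> \<beta> where 1: "snd y = \<alpha> *\<^sub>R fst b + \<beta> *\<^sub>R snd b" using arc_relintE[OF oarcs_valid[OF bo] y(4)] by metis
      obtain \<gamma> \<delta> where 2: "fst y = \<gamma> *\<^sub>R fst b + \<delta> *\<^sub>R snd b" using arc_relintE[OF oarcs_valid[OF bo] f] by metis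
      have "det3 (fst y) (snd y) (snd b) = 0" unfolding 1 2 by (simp add: det3_linear)
      then show False using hit_transversal(1)[OF y(1) bo y(4)] by blast
    qed
    ultimately have "y = z" by (metis endpoints_eq_iff)
    then have "\<sigma> c = \<tau> c" for c using y(5)[of c] z(4)[of c] sign_pos_eq by (simp add: coord_def)
    then show "\<sigma> = \<tau>" by blast
  qed
  moreover have "finite (swirls D)"
  proof (rule finite_subset)
    show "finite (Pow (D \<times> D))" using finite_D by simp
    show "swirls D \<subseteq> Pow (D \<times> D)"
    proof
      fix E assume "E \<in> swirls D"
      then obtain xs where xs: "swirl D xs" "E = swirl_edges xs" by (auto simp: swirls_def)
      then have "xs ! i \<in> D" if "i < length xs" for i
        using that nth_mem[of i xs] unfolding swirl_def by (simp add: subset_iff del: split_paired_All)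
      moreover have "xs \<noteq> []" using xs(1) by (simp add: swirl_def)
      ultimately show "E \<in> Pow (D \<times> D)" unfolding xs(2) swirl_edges_def by auto
    qed
  qed
  ultimately have "card (UNIV :: (3 \<Rightarrow> bool) set) \<le> card (swirls D)"
    using E(1) by (intro card_inj_on_le[of E]) auto
  then show ?thesis by (simp add: card_fun)
qed

end

theorem lower_bounds:
  assumes "SD D" "k_oriented 3 D"
  shows "8 \<le> card (swirls D)" "12 \<le> card D"
proof -
  obtain P f where P: "card P = 3" "P \<subseteq> S2" "\<forall>p\<in>P. \<forall>q\<in>P. q \<noteq> - p"
    "\<And>a. a \<in> D \<Longrightarrow> f a \<in> P \<and> arc_normal a \<bullet> f a = 0 \<and> f a \<notin> arc_points a \<and> - f a \<notin> arc_points a"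
    using assms(2) unfolding k_oriented_def by blast
  have "finite P" using P(1) by (metis card.infinite zero_neq_numeral)
  then obtain pole :: "3 \<Rightarrow> real^3" where pole: "bij_betw pole UNIV P"
    using P(1) finite_same_card_bij[of "UNIV :: 3 set" P] by auto
  define ty where "ty a = inv_into UNIV pole (f a)" for a
  have ty: "pole (ty a) = f a" if "a \<in> D" for a
    unfolding ty_def using P(4)[OF that] pole by (metis bij_betw_imp_surj_on f_inv_into_f)
  have in_P: "pole c \<in> P" for c using pole by (auto simp: bij_betw_def)
  interpret three_poles D pole ty
  proof
    show "SD D" by (rule assms(1))
    show "norm (pole c) = 1" for c using in_P[of c] P(2) by (auto simp: S2_def)
    show "pole c \<noteq> pole c'" if "c \<noteq> c'" for c c' using that pole by (auto simp: bij_betw_def inj_eq)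
    show "pole c \<noteq> - pole c'" for c c' using P(3) in_P by blast
  qed (use ty P(4) in auto)
  show "8 \<le> card (swirls D)" "12 \<le> card D" by (rule eight_swirls twelve_arcs)+
qed

section \<open>Twelve arcs with eight swirls\<close>

definition nx :: "3 \<Rightarrow> 3" where
  "nx k = (if k = 1 then 2 else if k = 2 then 3 else 1)"

lemma nx_simps [simp]: "nx 1 = 2" "nx 2 = 3" "nx 3 = 1"
  by (simp_all add: nx_def)

lemma nx_nx_nx [simp]: "nx (nx (nx k)) = k"
proof -
  have "\<forall>k. nx (nx (nx k)) = k" unfolding forall_3 by simp
  then show ?thesis by blast
qed

lemma nx_ne [simp]: "nx k \<noteq> k" "k \<noteq> nx k" "nx (nx k) \<noteq> k" "k \<noteq> nx (nx k)" "nx (nx k) \<noteq> nx k" "nx k \<noteq> nx (nx k)"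
proof -
  have "\<forall>k. nx k \<noteq> k \<and> nx (nx k) \<noteq> k \<and> nx (nx k) \<noteq> nx k" unfolding forall_3 by simp
  then show "nx k \<noteq> k" "k \<noteq> nx k" "nx (nx k) \<noteq> k" "k \<noteq> nx (nx k)" "nx (nx k) \<noteq> nx k" "nx k \<noteq> nx (nx k)"
    by metis+
qed

lemma nx_cases: "j = k \<or> j = nx k \<or> j = nx (nx k)"
proof -
  have "\<forall>j k. j = k \<or> j = nx k \<or> j = nx (nx k)" unfolding forall_3 by simp
  then show ?thesis by blast
qed

lemma vec3_eqI:
  fixes u v :: "real^3"
  assumes "u $ k = v $ k" "u $ nx k = v $ nx k" "u $ nx (nx k) = v $ nx (nx k)"
  shows "u = v"
proof -
  have "u $ j = v $ j" for j using nx_cases[of j k] assms by auto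
  then show ?thesis by (simp add: vec_eq_iff)
qed

lemma inner_nx: "u \<bullet> v = u $ k * v $ k + u $ nx k * v $ nx k + u $ nx (nx k) * v $ nx (nx k)" for u v :: "real^3"
proof -
  have "\<forall>k. u \<bullet> v = u $ k * v $ k + u $ nx k * v $ nx k + u $ nx (nx k) * v $ nx (nx k)"
    unfolding forall_3 by (simp add: inner_vec_def sum_3)
  then show ?thesis by blast
qed

lemma cross3_nx:
  fixes u v :: "real^3"
  shows "cross3 u v $ k = u $ nx k * v $ nx (nx k) - u $ nx (nx k) * v $ nx k"
proof -
  have "\<forall>k. cross3 u v $ k = u $ nx k * v $ nx (nx k) - u $ nx (nx k) * v $ nx k"
    unfolding forall_3 by (simp add: cross3_def)
  then show ?thesis by blast
qed

text \<open>The arc of type k consists of the directions with coordinates t (between -4 and 4), a, 2b at the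
  cyclically ordered positions k, k+1, k+2, where a and b are signs. The direction (4r, a, 2b) is also
  (a/2, b, 2r) at the positions k+1, k+2, k, so the end t = 4r lies on the arc of the next type with
  signs b and r.\<close>

definition pt :: "3 \<Rightarrow> real \<Rightarrow> real \<Rightarrow> real \<Rightarrow> real^3" where
  "pt k a b t = (1 / sqrt 21) *\<^sub>R (\<chi> i. if i = k then t else if i = nx k then a else 2 * b)"

lemma pt_nth [simp]:
  "pt k a b t $ k = t / sqrt 21" "pt k a b t $ nx k = a / sqrt 21" "pt k a b t $ nx (nx k) = 2 * b / sqrt 21"
  by (simp_all add: pt_def)

definition ex_arc :: "3 \<times> bool \<times> bool \<Rightarrow> arc" where
  "ex_arc = (\<lambda>(k, p, q). (pt k (sign p) (sign q) (- 4), pt k (sign p) (sign q) 4))"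

lemma ex_arc_eq: "ex_arc (k, p, q) = (pt k (sign p) (sign q) (- 4), pt k (sign p) (sign q) 4)"
  by (simp add: ex_arc_def)

definition ex_diagram :: "arc set" where
  "ex_diagram = range ex_arc"

text \<open>The factor in \<open>pt\<close> comes from 16 + 1 + 4 = 21, so only the ends
  \<open>t = \<plusminus> 4\<close> are unit vectors.\<close>

lemma norm_pt: "norm (pt k (sign p) (sign q) (4 * sign r)) = 1"
proof -
  have "pt k (sign p) (sign q) (4 * sign r) \<bullet> pt k (sign p) (sign q) (4 * sign r) = 1"
    unfolding inner_nx[of _ _ k] pt_nth by (cases p; cases q; cases r) (simp_all add: sign_def field_simps)
  then show ?thesis by (simp add: norm_eq_1)
qed

lemma pt_ends: "pt k a b (- 4) = pt k a b (4 * sign False)" "pt k a b 4 = pt k a b (4 * sign True)"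
  by (simp_all add: sign_def)

lemma ex_arc_valid: "valid_arc (ex_arc (k, p, q))"
proof -
  have "pt k (sign p) (sign q) (- 4) \<noteq> pt k (sign p) (sign q) 4"
  proof
    assume "pt k (sign p) (sign q) (- 4) = pt k (sign p) (sign q) 4"
    then have "pt k (sign p) (sign q) (- 4) $ k = pt k (sign p) (sign q) 4 $ k" by simp
    then show False unfolding pt_nth by simp
  qed
  moreover have "pt k (sign p) (sign q) (- 4) \<noteq> - pt k (sign p) (sign q) 4"
  proof
    assume "pt k (sign p) (sign q) (- 4) = - pt k (sign p) (sign q) 4"
    then have "pt k (sign p) (sign q) (- 4) $ nx k = (- pt k (sign p) (sign q) 4) $ nx k" by simp
    then show False by (simp add: sign_def split: if_splits)
  qed
  moreover have "norm (pt k (sign p) (sign q) (- 4)) = 1" "norm (pt k (sign p) (sign q) 4) = 1"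
    unfolding pt_ends by (rule norm_pt)+
  ultimately show ?thesis by (simp add: ex_arc_eq valid_arc_def S2_def)
qed

lemma pt_combination:
  assumes "\<alpha> + \<beta> \<noteq> 0"
  shows "\<alpha> *\<^sub>R pt k a b x + \<beta> *\<^sub>R pt k a b y = (\<alpha> + \<beta>) *\<^sub>R pt k a b ((\<alpha> * x + \<beta> * y) / (\<alpha> + \<beta>))"
proof -
  define c where "c = (\<alpha> * x + \<beta> * y) / (\<alpha> + \<beta>)"
  have c: "\<alpha> * x + \<beta> * y = (\<alpha> + \<beta>) * c" using assms by (simp add: c_def)
  have "(\<alpha> *\<^sub>R pt k a b x + \<beta> *\<^sub>R pt k a b y) $ k = (\<alpha> * x + \<beta> * y) / sqrt 21"
    by (simp add: add_divide_distrib)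
  also have "\<dots> = ((\<alpha> + \<beta>) *\<^sub>R pt k a b c) $ k" unfolding c by simp
  finally show ?thesis unfolding c_def[symmetric]
    by (rule vec3_eqI) (simp_all add: algebra_simps add_divide_distrib)
qed

text \<open>Between the ends \<open>pt\<close> is shorter than a unit vector, hence the free factor
  \<open>l\<close>; the parameter \<open>t\<close> is linear along the chord.\<close>

lemma ex_arc_relint:
  "v \<in> arc_relint (ex_arc (k, p, q)) \<longleftrightarrow> norm v = 1 \<and> (\<exists>l t. 0 < l \<and> \<bar>t\<bar> < 4 \<and> v = l *\<^sub>R pt k (sign p) (sign q) t)"
proof
  assume "v \<in> arc_relint (ex_arc (k, p, q))"
  then obtain \<alpha> \<beta> where ab: "0 < \<alpha>" "0 < \<beta>" "v = \<alpha> *\<^sub>R pt k (sign p) (sign q) (- 4) + \<beta> *\<^sub>R pt k (sign p) (sign q) 4" "norm v = 1"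
    using arc_relintE[OF ex_arc_valid] unfolding ex_arc_eq fst_conv snd_conv by metis
  define t where "t = (\<alpha> * (- 4) + \<beta> * 4) / (\<alpha> + \<beta>)"
  have "\<bar>t\<bar> < 4" unfolding t_def using ab(1,2) by (simp add: abs_less_iff field_simps)
  moreover have "v = (\<alpha> + \<beta>) *\<^sub>R pt k (sign p) (sign q) t" unfolding ab(3) t_def using ab(1,2) by (intro pt_combination) simp
  ultimately show "norm v = 1 \<and> (\<exists>l t. 0 < l \<and> \<bar>t\<bar> < 4 \<and> v = l *\<^sub>R pt k (sign p) (sign q) t)"
    using ab by (intro conjI exI[of _ "\<alpha> + \<beta>"] exI[of _ t]) auto
next
  assume "norm v = 1 \<and> (\<exists>l t. 0 < l \<and> \<bar>t\<bar> < 4 \<and> v = l *\<^sub>R pt k (sign p) (sign q) t)"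
  then obtain l t where v: "norm v = 1" "0 < l" "\<bar>t\<bar> < 4" "v = l *\<^sub>R pt k (sign p) (sign q) t" by blast
  show "v \<in> arc_relint (ex_arc (k, p, q))"
  proof (rule arc_relint_combination[OF ex_arc_valid v(1)])
    show "0 < l * (4 - t) / 8" "0 < l * (4 + t) / 8" using v by (auto simp: abs_less_iff)
    show "v = (l * (4 - t) / 8) *\<^sub>R fst (ex_arc (k, p, q)) + (l * (4 + t) / 8) *\<^sub>R snd (ex_arc (k, p, q))"
      unfolding v(4) ex_arc_eq fst_conv snd_conv
      by (rule vec3_eqI[of _ k]) (simp_all add: field_simps)
  qed
qed

lemma end_on_next: "pt k (sign p) (sign q) (4 * sign r) \<in> arc_relint (ex_arc (nx k, q, r))"
proof -
  have "pt k (sign p) (sign q) (4 * sign r) = 2 *\<^sub>R pt (nx k) (sign q) (sign r) (sign p / 2)"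
    by (rule vec3_eqI[of _ k]) (use pt_nth[of "nx k"] in simp_all)
  moreover have "\<bar>sign p / 2\<bar> < 4" by (simp add: sign_def)
  ultimately have "\<exists>l t. 0 < l \<and> \<bar>t\<bar> < 4 \<and> pt k (sign p) (sign q) (4 * sign r) = l *\<^sub>R pt (nx k) (sign q) (sign r) t"
    by (intro exI[of _ "2::real"] exI[of _ "sign p / 2"] conjI) simp_all
  then show ?thesis unfolding ex_arc_relint using norm_pt by blast
qed

text \<open>Two of the coordinates give \<open>\<mu> = 2 * l\<close> and
  \<open>l * \<bar>t\<bar> = 2 * \<mu>\<close>, hence \<open>\<bar>t\<bar> = 4\<close>: such a point
  can only be an end of the first arc.\<close>

lemma cross_types:
  assumes "0 < l" "\<bar>t\<bar> < 4" "0 < \<mu>" "l *\<^sub>R pt k (sign p) (sign q) t = \<mu> *\<^sub>R pt (nx k) (sign p') (sign q') t'"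
  shows False
proof -
  have "(l *\<^sub>R pt k (sign p) (sign q) t) $ k = (\<mu> *\<^sub>R pt (nx k) (sign p') (sign q') t') $ nx (nx (nx k))"
    "(l *\<^sub>R pt k (sign p) (sign q) t) $ nx (nx k) = (\<mu> *\<^sub>R pt (nx k) (sign p') (sign q') t') $ nx (nx k)"
    using assms(4) by simp_all
  then have "l * t = \<mu> * (2 * sign q')" "l * (2 * sign q) = \<mu> * sign p'"
    unfolding vector_scaleR_component pt_nth by simp_all
  then have "\<bar>l * t\<bar> = 2 * \<mu>" "\<bar>l * (2 * sign q)\<bar> = \<mu>" using assms(3) by (simp_all add: abs_mult)
  then have "l * \<bar>t\<bar> = 2 * \<mu>" "2 * l = \<mu>" using assms(1) by (simp_all add: abs_mult)
  then have "l * \<bar>t\<bar> = l * 4" by simp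
  then show False using assms(1,2) by simp
qed

lemma ex_arc_relint_unique:
  assumes "v \<in> arc_relint (ex_arc (k, p, q))" "v \<in> arc_relint (ex_arc (k', p', q'))"
  shows "k = k' \<and> p = p' \<and> q = q'"
proof -
  obtain l t where v: "0 < l" "\<bar>t\<bar> < 4" "v = l *\<^sub>R pt k (sign p) (sign q) t" using assms(1) unfolding ex_arc_relint by blast
  obtain \<mu> t' where v': "0 < \<mu>" "\<bar>t'\<bar> < 4" "v = \<mu> *\<^sub>R pt k' (sign p') (sign q') t'" using assms(2) unfolding ex_arc_relint by blast
  have eq: "l *\<^sub>R pt k (sign p) (sign q) t = \<mu> *\<^sub>R pt k' (sign p') (sign q') t'" using v v' by simp
  consider "k' = k" | "k' = nx k" | "k = nx k'" using nx_cases[of k' k] by (metis nx_nx_nx)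
  then show ?thesis
  proof cases
    case 1
    have "l * sign p = \<mu> * sign p'" "l * sign q = \<mu> * sign q'"
      using arg_cong[OF eq, of "\<lambda>v. v $ nx k"] arg_cong[OF eq, of "\<lambda>v. v $ nx (nx k)"]
      unfolding 1 vector_scaleR_component pt_nth by simp_all
    then show ?thesis using v(1) v'(1) 1 by (auto simp: sign_def split: if_splits)
  next
    case 2
    then show ?thesis using cross_types[OF v(1,2) v'(1)] eq by blast
  next
    case 3
    then show ?thesis using cross_types[OF v'(1,2) v(1)] eq[symmetric] by blast
  qed
qed

lemma ex_arc_inj: "ex_arc (k, p, q) = ex_arc (k', p', q') \<Longrightarrow> k = k' \<and> p = p' \<and> q = q'"
  using ex_arc_relint_unique arc_relintI(1)[OF ex_arc_valid, of 1 1, OF _ _ refl] by (metis zero_less_one)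

lemma ex_oriented:
  assumes "a \<in> ex_diagram" "(e, w) \<in> {a, prod.swap a}"
  obtains k p q r where "a = ex_arc (k, p, q)" "e = pt k (sign p) (sign q) (4 * sign r)" "w = pt k (sign p) (sign q) (- (4 * sign r))"
proof -
  obtain k p q where a: "a = ex_arc (k, p, q)" using assms(1) unfolding ex_diagram_def by auto
  have "(e, w) = a \<or> (e, w) = prod.swap a" using assms(2) by auto
  then show ?thesis
  proof
    assume "(e, w) = a"
    then show ?thesis using that[of k p q False] a by (simp add: ex_arc_eq sign_def)
  next
    assume "(e, w) = prod.swap a"
    then show ?thesis using that[of k p q True] a by (simp add: ex_arc_eq sign_def)
  qed
qed

lemma end_hits_only_next:
  assumes "pt k (sign p) (sign q) (4 * sign r) \<in> arc_relint a" "a \<in> ex_diagram"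
  shows "a = ex_arc (nx k, q, r)"
  using assms ex_arc_relint_unique[OF end_on_next[of k p q r]] unfolding ex_diagram_def by auto

lemma ex_diagram_SD: "SD ex_diagram"
  unfolding SD_def
proof (intro conjI ballI impI)
  show "finite ex_diagram" "ex_diagram \<noteq> {}" by (simp_all add: ex_diagram_def)
  show "valid_arc a" if "a \<in> ex_diagram" for a using that ex_arc_valid by (auto simp: ex_diagram_def)
  show "arc_relint a \<inter> arc_relint b = {}" if "a \<in> ex_diagram" "b \<in> ex_diagram" "a \<noteq> b" for a b
    using that ex_arc_relint_unique unfolding ex_diagram_def by (auto simp: disjoint_iff) blast+
  show "\<exists>c\<in>ex_diagram. e \<in> arc_relint c" if ae: "a \<in> ex_diagram" "e \<in> endpoints a" for a e
  proof -
    obtain w where "(e, w) \<in> {a, prod.swap a}" using ae(2) by (cases a) (auto simp: endpoints_def)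
    then obtain k p q r where "e = pt k (sign p) (sign q) (4 * sign r)" using ex_oriented[OF ae(1)] by metis
    then show ?thesis using end_on_next unfolding ex_diagram_def by blast
  qed
qed

lemma ex_normal: "cross3 (pt k a b (- x)) (pt k a b x) \<bullet> v = x * (4 * b * v $ nx k - 2 * a * v $ nx (nx k)) / 21"
  unfolding inner_nx[of _ v k] cross3_nx using pt_nth[of k]
  by (simp add: field_simps)

lemma ex_diagram_SOD: "SOD ex_diagram"
  unfolding SOD_def
proof (intro conjI ballI allI impI ex_diagram_SD)
  \<comment> \<open>The far end of a hitting arc lies on a side given by the signs of the arc that
    is hit alone.\<close>
  have side: "sgn (arc_normal a \<bullet> w) = sgn (sign p * sign q)"
    if ab: "a = ex_arc (k, p, q)" "b \<in> ex_diagram" "(e, w) \<in> {b, prod.swap b}" "e \<in> arc_relint a" for a b e w k p q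
  proof -
    obtain j p' q' r where b: "e = pt j (sign p') (sign q') (4 * sign r)" "w = pt j (sign p') (sign q') (- (4 * sign r))"
      using ex_oriented[OF ab(2,3)] by metis
    then have "ex_arc (k, p, q) = ex_arc (nx j, q', r)" using end_hits_only_next ab(1,4) by (simp add: ex_diagram_def)
    then have eq: "k = nx j" "p = q'" "q = r" using ex_arc_inj by blast+
    have "arc_normal a \<bullet> w = 4 * (4 * sign q * w $ nx k - 2 * sign p * w $ nx (nx k)) / 21"
      unfolding ab(1) ex_arc_eq arc_normal_def fst_conv snd_conv using ex_normal[of k "sign p" "sign q" 4 w] by simp
    also have "\<dots> = 64 / (21 * sqrt 21) * (sign p * sign q)"
      unfolding b(2) eq using pt_nth[of j] by (simp add: field_simps)
    finally show ?thesis by (simp add: sgn_mult)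
  qed
  fix a b c e w e' w' assume "a \<in> ex_diagram" "b \<in> ex_diagram" "c \<in> ex_diagram"
    and h: "(e, w) \<in> {b, prod.swap b} \<and> e \<in> arc_relint a \<and> (e', w') \<in> {c, prod.swap c} \<and> e' \<in> arc_relint a"
  obtain k p q where "a = ex_arc (k, p, q)" using \<open>a \<in> ex_diagram\<close> unfolding ex_diagram_def by auto
  then show "sgn (arc_normal a \<bullet> w) = sgn (arc_normal a \<bullet> w')"
    using side[of a k p q b e w] side[of a k p q c e' w'] \<open>b \<in> ex_diagram\<close> \<open>c \<in> ex_diagram\<close> h by simp
qed

lemma ex_diagram_oriented: "k_oriented 3 ex_diagram"
proof -
  define f where "f a = axis (SOME k. \<exists>p q. a = ex_arc (k, p, q)) (1::real)" for a
  have f: "f (ex_arc (k, p, q)) = axis k 1" for k p q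
  proof -
    have "(SOME j. \<exists>p' q'. ex_arc (k, p, q) = ex_arc (j, p', q')) = k"
      by (rule some_equality) (use ex_arc_inj in blast)+
    then show ?thesis by (simp add: f_def)
  qed
  define P where "P = range (\<lambda>k::3. axis k (1::real))"
  have "inj (\<lambda>k::3. axis k (1::real))" by (rule injI) (simp add: axis_eq_axis)
  then have cP: "card P = 3" unfolding P_def by (simp add: card_image)
  have axis_nth: "axis k (1::real) $ nx k = 0" for k by (simp add: axis_def)
  \<comment> \<open>The coordinate at position \<open>nx k\<close> is constant and nonzero along the
    chord, while it is zero for the poles of this type.\<close>
  have off: "v $ nx k \<noteq> 0" if v: "v \<in> arc_points (ex_arc (k, p, q))" for v k p q
  proof -
    obtain x where x: "x \<in> closed_segment (pt k (sign p) (sign q) (- 4)) (pt k (sign p) (sign q) 4)" "v = x /\<^sub>R norm x"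
      using v unfolding arc_points_def ex_arc_eq by auto
    then obtain t where t: "x = (1 - t) *\<^sub>R pt k (sign p) (sign q) (- 4) + t *\<^sub>R pt k (sign p) (sign q) 4"
      by (auto simp: in_segment)
    have "x $ nx k = sign p / sqrt 21"
      unfolding t vector_add_component vector_scaleR_component pt_nth by (simp add: field_simps)
    then have "x $ nx k \<noteq> 0" by simp
    moreover have "norm x \<noteq> 0" using calculation by auto
    ultimately show ?thesis unfolding x(2) by simp
  qed
  show ?thesis unfolding k_oriented_def
  proof (intro exI[of _ P] exI[of _ f] conjI ballI)
    show "P \<subseteq> S2" by (auto simp: P_def S2_def norm_axis_1)
    show "q \<noteq> - p" if pq: "p \<in> P" "q \<in> P" for p q
    proof
      assume "q = - p"
      obtain j k where "p = axis j (1::real)" "q = axis k (1::real)" using pq by (auto simp: P_def)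
      then have "axis k (1::real) $ k = (- axis j (1::real)) $ k" using \<open>q = - p\<close> by simp
      then show False by (simp add: axis_def split: if_splits)
    qed
    fix a assume "a \<in> ex_diagram"
    then obtain k p q where a: "a = ex_arc (k, p, q)" unfolding ex_diagram_def by auto
    show "f a \<in> P" "f a \<notin> arc_points a" "- f a \<notin> arc_points a"
      unfolding a f using off[of "axis k 1" k p q] off[of "- axis k 1" k p q] axis_nth[of k] by (auto simp: P_def)
    have "arc_normal a \<bullet> axis k 1 = 4 * (4 * sign q * axis k 1 $ nx k - 2 * sign p * axis k 1 $ nx (nx k)) / 21"
      unfolding a ex_arc_eq arc_normal_def fst_conv snd_conv using ex_normal[of k "sign p" "sign q" 4 "axis k 1"] by simp
    then show "arc_normal a \<bullet> f a = 0" unfolding a f by (simp add: axis_def)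
  qed (rule cP)
qed

text \<open>The three arcs that meet in the octant \<sigma>: the arc of type \<open>k\<close>
  carries the signs of the two other coordinates.\<close>

definition ex_swirl :: "(3 \<Rightarrow> bool) \<Rightarrow> (arc \<times> arc) set" where
  "ex_swirl \<sigma> = range (\<lambda>k. (ex_arc (k, \<sigma> (nx k), \<sigma> (nx (nx k))), ex_arc (nx k, \<sigma> (nx (nx k)), \<sigma> k)))"

text \<open>The term with 64 dominates. So the direction of the turn decides, given the signs
  \<open>q\<close> and \<open>r\<close>, at which end the next arc is left.\<close>

lemma ex_turn:
  "cross3 (pt k (sign p) (sign q) (- (4 * sign r))) (pt k (sign p) (sign q) (4 * sign r)) \<bullet> pt (nx k) (sign q) (sign r) (4 * sign r')
    = sign q * sign r * (64 * sign r' - 8 * sign p) / (21 * sqrt 21)"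
  unfolding ex_normal using pt_nth[of "nx k"] by (simp add: field_simps)

lemma ex_turn_pos:
  "cross3 (pt k (sign p) (sign q) (- (4 * sign r))) (pt k (sign p) (sign q) (4 * sign r)) \<bullet> pt (nx k) (sign q) (sign r) (4 * sign r') > 0
    \<longleftrightarrow> r' = (q = r)"
  unfolding ex_turn by (cases p; cases q; cases r; cases r') (simp_all add: sign_def)

lemma ex_turn_neg:
  "cross3 (pt k (sign p) (sign q) (- (4 * sign r))) (pt k (sign p) (sign q) (4 * sign r)) \<bullet> pt (nx k) (sign q) (sign r) (4 * sign r') < 0
    \<longleftrightarrow> r' = (q \<noteq> r)"
  unfolding ex_turn by (cases p; cases q; cases r; cases r') (simp_all add: sign_def)

text \<open>From arc to arc the signs shift by one place, and the common direction of the turns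
  determines the new sign from the last two. Such a sequence has period 3, so its signs name an
  octant.\<close>

lemma ex_swirl_edges:
  assumes "swirl ex_diagram xs"
  shows "\<exists>\<sigma>. swirl_edges xs = ex_swirl \<sigma>"
proof -
  define n where "n = length xs"
  obtain ps qs where s: "xs \<noteq> []" "set xs \<subseteq> ex_diagram"
    "\<And>i. i < n \<Longrightarrow> (ps ! i, qs ! i) \<in> {xs ! i, prod.swap (xs ! i)} \<and> ps ! i \<in> arc_relint (xs ! ((i + 1) mod n))"
    "(\<forall>i<n. cross3 (qs ! i) (ps ! i) \<bullet> ps ! ((i + 1) mod n) > 0) \<or> (\<forall>i<n. cross3 (qs ! i) (ps ! i) \<bullet> ps ! ((i + 1) mod n) < 0)"
    using assms unfolding swirl_def n_def by blast
  have n: "n > 0" using s(1) by (simp add: n_def)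
  have mem: "xs ! (i mod n) \<in> ex_diagram" for i
  proof -
    have "xs ! (i mod n) \<in> set xs" using n by (simp add: n_def)
    then show ?thesis using s(2) by (rule subsetD[rotated])
  qed
  define side where "side i k p q r \<longleftrightarrow> xs ! (i mod n) = ex_arc (k, p, q)
      \<and> ps ! (i mod n) = pt k (sign p) (sign q) (4 * sign r) \<and> qs ! (i mod n) = pt k (sign p) (sign q) (- (4 * sign r))"
    for i k p q r
  have "\<exists>k p q r. side i k p q r" for i
  proof -
    have "i mod n < n" using n by simp
    then show ?thesis using ex_oriented[OF mem] s(3)[of "i mod n"] unfolding side_def by metis
  qed
  then obtain K p q r where "\<And>i. side i (K i) (p i) (q i) (r i)" by metis
  then have X: "xs ! (i mod n) = ex_arc (K i, p i, q i)" "ps ! (i mod n) = pt (K i) (sign (p i)) (sign (q i)) (4 * sign (r i))"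
    "qs ! (i mod n) = pt (K i) (sign (p i)) (sign (q i)) (- (4 * sign (r i)))" for i
    unfolding side_def by blast+
  have sm: "(i mod n + 1) mod n = Suc i mod n" for i by (simp add: mod_Suc_eq)
  have nxt: "xs ! (Suc i mod n) = ex_arc (nx (K i), q i, r i)" for i
    using end_hits_only_next[of "K i" "p i" "q i" "r i" "xs ! (Suc i mod n)"] s(3)[of "i mod n"] n mem[of "Suc i"]
    unfolding X(2)[symmetric] sm by simp
  then have step: "K (Suc i) = nx (K i)" "p (Suc i) = q i" "q (Suc i) = r i" for i
    using X(1)[of "Suc i"] ex_arc_inj by metis+
  have turns: "(\<forall>i. r (Suc i) = (q i = r i)) \<or> (\<forall>i. r (Suc i) = (q i \<noteq> r i))"
    using s(4)
  proof
    assume a: "\<forall>i<n. cross3 (qs ! i) (ps ! i) \<bullet> ps ! ((i + 1) mod n) > 0"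
    have "r (Suc i) = (q i = r i)" for i
    proof -
      have "cross3 (qs ! (i mod n)) (ps ! (i mod n)) \<bullet> ps ! (Suc i mod n) > 0" using a n sm by (metis mod_less_divisor)
      then show ?thesis unfolding X step ex_turn_pos .
    qed
    then show ?thesis by blast
  next
    assume a: "\<forall>i<n. cross3 (qs ! i) (ps ! i) \<bullet> ps ! ((i + 1) mod n) < 0"
    have "r (Suc i) = (q i \<noteq> r i)" for i
    proof -
      have "cross3 (qs ! (i mod n)) (ps ! (i mod n)) \<bullet> ps ! (Suc i mod n) < 0" using a n sm by (metis mod_less_divisor)
      then show ?thesis unfolding X step ex_turn_neg .
    qed
    then show ?thesis by blast
  qed
  \<comment> \<open>The rule is applied twice: \<open>r (Suc i)\<close> compares \<open>q i\<close>
    with \<open>r i\<close>, and the next sign compares this again with \<open>r i\<close>, which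
    cancels.\<close>
  have q: "q i = r (Suc (Suc i))" for i using turns step by metis
  have r3: "r (Suc (Suc (Suc i))) = r i" for i using q[of "Suc i"] step by simp
  have same: "ex_arc (K (i + n), p (i + n), q (i + n)) = ex_arc (K i, p i, q i)" for i
    using X(1)[of i] X(1)[of "i + n"] by simp
  have per: "p (i + n) = p i" "q (i + n) = q i" for i
    using ex_arc_inj[OF same[of i]] by blast+
  have "q (Suc (Suc i) + n) = q (Suc (Suc i))" for i by (rule per(2))
  then have per_r: "r (Suc (i + n)) = r (Suc i)" for i unfolding add_Suc step(3) .
  have p: "p i = r (Suc i)" for i
  proof -
    \<comment> \<open>The recursion describes \<open>p\<close> only at successors; shifting by the
      length of the swirl gives index 0 a predecessor.\<close>
    obtain m where m: "i + n = Suc m" using n by (cases "i + n") auto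
    have "p (i + n) = r (Suc (i + n))" unfolding m using step(2)[of m] q[of m] by simp
    then show ?thesis unfolding per(1) per_r .
  qed
  define \<sigma> where "\<sigma> = (\<lambda>k. if k = K 0 then r 0 else if k = nx (K 0) then r 1 else r 2)"
  have \<sigma>: "\<sigma> (K i) = r i \<and> \<sigma> (nx (K i)) = r (Suc i) \<and> \<sigma> (nx (nx (K i))) = r (Suc (Suc i))" for i
  proof (induction i)
    case 0
    show ?case by (simp add: \<sigma>_def numeral_2_eq_2)
  next
    case (Suc i)
    then show ?case by (simp add: step r3)
  qed
  have edge: "(xs ! (i mod n), xs ! (Suc i mod n))
      = (ex_arc (K i, \<sigma> (nx (K i)), \<sigma> (nx (nx (K i)))), ex_arc (nx (K i), \<sigma> (nx (nx (K i))), \<sigma> (K i)))" for i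
    using X(1)[of i] nxt[of i] \<sigma>[of i] p[of i] q[of i] by simp
  have "swirl_edges xs = ex_swirl \<sigma>"
  proof
    show "swirl_edges xs \<subseteq> ex_swirl \<sigma>"
    proof
      fix z assume "z \<in> swirl_edges xs"
      then obtain i where "i < n" "z = (xs ! i, xs ! ((i + 1) mod n))" unfolding swirl_edges_def n_def by blast
      then have "z = (xs ! (i mod n), xs ! (Suc i mod n))" by simp
      then show "z \<in> ex_swirl \<sigma>" unfolding edge ex_swirl_def by blast
    qed
    show "ex_swirl \<sigma> \<subseteq> swirl_edges xs"
    proof
      fix z assume "z \<in> ex_swirl \<sigma>"
      then obtain k where k: "z = (ex_arc (k, \<sigma> (nx k), \<sigma> (nx (nx k))), ex_arc (nx k, \<sigma> (nx (nx k)), \<sigma> k))"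
        unfolding ex_swirl_def by blast
      have "k = K 0 \<or> k = K (Suc 0) \<or> k = K (Suc (Suc 0))" unfolding step by (rule nx_cases)
      then obtain i where "k = K i" by blast
      then have "z = (xs ! (i mod n), xs ! ((i mod n + 1) mod n))" unfolding k sm edge by simp
      then show "z \<in> swirl_edges xs" unfolding swirl_edges_def n_def[symmetric] using n by (auto intro!: exI[of _ "i mod n"])
    qed
  qed
  then show ?thesis by blast
qed

text \<open>There are only eight sign patterns. Equality follows from the general lower bound, and
  likewise for the number of arcs.\<close>

lemma ex_diagram_swirls: "card (swirls ex_diagram) \<le> 8"
proof -
  have "swirls ex_diagram \<subseteq> range ex_swirl" unfolding swirls_def using ex_swirl_edges by blast
  then have "card (swirls ex_diagram) \<le> card (range ex_swirl)" by (rule card_mono[rotated]) simp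
  also have "\<dots> \<le> card (UNIV :: (3 \<Rightarrow> bool) set)" by (rule card_image_le) simp
  finally show ?thesis by (simp add: card_fun)
qed

lemma ex_diagram_card: "card ex_diagram \<le> 12"
proof -
  have "card ex_diagram \<le> card (UNIV :: (3 \<times> bool \<times> bool) set)" unfolding ex_diagram_def by (rule card_image_le) simp
  then show ?thesis by simp
qed

theorem mainTheorem2:
  shows "(\<forall>D. SD D \<and> k_oriented 3 D \<longrightarrow> 8 \<le> card (swirls D) \<and> 12 \<le> card D)
       \<and> (\<exists>D. SOD D \<and> k_oriented 3 D \<and> card (swirls D) = 8 \<and> card D = 12)"
  using lower_bounds ex_diagram_SOD ex_diagram_oriented lower_bounds[OF ex_diagram_SD ex_diagram_oriented] ex_diagram_swirls ex_diagram_card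
  by (meson le_antisym)

end
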